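(* For every positive integer $n$, the extra slow Tamari lattice $\operatorname{esTam}_n$ is (1) semidistributive; (2) extremal; (3) trim; (4) polygonal, and each of its polygons is either a quadrilateral (both maximal chains of length $2$) or a heptagon (one maximal chain of length $2$ and the other of length $5$); (5) congruence uniform.
   Context: Let $n$ be a positive integer. The board of size $n$ is the Ferrers diagram of shape $(n,n,n-1,n-2,\dots,3,2)$ (a single cell $(1,1)$ if $n=1$). Its cells are written $(i,j)$, where $i$ is the row, numbered from the top, and $j$ is the column label, the columns being labelled $n,n-1,\dots,1$ from left to right. So the cells are $(1,j)$ for $1\le j\le n$ and $(i,j)$ for $2\le i\le n$, $i-1\le j\le n$. The root is $(1,n)$ (top-left cell); the border cells are $(i,i-1)$ for $2\le i\le n$ (the rightmost cells of rows $2,\dots,n$). An fb-tableau of size $n$ is a filling in which each cell is either empty or nonempty such that the root and all border cells are nonempty, and every nonempty cell other than the root has a nonempty cell strictly to its left in the same row or strictly above it in the same column. In an fb-tableau, a nonempty cell different from the root is called a left-arrow if there is no nonempty cell strictly to its left in its row, an up-arrow if there is no nonempty cell strictly above it in its column, and a dot otherwise; the root is also a dot. (Each of rows $2,\dots,n$ has exactly one left-arrow, each of columns $1,\dots,n-1$ has exactly one up-arrow.) A cell is free in $T$ if it lies strictly below an up-arrow (same column) and strictly to the right of a left-arrow (same row); a free cell is either empty or contains a dot. $\operatorname{Row}(T)$ is the set of cells lying weakly to the right of a left-arrow or of the root in the same row; $\operatorname{Col}(T)$ is the set of cells lying weakly below an up-arrow or the root in the same column. For fb-tableaux $S,T$ of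 size $n$, write $S\lhd T$ if (1) $\operatorname{Col}(S)\subseteq\operatorname{Col}(T)$; (2) $\operatorname{Row}(T)\subseteq\operatorname{Row}(S)$; (3) for every cell $c$ that is free in both $S$ and $T$, if $c$ contains a dot in $S$ then $c$ contains a dot in $T$. The extra slow Tamari lattice $\operatorname{esTam}_n$ is the set of fb-tableaux of size $n$ ordered by $\lhd$; it is a finite lattice. Lattice notions, for a finite lattice $L$. The length of a chain is its number of elements minus one. An element is join-irreducible (resp. meet-irreducible) if it covers (resp. is covered by) exactly one element. $L$ is semidistributive if for all $x,y,z$: $x\vee z=y\vee z$ implies $(x\wedge y)\vee z=x\vee z$, and $x\wedge z=y\wedge z$ implies $(x\vee y)\wedge z=x\wedge z$. $L$ is extremal if the length of its longest chain equals both its number of join-irreducible and its number of meet-irreducible elements. An element $x$ is left modular if $(y\wedge x)\vee z=y\vee(x\wedge z)$ for all $y\le z$; $L$ is left modular if it has a maximal chain all of whose elements are left modular; $L$ is trim if it is left modular and extremal. A polygon is an interval $[x,y]$ that is the union of two distinct maximal chains from $x$ to $y$ which intersect only at $x$ and $y$. $L$ is polygonal if: whenever $y_1\neq y_2$ both cover $x$, $[x,y_1\vee y_2]$ is a polygon; and whenever $y_1\ne y_2$ are both covered by $x$, $[y_1\wedge y_2,x]$ is a polygon. A congruence is an equivalence relation compatible with $\wedge$ and $\vee$; the congruences form a lattice $\operatorname{Con}L$ under inclusion, and $\operatorname{con}(x,y)$ is the smallest congruence identifying $x$ and $y$. For $\mathbf j$ join-irreducible with unique lower cover $\mathbf j_*$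 put $\operatorname{con}(\mathbf j)=\operatorname{con}(\mathbf j_*,\mathbf j)$; for $\mathbf m$ meet-irreducible with unique upper cover $\mathbf m^*$ put $\operatorname{con}(\mathbf m)=\operatorname{con}(\mathbf m,\mathbf m^* )$. $L$ is congruence uniform if $\mathbf j\mapsto\operatorname{con}(\mathbf j)$ and $\mathbf m\mapsto\operatorname{con}(\mathbf m)$ are bijections from the join-irreducible, resp. meet-irreducible, elements of $L$ onto the join-irreducible elements of $\operatorname{Con}L$.
   Formalization: Left modularity uses the standard identity (y∨x)∧z = y∨(x∧z) for y≤z (the printed one holds only for the top), and "each of its polygons" means the intervals [x,y1∨y2], [y1∧y2,x] from the definition of polygonal, since a 2×3 grid also meets the literal definition of polygon. *)

theory Defs
  imports "HOL-Algebra.Complete_Lattice"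
begin

section \<open>Finite lattices\<close>

text \<open>
  Lattices are HOL-Algebra records: \<open>le\<close> is the order, and the locale \<open>lattice\<close> forces
  the equality field to be genuine equality on the carrier.
\<close>

locale finite_lattice = lattice +
  assumes finite_carrier: "finite (carrier L)"

text \<open>\<open>covers L y x\<close> reads: \<open>y\<close> covers \<open>x\<close>.\<close>

definition covers :: "'a gorder \<Rightarrow> 'a \<Rightarrow> 'a \<Rightarrow> bool" where
  "covers L y x \<longleftrightarrow> x \<in> carrier L \<and> y \<in> carrier L \<and> x \<sqsubset>\<^bsub>L\<^esub> y \<and>
     \<not> (\<exists>z\<in>carrier L. x \<sqsubset>\<^bsub>L\<^esub> z \<and> z \<sqsubset>\<^bsub>L\<^esub> y)"

definition join_irreducibles :: "'a gorder \<Rightarrow> 'a set" where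
  "join_irreducibles L = {j \<in> carrier L. \<exists>!x. covers L j x}"

definition meet_irreducibles :: "'a gorder \<Rightarrow> 'a set" where
  "meet_irreducibles L = {m \<in> carrier L. \<exists>!y. covers L y m}"

definition lower_cover :: "'a gorder \<Rightarrow> 'a \<Rightarrow> 'a" where
  "lower_cover L j = (THE x. covers L j x)"

definition upper_cover :: "'a gorder \<Rightarrow> 'a \<Rightarrow> 'a" where
  "upper_cover L m = (THE y. covers L y m)"

definition semidistributive :: "'a gorder \<Rightarrow> bool" where
  "semidistributive L \<longleftrightarrow> (\<forall>x\<in>carrier L. \<forall>y\<in>carrier L. \<forall>z\<in>carrier L.
     (x \<squnion>\<^bsub>L\<^esub> z = y \<squnion>\<^bsub>L\<^esub> z \<longrightarrow> (x \<sqinter>\<^bsub>L\<^esub> y) \<squnion>\<^bsub>L\<^esub> z = x \<squnion>\<^bsub>L\<^esub> z) \<and>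
     (x \<sqinter>\<^bsub>L\<^esub> z = y \<sqinter>\<^bsub>L\<^esub> z \<longrightarrow> (x \<squnion>\<^bsub>L\<^esub> y) \<sqinter>\<^bsub>L\<^esub> z = x \<sqinter>\<^bsub>L\<^esub> z))"

definition chain_length :: "'a set \<Rightarrow> nat" where
  "chain_length C = card C - 1"

definition max_chain_length :: "'a gorder \<Rightarrow> nat" where
  "max_chain_length L = Max {chain_length C | C. pred_on.chain (carrier L) (le L) C}"

definition extremal :: "'a gorder \<Rightarrow> bool" where
  "extremal L \<longleftrightarrow> max_chain_length L = card (join_irreducibles L) \<and>
     max_chain_length L = card (meet_irreducibles L)"

text \<open>
  The standard modular-pair identity \<open>(y \<or> x) \<and> z = y \<or> (x \<and> z)\<close> for all \<open>y \<le> z\<close>. (With the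
  operations on the left interchanged, only the top element would satisfy it.)
\<close>

definition left_modular_element :: "'a gorder \<Rightarrow> 'a \<Rightarrow> bool" where
  "left_modular_element L x \<longleftrightarrow> x \<in> carrier L \<and>
     (\<forall>y\<in>carrier L. \<forall>z\<in>carrier L. y \<sqsubseteq>\<^bsub>L\<^esub> z \<longrightarrow>
        (y \<squnion>\<^bsub>L\<^esub> x) \<sqinter>\<^bsub>L\<^esub> z = y \<squnion>\<^bsub>L\<^esub> (x \<sqinter>\<^bsub>L\<^esub> z))"

definition left_modular :: "'a gorder \<Rightarrow> bool" where
  "left_modular L \<longleftrightarrow>
     (\<exists>C. pred_on.maxchain (carrier L) (le L) C \<and> (\<forall>x\<in>C. left_modular_element L x))"

definition trim :: "'a gorder \<Rightarrow> bool" where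
  "trim L \<longleftrightarrow> left_modular L \<and> extremal L"


section \<open>Polygons\<close>

definition polygon_sides :: "'a gorder \<Rightarrow> 'a \<Rightarrow> 'a \<Rightarrow> 'a set \<Rightarrow> 'a set \<Rightarrow> bool" where
  "polygon_sides L x y C D \<longleftrightarrow> x \<in> carrier L \<and> y \<in> carrier L \<and>
     pred_on.maxchain (\<lbrace>x..y\<rbrace>\<^bsub>L\<^esub>) (le L) C \<and> pred_on.maxchain (\<lbrace>x..y\<rbrace>\<^bsub>L\<^esub>) (le L) D \<and>
     C \<noteq> D \<and> C \<union> D = \<lbrace>x..y\<rbrace>\<^bsub>L\<^esub> \<and> C \<inter> D = {x, y}"

definition polygon :: "'a gorder \<Rightarrow> 'a \<Rightarrow> 'a \<Rightarrow> bool" where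
  "polygon L x y \<longleftrightarrow> (\<exists>C D. polygon_sides L x y C D)"

definition quadrilateral :: "'a gorder \<Rightarrow> 'a \<Rightarrow> 'a \<Rightarrow> bool" where
  "quadrilateral L x y \<longleftrightarrow>
     (\<exists>C D. polygon_sides L x y C D \<and> chain_length C = 2 \<and> chain_length D = 2)"

definition heptagon :: "'a gorder \<Rightarrow> 'a \<Rightarrow> 'a \<Rightarrow> bool" where
  "heptagon L x y \<longleftrightarrow>
     (\<exists>C D. polygon_sides L x y C D \<and> chain_length C = 2 \<and> chain_length D = 5)"

definition polygonal :: "'a gorder \<Rightarrow> bool" where
  "polygonal L \<longleftrightarrow>
     (\<forall>x y1 y2. y1 \<noteq> y2 \<and> covers L y1 x \<and> covers L y2 x \<longrightarrow> polygon L x (y1 \<squnion>\<^bsub>L\<^esub> y2)) \<and>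
     (\<forall>x y1 y2. y1 \<noteq> y2 \<and> covers L x y1 \<and> covers L x y2 \<longrightarrow> polygon L (y1 \<sqinter>\<^bsub>L\<^esub> y2) x)"

text \<open>
  The polygons of a polygonal lattice are the intervals occurring in the definition of
  polygonality, given here by their end points. Not every interval satisfying \<open>polygon\<close> is of this
  form: a 2 by 3 grid is the union of two of its maximal chains that meet only at the ends, but it
  has a third maximal chain and is not spanned by two covers.
\<close>

definition polygons_of :: "'a gorder \<Rightarrow> ('a \<times> 'a) set" where
  "polygons_of L =
     {(x, y1 \<squnion>\<^bsub>L\<^esub> y2) | x y1 y2. y1 \<noteq> y2 \<and> covers L y1 x \<and> covers L y2 x} \<union>
     {(y1 \<sqinter>\<^bsub>L\<^esub> y2, x) | x y1 y2. y1 \<noteq> y2 \<and> covers L x y1 \<and> covers L x y2}"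


section \<open>Congruences\<close>

definition lattice_congruence :: "'a gorder \<Rightarrow> ('a \<times> 'a) set \<Rightarrow> bool" where
  "lattice_congruence L \<theta> \<longleftrightarrow> equiv (carrier L) \<theta> \<and>
     (\<forall>x x' y y'. (x, x') \<in> \<theta> \<and> (y, y') \<in> \<theta> \<longrightarrow>
        (x \<sqinter>\<^bsub>L\<^esub> y, x' \<sqinter>\<^bsub>L\<^esub> y') \<in> \<theta> \<and> (x \<squnion>\<^bsub>L\<^esub> y, x' \<squnion>\<^bsub>L\<^esub> y') \<in> \<theta>)"

definition Con :: "'a gorder \<Rightarrow> ('a \<times> 'a) set gorder" where
  "Con L = \<lparr>carrier = {\<theta>. lattice_congruence L \<theta>}, eq = (=), le = (\<subseteq>)\<rparr>"

definition con :: "'a gorder \<Rightarrow> 'a \<Rightarrow> 'a \<Rightarrow> ('a \<times> 'a) set" where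
  "con L x y = (THE \<theta>. least (Con L) \<theta> {\<theta> \<in> carrier (Con L). (x, y) \<in> \<theta>})"

definition congruence_uniform :: "'a gorder \<Rightarrow> bool" where
  "congruence_uniform L \<longleftrightarrow>
     bij_betw (\<lambda>j. con L (lower_cover L j) j) (join_irreducibles L) (join_irreducibles (Con L)) \<and>
     bij_betw (\<lambda>m. con L m (upper_cover L m)) (meet_irreducibles L) (join_irreducibles (Con L))"


section \<open>Fb-tableaux\<close>

text \<open>
  In a cell \<open>(i, j)\<close> the row index \<open>i\<close> grows downwards, whereas the column label \<open>j\<close> decreases
  from left to right; so ``left'' means larger \<open>j\<close> and ``above'' means smaller \<open>i\<close>. A tableau is
  represented by its set of nonempty cells.
\<close>

type_synonym cell = "nat \<times> nat"

definition board :: "nat \<Rightarrow> cell set" where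
  "board n = {(1, j) | j. 1 \<le> j \<and> j \<le> n} \<union> {(i, j) | i j. 2 \<le> i \<and> i \<le> n \<and> i - 1 \<le> j \<and> j \<le> n}"

definition root :: "nat \<Rightarrow> cell" where
  "root n = (1, n)"

definition border :: "nat \<Rightarrow> cell set" where
  "border n = {(i, i - 1) | i. 2 \<le> i \<and> i \<le> n}"

definition has_left :: "cell set \<Rightarrow> cell \<Rightarrow> bool" where
  "has_left T c \<longleftrightarrow> (\<exists>j. (fst c, j) \<in> T \<and> j > snd c)"

definition has_above :: "cell set \<Rightarrow> cell \<Rightarrow> bool" where
  "has_above T c \<longleftrightarrow> (\<exists>i. (i, snd c) \<in> T \<and> i < fst c)"

definition fb_tableaux :: "nat \<Rightarrow> cell set set" where
  "fb_tableaux n = {T. T \<subseteq> board n \<and> root n \<in> T \<and> border n \<subseteq> T \<and>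
     (\<forall>c\<in>T. c \<noteq> root n \<longrightarrow> has_left T c \<or> has_above T c)}"

definition left_arrows :: "nat \<Rightarrow> cell set \<Rightarrow> cell set" where
  "left_arrows n T = {c \<in> T. c \<noteq> root n \<and> \<not> has_left T c}"

definition up_arrows :: "nat \<Rightarrow> cell set \<Rightarrow> cell set" where
  "up_arrows n T = {c \<in> T. c \<noteq> root n \<and> \<not> has_above T c}"

definition dots :: "nat \<Rightarrow> cell set \<Rightarrow> cell set" where
  "dots n T = T - left_arrows n T - up_arrows n T"

definition free_cells :: "nat \<Rightarrow> cell set \<Rightarrow> cell set" where
  "free_cells n T = {(i, j) \<in> board n.
     (\<exists>i'<i. (i', j) \<in> up_arrows n T) \<and> (\<exists>j'>j. (i, j') \<in> left_arrows n T)}"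

definition Row :: "nat \<Rightarrow> cell set \<Rightarrow> cell set" where
  "Row n T = {(i, j) \<in> board n. \<exists>j'\<ge>j. (i, j') \<in> left_arrows n T \<union> {root n}}"

definition Col :: "nat \<Rightarrow> cell set \<Rightarrow> cell set" where
  "Col n T = {(i, j) \<in> board n. \<exists>i'\<le>i. (i', j) \<in> up_arrows n T \<union> {root n}}"

definition fb_le :: "nat \<Rightarrow> cell set \<Rightarrow> cell set \<Rightarrow> bool" where
  "fb_le n S T \<longleftrightarrow> Col n S \<subseteq> Col n T \<and> Row n T \<subseteq> Row n S \<and>
     (\<forall>c \<in> free_cells n S \<inter> free_cells n T. c \<in> dots n S \<longrightarrow> c \<in> dots n T)"

definition esTam :: "nat \<Rightarrow> cell set gorder" where
  "esTam n = \<lparr>carrier = fb_tableaux n, eq = (=), le = fb_le n\<rparr>"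

end

theory Submission
  imports Defs
begin

text \<open>
  Process the cells of a tableau away from the border. A cell that is neither strictly left of (in
  its row) nor strictly above (in its column) the already known arrows can be filled freely, in
  one of four linearly ordered ways (three on the border): up-arrow, empty, dot, left-arrow. An
  up-arrow forces the cells above it and a left-arrow forces the cells to the left of it. So
  \<open>esTam n\<close> arises from a point by replacing intervals by products with chains, and a
  tableau is encoded by an array \<open>a\<close> of states. These arrays are closed under pointwise minima,
  which are the meets. The dual array \<open>b\<close> counts the steps that remain; \<open>S \<le> T\<close> holds iff
  \<open>a S + b T\<close> never exceeds the number of steps of a cell. Transposing the board, reversing
  the order and exchanging \<open>a\<close> with \<open>b\<close> is a symmetry.

  The join- and the meet-irreducible elements are indexed by the pairs of a cell and a step.
  Elements with \<open>a + b\<close> maximal everywhere are left modular and contain a chain with one step per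
  pair. The congruences that remember only a step and everything closer to the border separate
  the congruences of the join-irreducibles. Two covers of an element are given by
  raising two cells; they span a quadrilateral unless these cells block each other at the corner
  cell above one and left of the other, which then runs through its four states on one side only.
\<close>

section \<open>Covers and congruences in finite lattices\<close>

text \<open>The obstacle is the cell that is shadowed from both sides. There \<open>a\<close> and
  \<open>b\<close> both vanish, so \<open>a + b\<close> is not constant, neither array is a cellwise
  function of the other, and joins are not pointwise maxima of \<open>a\<close> (they are pointwise
  minima of \<open>b\<close>). Hence both arrays are carried along, and the order enters through the
  inequality \<open>a S r j + b T r j \<le> cap r j\<close>, which keeps its form when
  \<open>S\<close>, \<open>T\<close> and \<open>a\<close>, \<open>b\<close> are exchanged together.
  The hypotheses of the abstract lattice are thereby stable under transposition, and every statement
  on joins, meet-irreducibles or lower polygons is read off from the dual interpretation. Inductions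
  run over \<open>j - r\<close>, the distance from the border, because a cell is shadowed only by
  cells of its row or column at smaller distance. Meet-irreducible congruences need no separating
  argument of their own: in every finite lattice both maps are onto the join-irreducible
  congruences, so equal cardinalities transfer injectivity. Polygons become finite checks because
  inside an interval from \<open>x\<close> to \<open>t\<close> only the cells with
  \<open>cap r j < a t r j + b x r j\<close> can tell elements apart.\<close>

locale poset = partial_order L for L :: "'a gorder" (structure)

locale fin_lattice = finite_lattice L for L :: "'a gorder" (structure)

sublocale fin_lattice \<subseteq> poset ..

lemma (in poset) covers_iff:
  "covers L y x \<longleftrightarrow> x \<in> carrier L \<and> y \<in> carrier L \<and> x \<sqsubseteq> y \<and> x \<noteq> y \<and>
    (\<forall>z\<in>carrier L. x \<sqsubseteq> z \<longrightarrow> z \<sqsubseteq> y \<longrightarrow> z = x \<or> z = y)"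
  by (auto simp: covers_def lless_eq)

lemma (in poset) poset_dual: "poset (inv_gorder L)"
  using dual_order by (simp add: poset_def)

lemma (in poset) covers_dual: "covers (inv_gorder L) x y \<longleftrightarrow> covers L y x"
proof -
  interpret d: poset "inv_gorder L" by (rule poset_dual)
  show ?thesis by (auto simp: covers_iff d.covers_iff)
qed

lemma (in poset) ex_cover_above_le:
  assumes "finite (carrier L)" "x \<in> carrier L" "y \<in> carrier L" "x \<sqsubseteq> y" "x \<noteq> y"
  shows "\<exists>z. covers L y z \<and> x \<sqsubseteq> z"
  using assms(2-)
proof (induction "card {z \<in> carrier L. x \<sqsubseteq> z \<and> z \<sqsubseteq> y}" arbitrary: x rule: less_induct)
  case less
  show ?case
  proof (cases "covers L y x")
    case False
    then obtain z where z: "z \<in> carrier L" "x \<sqsubseteq> z" "z \<sqsubseteq> y" "z \<noteq> x" "z \<noteq> y"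
      using less.prems by (auto simp: covers_iff)
    have "{w \<in> carrier L. z \<sqsubseteq> w \<and> w \<sqsubseteq> y} \<subset> {w \<in> carrier L. x \<sqsubseteq> w \<and> w \<sqsubseteq> y}"
      using z less.prems le_trans le_antisym by blast
    then have "card {w \<in> carrier L. z \<sqsubseteq> w \<and> w \<sqsubseteq> y} < card {w \<in> carrier L. x \<sqsubseteq> w \<and> w \<sqsubseteq> y}"
      using assms(1) by (intro psubset_card_mono) auto
    from less.hyps[OF this z(1) less.prems(2) z(3,5)] obtain w where "covers L y w" "z \<sqsubseteq> w"
      by blast
    then show ?thesis using z less.prems le_trans by (meson covers_iff)
  qed (use less.prems in auto)
qed

lemma (in poset) ex_cover_below_ge:
  assumes "finite (carrier L)" "x \<in> carrier L" "y \<in> carrier L" "x \<sqsubseteq> y" "x \<noteq> y"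
  shows "\<exists>z. covers L z x \<and> z \<sqsubseteq> y"
proof -
  interpret d: poset "inv_gorder L" by (rule poset_dual)
  show ?thesis using d.ex_cover_above_le[of y x] assms by (auto simp: covers_dual)
qed

lemma (in poset) join_irreducibleI:
  assumes "j \<in> carrier L" "z \<in> carrier L" "z \<sqsubseteq> j" "z \<noteq> j"
    and "\<And>y. y \<in> carrier L \<Longrightarrow> y \<sqsubseteq> j \<Longrightarrow> y \<noteq> j \<Longrightarrow> y \<sqsubseteq> z"
  shows "j \<in> join_irreducibles L" "lower_cover L j = z"
proof -
  have "covers L j x \<longleftrightarrow> x = z" for x
    using assms le_antisym by (auto simp: covers_iff)
  then show "j \<in> join_irreducibles L" "lower_cover L j = z"
    using assms(1) by (auto simp: join_irreducibles_def lower_cover_def)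
qed

lemma (in poset) join_irreducibleD:
  assumes "finite (carrier L)" "j \<in> join_irreducibles L"
  shows "j \<in> carrier L" "covers L j (lower_cover L j)"
    "\<And>y. y \<in> carrier L \<Longrightarrow> y \<sqsubseteq> j \<Longrightarrow> y \<noteq> j \<Longrightarrow> y \<sqsubseteq> lower_cover L j"
proof -
  from assms(2) have j: "j \<in> carrier L" and ex: "\<exists>!x. covers L j x"
    by (auto simp: join_irreducibles_def)
  have eq: "covers L j x \<Longrightarrow> x = lower_cover L j" for x
    using ex unfolding lower_cover_def by (metis the_equality)
  show "j \<in> carrier L" by (fact j)
  show "covers L j (lower_cover L j)" using ex eq by metis
  show "y \<sqsubseteq> lower_cover L j" if "y \<in> carrier L" "y \<sqsubseteq> j" "y \<noteq> j" for y
    using ex_cover_above_le[OF assms(1) that(1) j that(2,3)] eq by blast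
qed

lemma (in poset) meet_irreducibles_dual:
  "join_irreducibles (inv_gorder L) = meet_irreducibles L"
  "lower_cover (inv_gorder L) = upper_cover L"
  by (simp_all add: join_irreducibles_def meet_irreducibles_def lower_cover_def
      upper_cover_def covers_dual fun_eq_iff)

section \<open>Congruences of a finite lattice and their join-irreducible elements\<close>

lemma lattice_congruenceI:
  assumes "equiv (carrier L) \<theta>"
    and "\<And>x x' y y'. (x, x') \<in> \<theta> \<Longrightarrow> (y, y') \<in> \<theta> \<Longrightarrow> (x \<sqinter>\<^bsub>L\<^esub> y, x' \<sqinter>\<^bsub>L\<^esub> y') \<in> \<theta>"
    and "\<And>x x' y y'. (x, x') \<in> \<theta> \<Longrightarrow> (y, y') \<in> \<theta> \<Longrightarrow> (x \<squnion>\<^bsub>L\<^esub> y, x' \<squnion>\<^bsub>L\<^esub> y') \<in> \<theta>"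
  shows "lattice_congruence L \<theta>"
  using assms unfolding lattice_congruence_def by blast

lemma lattice_congruenceD:
  assumes "lattice_congruence L \<theta>"
  shows "equiv (carrier L) \<theta>"
    and "\<theta> \<subseteq> carrier L \<times> carrier L"
    and "x \<in> carrier L \<Longrightarrow> (x, x) \<in> \<theta>"
    and "(x, y) \<in> \<theta> \<Longrightarrow> (y, x) \<in> \<theta>"
    and "(x, y) \<in> \<theta> \<Longrightarrow> (y, z) \<in> \<theta> \<Longrightarrow> (x, z) \<in> \<theta>"
    and "(x, x') \<in> \<theta> \<Longrightarrow> (y, y') \<in> \<theta> \<Longrightarrow> (x \<sqinter>\<^bsub>L\<^esub> y, x' \<sqinter>\<^bsub>L\<^esub> y') \<in> \<theta>"
    and "(x, x') \<in> \<theta> \<Longrightarrow> (y, y') \<in> \<theta> \<Longrightarrow> (x \<squnion>\<^bsub>L\<^esub> y, x' \<squnion>\<^bsub>L\<^esub> y') \<in> \<theta>"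
proof -
  from assms show eq: "equiv (carrier L) \<theta>" by (simp add: lattice_congruence_def)
  show "\<theta> \<subseteq> carrier L \<times> carrier L" by (rule equiv_type[OF eq])
  show "x \<in> carrier L \<Longrightarrow> (x, x) \<in> \<theta>" using eq by (simp add: equiv_def refl_on_def)
  show "(x, y) \<in> \<theta> \<Longrightarrow> (y, x) \<in> \<theta>" using eq by (meson equivE symE)
  show "(x, y) \<in> \<theta> \<Longrightarrow> (y, z) \<in> \<theta> \<Longrightarrow> (x, z) \<in> \<theta>" using eq by (meson equivE transE)
qed (use assms in \<open>auto simp: lattice_congruence_def\<close>)

lemma Con_simps [simp]:
  "carrier (Con L) = {\<theta>. lattice_congruence L \<theta>}" "le (Con L) = (\<subseteq>)" "eq (Con L) = (=)"
  by (simp_all add: Con_def)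

lemma poset_Con: "poset (Con L)"
  by unfold_locales auto

lemma (in lattice) join_eq_right: "x \<in> carrier L \<Longrightarrow> y \<in> carrier L \<Longrightarrow> x \<sqsubseteq> y \<Longrightarrow> x \<squnion> y = y"
  using le_iff_meet by blast

lemma (in lattice) meet_eq_left: "x \<in> carrier L \<Longrightarrow> y \<in> carrier L \<Longrightarrow> x \<sqsubseteq> y \<Longrightarrow> x \<sqinter> y = x"
  using le_iff_join by metis

lemma lattice_congruence_dual: "lattice_congruence (inv_gorder L) = lattice_congruence L"
  by (auto simp: lattice_congruence_def fun_eq_iff)

lemma con_dual: "con (inv_gorder L) x y = con L y x"
proof -
  have "{\<theta>. lattice_congruence L \<theta> \<and> (x, y) \<in> \<theta>} = {\<theta>. lattice_congruence L \<theta> \<and> (y, x) \<in> \<theta>}"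
    by (auto intro: lattice_congruenceD(4))
  then show ?thesis
    by (simp add: con_def Con_def lattice_congruence_dual)
qed

text \<open>The arguments are moved along their paths one at a time, so compatibility in each single
  argument is enough.\<close>

lemma trancl_binop:
  assumes "U \<subseteq> A \<times> A"
    and l: "\<And>u v w. (u, v) \<in> U \<Longrightarrow> w \<in> A \<Longrightarrow> (f u w, f v w) \<in> U"
    and r: "\<And>u v w. (u, v) \<in> U \<Longrightarrow> w \<in> A \<Longrightarrow> (f w u, f w v) \<in> U"
    and xx: "(x, x') \<in> U\<^sup>+" and yy: "(y, y') \<in> U\<^sup>+"
  shows "(f x y, f x' y') \<in> U\<^sup>+"
proof -
  have A: "y \<in> A" "x' \<in> A" using xx yy trancl_subset_Sigma[OF assms(1)] by auto
  have "(f x y, f x' y) \<in> U\<^sup>+"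
    using xx by (induction rule: trancl_induct) (auto intro: l A trancl_into_trancl)
  moreover have "(f x' y, f x' y') \<in> U\<^sup>+"
    using yy by (induction rule: trancl_induct) (auto intro: r A trancl_into_trancl)
  ultimately show ?thesis by (rule trancl_trans)
qed

context fin_lattice
begin

lemma fin_lattice_dual: "fin_lattice (inv_gorder L)"
  using dual_lattice finite_carrier
  by (simp add: fin_lattice_def finite_lattice_def finite_lattice_axioms_def)

lemma finite_Con: "finite (carrier (Con L))"
  by (rule finite_subset[of _ "Pow (carrier L \<times> carrier L)"])
    (use finite_carrier lattice_congruenceD(2) in auto)

lemma con_lemmas:
  assumes "x \<in> carrier L" "y \<in> carrier L"
  shows lattice_congruence_con: "lattice_congruence L (con L x y)"
    and mem_con: "(x, y) \<in> con L x y"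
    and con_subset: "\<And>\<theta>. lattice_congruence L \<theta> \<Longrightarrow> (x, y) \<in> \<theta> \<Longrightarrow> con L x y \<subseteq> \<theta>"
proof -
  let ?S = "{\<theta>. lattice_congruence L \<theta> \<and> (x, y) \<in> \<theta>}"
  have top: "lattice_congruence L (carrier L \<times> carrier L)"
    by (intro lattice_congruenceI equivI refl_onI symI transI) auto
  then have ne: "carrier L \<times> carrier L \<in> ?S" using assms by auto
  have eq: "equiv (carrier L) (\<Inter>?S)"
  proof (intro equivI refl_onI symI transI)
    show "\<Inter> ?S \<subseteq> carrier L \<times> carrier L" using ne by blast
  qed (auto dest: lattice_congruenceD)
  have "lattice_congruence L (\<Inter>?S)"
    by (rule lattice_congruenceI[OF eq]) (auto dest: lattice_congruenceD)
  then have least: "least (Con L) (\<Inter>?S) {\<theta> \<in> carrier (Con L). (x, y) \<in> \<theta>}"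
    by (auto simp: least_def)
  interpret C: poset "Con L" by (rule poset_Con)
  have "con L x y = \<Inter>?S"
    unfolding con_def by (rule the_equality, rule least, rule C.least_unique[OF _ least])
  then show "lattice_congruence L (con L x y)" "(x, y) \<in> con L x y"
    "\<And>\<theta>. lattice_congruence L \<theta> \<Longrightarrow> (x, y) \<in> \<theta> \<Longrightarrow> con L x y \<subseteq> \<theta>"
    using \<open>lattice_congruence L (\<Inter>?S)\<close> by auto
qed

text \<open>
  A prime quotient is contracted by a join of congruences only if one of them contracts it:
  project a connecting path into the two-element interval.
\<close>

lemma join_irreducible_con_cover:
  assumes "covers L b a"
  shows "con L a b \<in> join_irreducibles (Con L)"
proof -
  have ab: "a \<in> carrier L" "b \<in> carrier L" "a \<sqsubseteq> b" "a \<noteq> b"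
    and prime: "\<And>z. z \<in> carrier L \<Longrightarrow> a \<sqsubseteq> z \<Longrightarrow> z \<sqsubseteq> b \<Longrightarrow> z = a \<or> z = b"
    using assms by (auto simp: covers_iff)
  let ?\<kappa> = "con L a b"
  \<comment> \<open>The transitive closure of this union is the join of all congruences strictly
    below \<open>?\<kappa>\<close>. It is the candidate for the unique lower cover; the point is
    that it stays different from \<open>?\<kappa>\<close>.\<close>
  let ?U = "\<Union>{\<psi>. lattice_congruence L \<psi> \<and> \<psi> \<subset> ?\<kappa>}"
  let ?\<phi> = "?U\<^sup>+"
  note \<kappa> = lattice_congruence_con[OF ab(1,2)]
  have notin: "(a, b) \<notin> \<psi>" if "lattice_congruence L \<psi>" "\<psi> \<subset> ?\<kappa>" for \<psi>
    using con_subset[OF ab(1,2) that(1)] that(2) by auto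
  have id: "lattice_congruence L (Id_on (carrier L))"
    by (intro lattice_congruenceI equivI refl_onI symI transI) auto
  have "Id_on (carrier L) \<subseteq> ?\<kappa>" using \<kappa> by (auto dest: lattice_congruenceD(3))
  moreover have "(a, b) \<notin> Id_on (carrier L)" using ab by auto
  ultimately have "Id_on (carrier L) \<subset> ?\<kappa>" using mem_con[OF ab(1,2)] by blast
  with id have idU: "Id_on (carrier L) \<subseteq> ?U" by auto
  have U_carrier: "?U \<subseteq> carrier L \<times> carrier L"
    using lattice_congruenceD(2) by fast
  have \<phi>_carrier: "?\<phi> \<subseteq> carrier L \<times> carrier L"
    using U_carrier by (rule trancl_subset_Sigma)
  have symU: "sym ?U" by (auto intro!: symI dest: lattice_congruenceD(4))
  have eq: "equiv (carrier L) ?\<phi>"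
  proof (rule equivI)
    show "?\<phi> \<subseteq> carrier L \<times> carrier L" by (rule \<phi>_carrier)
    show "refl_on (carrier L) ?\<phi>"
      using idU by (intro refl_onI r_into_trancl) (rule subsetD, auto)
  qed (rule sym_trancl[OF symU] trans_trancl)+
  have op: "(f x y, f x' y') \<in> ?\<phi>"
    if f: "\<And>\<psi> x x' y y'. lattice_congruence L \<psi> \<Longrightarrow> (x, x') \<in> \<psi> \<Longrightarrow> (y, y') \<in> \<psi> \<Longrightarrow> (f x y, f x' y') \<in> \<psi>"
      and xx: "(x, x') \<in> ?\<phi>" and yy: "(y, y') \<in> ?\<phi>" for f :: "'a \<Rightarrow> 'a \<Rightarrow> 'a" and x x' y y'
  proof (rule trancl_binop[OF U_carrier _ _ xx yy])
    fix u v w assume "(u, v) \<in> ?U" "w \<in> carrier L"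
    then obtain \<psi> where \<psi>: "lattice_congruence L \<psi>" "\<psi> \<subset> ?\<kappa>" "(u, v) \<in> \<psi>" "(w, w) \<in> \<psi>"
      by (auto dest: lattice_congruenceD(3))
    then show "(f u w, f v w) \<in> ?U" "(f w u, f w v) \<in> ?U"
      using f[OF \<psi>(1,3,4)] f[OF \<psi>(1,4,3)] by blast+
  qed
  have \<phi>: "lattice_congruence L ?\<phi>"
    by (rule lattice_congruenceI[OF eq]; rule op; (rule lattice_congruenceD(6,7), assumption+)?; assumption)
  have U\<kappa>: "?U \<subseteq> ?\<kappa>" by auto
  have \<phi>\<kappa>: "?\<phi> \<subseteq> ?\<kappa>"
  proof -
    have "trans ?\<kappa>" using lattice_congruenceD(1)[OF \<kappa>] by (rule equivE)
    then have "?\<kappa>\<^sup>+ = ?\<kappa>" by (rule trancl_id)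
    then show ?thesis using trancl_mono[OF _ U\<kappa>] by auto
  qed
  define f where "f x = (x \<squnion> a) \<sqinter> b" for x
  have f_cases: "f x = a \<or> f x = b" if "x \<in> carrier L" for x
    unfolding f_def using that ab by (intro prime) (auto intro: meet_le join_right meet_right)
  have fa: "f a = a" and fb: "f b = b"
    using ab by (auto simp: f_def join_eq_right meet_eq_left join_comm[of _ b a])
  have "f y = a" if "(a, y) \<in> ?\<phi>" for y
    using that
  proof (induction rule: trancl_induct)
    case (base y)
    then obtain \<psi> where \<psi>: "lattice_congruence L \<psi>" "\<psi> \<subset> ?\<kappa>" "(a, y) \<in> \<psi>" by auto
    have "(f a, f y) \<in> \<psi>" unfolding f_def
      using \<psi> ab by (intro lattice_congruenceD(6,7)[OF \<psi>(1)]) (auto intro: lattice_congruenceD)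
    moreover have "y \<in> carrier L" using \<psi> lattice_congruenceD(2) by blast
    ultimately show ?case using f_cases notin[OF \<psi>(1,2)] fa by metis
  next
    case (step y z)
    then obtain \<psi> where \<psi>: "lattice_congruence L \<psi>" "\<psi> \<subset> ?\<kappa>" "(y, z) \<in> \<psi>" by auto
    have "(f y, f z) \<in> \<psi>" unfolding f_def
      using \<psi> ab by (intro lattice_congruenceD(6,7)[OF \<psi>(1)]) (auto intro: lattice_congruenceD)
    moreover have "z \<in> carrier L" using \<psi> lattice_congruenceD(2) by blast
    ultimately show ?case using f_cases notin[OF \<psi>(1,2)] step.IH by metis
  qed
  then have "(a, b) \<notin> ?\<phi>" using fb ab by auto
  then have ne: "?\<phi> \<noteq> ?\<kappa>" using mem_con[OF ab(1,2)] by auto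
  interpret C: poset "Con L" by (rule poset_Con)
  show ?thesis
    by (rule C.join_irreducibleI(1)[of _ ?\<phi>]) (use \<kappa> \<phi> \<phi>\<kappa> ne in auto)
qed

lemma congruence_generated_by_covers:
  assumes "lattice_congruence L \<theta>" "x \<in> carrier L" "y \<in> carrier L" "x \<sqsubseteq> y"
    and "\<And>a b. covers L b a \<Longrightarrow> x \<sqsubseteq> a \<Longrightarrow> b \<sqsubseteq> y \<Longrightarrow> (a, b) \<in> \<theta>"
  shows "(x, y) \<in> \<theta>"
  using assms(2-)
proof (induction "card {z \<in> carrier L. x \<sqsubseteq> z \<and> z \<sqsubseteq> y}" arbitrary: x rule: less_induct)
  case less
  show ?case
  proof (cases "x = y")
    case True
    then show ?thesis using assms(1) less.prems lattice_congruenceD(3) by metis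
  next
    case False
    from ex_cover_below_ge[OF finite_carrier less.prems(1-3) False]
    obtain z where cov: "covers L z x" and zy: "z \<sqsubseteq> y" by blast
    then have z: "z \<in> carrier L" "x \<sqsubseteq> z" "x \<noteq> z" by (auto simp: covers_iff)
    have "{w \<in> carrier L. z \<sqsubseteq> w \<and> w \<sqsubseteq> y} \<subset> {w \<in> carrier L. x \<sqsubseteq> w \<and> w \<sqsubseteq> y}"
      using z less.prems le_trans le_antisym by blast
    then have "card {w \<in> carrier L. z \<sqsubseteq> w \<and> w \<sqsubseteq> y} < card {w \<in> carrier L. x \<sqsubseteq> w \<and> w \<sqsubseteq> y}"
      using finite_carrier by (intro psubset_card_mono) auto
    moreover have "(a, b) \<in> \<theta>" if "covers L b a" "z \<sqsubseteq> a" "b \<sqsubseteq> y" for a b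
      using that z less.prems le_trans by (meson covers_iff)
    ultimately have "(z, y) \<in> \<theta>" using less.hyps z less.prems zy by blast
    moreover have "(x, z) \<in> \<theta>" using less.prems cov zy by auto
    ultimately show ?thesis using assms(1) lattice_congruenceD(5) by metis
  qed
qed

text \<open>A join-irreducible congruence identifies some pair that its lower cover separates.
  Refining that pair to a cover still separated there gives a principal congruence inside
  \<open>\<theta>\<close> but not inside the lower cover, hence \<open>\<theta>\<close>
  itself.\<close>

lemma join_irreducible_Con_E:
  assumes "\<theta> \<in> join_irreducibles (Con L)"
  obtains a b where "covers L b a" "\<theta> = con L a b"
proof -
  interpret C: poset "Con L" by (rule poset_Con)
  note D = C.join_irreducibleD[OF finite_Con assms]
  let ?\<psi> = "lower_cover (Con L) \<theta>"
  have \<theta>: "lattice_congruence L \<theta>" using D(1) by simp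
  have \<psi>: "lattice_congruence L ?\<psi>" "?\<psi> \<subset> \<theta>" using D(2) by (auto simp: C.covers_iff)
  then obtain u v where uv: "(u, v) \<in> \<theta>" "(u, v) \<notin> ?\<psi>" by auto
  have c: "u \<in> carrier L" "v \<in> carrier L" using uv(1) \<theta> lattice_congruenceD(2) by blast+
  let ?x = "u \<sqinter> v" let ?y = "u \<squnion> v"
  have le: "?x \<sqsubseteq> u" "?x \<sqsubseteq> v" "u \<sqsubseteq> ?y" "v \<sqsubseteq> ?y" "?x \<sqsubseteq> ?y"
    using c by (auto intro: meet_left meet_right join_left join_right
        le_trans[OF meet_left join_left])
  \<comment> \<open>Passes from the possibly incomparable \<open>u\<close>, \<open>v\<close> to a
    comparable pair, between which a path of covers exists.\<close>
  have "(?x, ?y) \<notin> ?\<psi>"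
  proof
    assume xy: "(?x, ?y) \<in> ?\<psi>"
    have "(u, ?y) \<in> ?\<psi>"
    proof -
      have "(?x \<squnion> u, ?y \<squnion> u) \<in> ?\<psi>"
        by (rule lattice_congruenceD(7)[OF \<psi>(1) xy lattice_congruenceD(3)[OF \<psi>(1) c(1)]])
      moreover have "?x \<squnion> u = u" "?y \<squnion> u = ?y"
        using c le by (auto simp: join_eq_right join_comm[of _ ?y u])
      ultimately show ?thesis by simp
    qed
    moreover have "(v, ?y) \<in> ?\<psi>"
    proof -
      have "(?x \<squnion> v, ?y \<squnion> v) \<in> ?\<psi>"
        by (rule lattice_congruenceD(7)[OF \<psi>(1) xy lattice_congruenceD(3)[OF \<psi>(1) c(2)]])
      moreover have "?x \<squnion> v = v" "?y \<squnion> v = ?y"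
        using c le by (auto simp: join_eq_right join_comm[of _ ?y v])
      ultimately show ?thesis by simp
    qed
    ultimately show False using uv(2) lattice_congruenceD(4,5)[OF \<psi>(1)] by blast
  qed
  then obtain a b where ab: "covers L b a" "?x \<sqsubseteq> a" "b \<sqsubseteq> ?y" "(a, b) \<notin> ?\<psi>"
    using congruence_generated_by_covers[OF \<psi>(1), of ?x ?y] c le by auto
  have abc: "a \<in> carrier L" "b \<in> carrier L" "a \<sqsubseteq> b" using ab(1) by (auto simp: covers_iff)
  have "(u \<sqinter> u, u \<sqinter> v) \<in> \<theta>"
    by (rule lattice_congruenceD(6)[OF \<theta> lattice_congruenceD(3)[OF \<theta> c(1)] uv(1)])
  moreover have "(u \<squnion> u, u \<squnion> v) \<in> \<theta>"
    by (rule lattice_congruenceD(7)[OF \<theta> lattice_congruenceD(3)[OF \<theta> c(1)] uv(1)])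
  ultimately have xy: "(?x, ?y) \<in> \<theta>"
    using c lattice_congruenceD(4,5)[OF \<theta>] by (metis join_eq_right meet_eq_left le_refl)
  \<comment> \<open>The polynomial \<open>(_ \<squnion> a) \<sqinter> b\<close> sends the ends of
    the large interval to \<open>a\<close> and \<open>b\<close>.\<close>
  have "((?x \<squnion> a) \<sqinter> b, (?y \<squnion> a) \<sqinter> b) \<in> \<theta>"
    using xy abc by (intro lattice_congruenceD(6,7)[OF \<theta>]) (auto intro: lattice_congruenceD(3)[OF \<theta>])
  moreover have "?x \<squnion> a = a" "a \<sqinter> b = a" "?y \<squnion> a = ?y" "?y \<sqinter> b = b"
    using c abc ab le_trans[OF abc(3) ab(3)]
    by (auto simp: join_eq_right meet_eq_left join_comm[of _ ?y a] meet_comm[of _ ?y b])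
  ultimately have "(a, b) \<in> \<theta>" by simp
  then have "con L a b \<subseteq> \<theta>" using con_subset[OF abc(1,2) \<theta>] by simp
  moreover have "\<not> con L a b \<subseteq> ?\<psi>" using mem_con[OF abc(1,2)] ab(4) by auto
  ultimately have "con L a b = \<theta>"
    using D(3)[of "con L a b"] lattice_congruence_con[OF abc(1,2)] by auto
  then show thesis by (intro that[OF ab(1)]) simp
qed

text \<open>Choose \<open>j\<close> minimal among the elements below \<open>b\<close> but not below
  \<open>a\<close>. Its lower cover is \<open>j \<sqinter> a\<close>, and
  \<open>j \<squnion> a = b\<close>, so the two prime quotients are perspective and generate the
  same congruence.\<close>

lemma ex_join_irreducible_con_eq:
  assumes "covers L b a"
  obtains j where "j \<in> join_irreducibles L" "con L (lower_cover L j) j = con L a b"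
proof -
  have ab: "a \<in> carrier L" "b \<in> carrier L" "a \<sqsubseteq> b" "a \<noteq> b"
    and prime: "\<And>z. z \<in> carrier L \<Longrightarrow> a \<sqsubseteq> z \<Longrightarrow> z \<sqsubseteq> b \<Longrightarrow> z = a \<or> z = b"
    using assms by (auto simp: covers_iff)
  let ?S = "{z \<in> carrier L. z \<sqsubseteq> b \<and> \<not> z \<sqsubseteq> a}"
  have "b \<in> ?S" using ab le_antisym by auto
  then obtain j where jS: "j \<in> ?S"
    and jmin: "\<And>z. z \<in> ?S \<Longrightarrow> card {w \<in> carrier L. w \<sqsubseteq> j} \<le> card {w \<in> carrier L. w \<sqsubseteq> z}"
    using arg_min_nat_lemma[of "\<lambda>z. z \<in> ?S" b "\<lambda>z. card {w \<in> carrier L. w \<sqsubseteq> z}"] by blast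
  then have j: "j \<in> carrier L" "j \<sqsubseteq> b" "\<not> j \<sqsubseteq> a" by auto
  have below: "z \<sqsubseteq> a" if z: "z \<in> carrier L" "z \<sqsubseteq> j" "z \<noteq> j" for z
  proof (rule ccontr)
    assume "\<not> z \<sqsubseteq> a"
    then have "z \<in> ?S" using z j ab le_trans by blast
    from jmin[OF this] have "card {w \<in> carrier L. w \<sqsubseteq> j} \<le> card {w \<in> carrier L. w \<sqsubseteq> z}" .
    moreover have "{w \<in> carrier L. w \<sqsubseteq> z} \<subset> {w \<in> carrier L. w \<sqsubseteq> j}"
      using z j le_trans le_antisym by blast
    then have "card {w \<in> carrier L. w \<sqsubseteq> z} < card {w \<in> carrier L. w \<sqsubseteq> j}"
      using finite_carrier by (intro psubset_card_mono) auto
    ultimately show False by simp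
  qed
  let ?i = "j \<sqinter> a"
  have i: "?i \<in> carrier L" "?i \<sqsubseteq> j" "?i \<sqsubseteq> a" "?i \<noteq> j"
    using j ab meet_left[OF j(1) ab(1)] meet_right[OF j(1) ab(1)] by auto
  have ji: "j \<in> join_irreducibles L" "lower_cover L j = ?i"
    by (rule join_irreducibleI[OF j(1) i(1,2,4)]; rule meet_le; use below j ab in simp)+
  have jb: "j \<squnion> a = b"
  proof -
    have "a \<sqsubseteq> j \<squnion> a" "j \<squnion> a \<sqsubseteq> b" "j \<sqsubseteq> j \<squnion> a" using j ab join_le join_left join_right by auto
    then show ?thesis using prime[of "j \<squnion> a"] j ab by auto
  qed
  have "con L ?i j \<subseteq> con L a b"
  proof (rule con_subset[OF i(1) j(1) lattice_congruence_con[OF ab(1,2)]])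
    have "(j \<sqinter> a, j \<sqinter> b) \<in> con L a b"
      using lattice_congruence_con[OF ab(1,2)] mem_con[OF ab(1,2)] j(1)
      by (intro lattice_congruenceD(6)) (auto intro: lattice_congruenceD(3))
    then show "(?i, j) \<in> con L a b" using j ab by (simp add: meet_eq_left)
  qed
  moreover have "con L a b \<subseteq> con L ?i j"
  proof (rule con_subset[OF ab(1,2) lattice_congruence_con[OF i(1) j(1)]])
    have "(?i \<squnion> a, j \<squnion> a) \<in> con L ?i j"
      using lattice_congruence_con[OF i(1) j(1)] mem_con[OF i(1) j(1)] ab(1)
      by (intro lattice_congruenceD(7)) (auto intro: lattice_congruenceD(3))
    then show "(a, b) \<in> con L ?i j" using i ab jb by (simp add: join_eq_right)
  qed
  ultimately show thesis using that ji by auto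
qed

lemma image_con_join_irreducibles:
  "(\<lambda>j. con L (lower_cover L j) j) ` join_irreducibles L = join_irreducibles (Con L)"
proof
  show "(\<lambda>j. con L (lower_cover L j) j) ` join_irreducibles L \<subseteq> join_irreducibles (Con L)"
    using join_irreducible_con_cover join_irreducibleD(2)[OF finite_carrier] by blast
  show "join_irreducibles (Con L) \<subseteq> (\<lambda>j. con L (lower_cover L j) j) ` join_irreducibles L"
  proof
    fix \<theta> assume "\<theta> \<in> join_irreducibles (Con L)"
    then obtain a b where ab: "covers L b a" "\<theta> = con L a b" by (rule join_irreducible_Con_E)
    from ab(1) obtain j where "j \<in> join_irreducibles L" "con L (lower_cover L j) j = con L a b"
      by (rule ex_join_irreducible_con_eq)
    then show "\<theta> \<in> (\<lambda>j. con L (lower_cover L j) j) ` join_irreducibles L"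
      using ab(2) by (auto intro: image_eqI[of _ _ j])
  qed
qed

lemma image_con_meet_irreducibles:
  "(\<lambda>m. con L m (upper_cover L m)) ` meet_irreducibles L = join_irreducibles (Con L)"
proof -
  interpret d: fin_lattice "inv_gorder L" by (rule fin_lattice_dual)
  have "Con (inv_gorder L) = Con L" by (simp add: Con_def lattice_congruence_dual)
  then show ?thesis
    using d.image_con_join_irreducibles by (simp add: meet_irreducibles_dual con_dual)
qed

text \<open>Both maps have the same image. Injectivity on the join-irreducibles fixes the size of
  that image, and a surjection between finite sets of equal size is injective.\<close>

lemma congruence_uniformI:
  assumes inj: "inj_on (\<lambda>j. con L (lower_cover L j) j) (join_irreducibles L)"
    and card: "card (join_irreducibles L) = card (meet_irreducibles L)"
  shows "congruence_uniform L"
proof -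
  have fin: "finite (meet_irreducibles L)"
    using finite_carrier by (auto simp: meet_irreducibles_def)
  have "card (join_irreducibles (Con L)) = card (meet_irreducibles L)"
    using card_image[OF inj] card image_con_join_irreducibles by simp
  then have "inj_on (\<lambda>m. con L m (upper_cover L m)) (meet_irreducibles L)"
    using eq_card_imp_inj_on[OF fin] image_con_meet_irreducibles by metis
  then show ?thesis
    using inj image_con_join_irreducibles image_con_meet_irreducibles
    by (simp add: congruence_uniform_def bij_betw_def)
qed

end

section \<open>Intervals spanned by two chains\<close>

context poset
begin

lemma mem_interval: "z \<in> \<lbrace>x..y\<rbrace> \<longleftrightarrow> z \<in> carrier L \<and> x \<sqsubseteq> z \<and> z \<sqsubseteq> y"
  by (auto simp: at_least_at_most_def)

lemma interval_dual: "\<lbrace>x..y\<rbrace>\<^bsub>inv_gorder L\<^esub> = \<lbrace>y..x\<rbrace>"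
  by (auto simp: at_least_at_most_def)

lemma maxchain_dual: "pred_on.maxchain A (le (inv_gorder L)) C = pred_on.maxchain A (le L) C"
proof -
  have "pred_on.chain A (le (inv_gorder L)) = pred_on.chain A (le L)"
    by (auto simp: pred_on.chain_def fun_eq_iff)
  then show ?thesis by (simp add: pred_on.maxchain_def)
qed

lemma polygon_sides_dual: "polygon_sides (inv_gorder L) x y C D = polygon_sides L y x C D"
  unfolding polygon_sides_def interval_dual maxchain_dual by auto

lemma polygon_dual:
  "quadrilateral (inv_gorder L) x y = quadrilateral L y x"
  "heptagon (inv_gorder L) x y = heptagon L y x"
  by (simp_all add: quadrilateral_def heptagon_def polygon_sides_dual)

text \<open>One side has the single inner element \<open>u\<close>, the other the
  \<open>l + 1\<close> inner elements \<open>z 0\<close>, ..., \<open>z l\<close>. Each side is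
  maximal because an extra element would lie on the other side, and \<open>u\<close> is incomparable
  to every \<open>z i\<close>.\<close>

lemma polygon_sidesI:
  fixes z :: "nat \<Rightarrow> 'a"
  assumes carr: "x \<in> carrier L" "t \<in> carrier L" "u \<in> carrier L" "\<And>i. i \<le> l \<Longrightarrow> z i \<in> carrier L"
    and interval: "\<And>w. w \<in> carrier L \<Longrightarrow> x \<sqsubseteq> w \<Longrightarrow> w \<sqsubseteq> t \<Longrightarrow> w = x \<or> w = u \<or> w = t \<or> (\<exists>i\<le>l. w = z i)"
    and u: "x \<sqsubseteq> u" "u \<sqsubseteq> t" "u \<noteq> x" "u \<noteq> t"
    and z: "\<And>i. i \<le> l \<Longrightarrow> x \<sqsubseteq> z i" "\<And>i. i \<le> l \<Longrightarrow> z i \<sqsubseteq> t"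
      "\<And>i. i \<le> l \<Longrightarrow> z i \<noteq> x" "\<And>i. i \<le> l \<Longrightarrow> z i \<noteq> t"
    and mono: "\<And>i i'. i \<le> i' \<Longrightarrow> i' \<le> l \<Longrightarrow> z i \<sqsubseteq> z i'"
    and inj: "inj_on z {..l}"
    and incomp: "\<And>i. i \<le> l \<Longrightarrow> \<not> u \<sqsubseteq> z i" "\<And>i. i \<le> l \<Longrightarrow> \<not> z i \<sqsubseteq> u"
  shows "\<exists>C D. polygon_sides L x t C D \<and> chain_length C = 2 \<and> chain_length D = l + 2"
proof -
  let ?C = "{x, u, t}" and ?D = "insert x (insert t (z ` {..l}))"
  have xt: "x \<sqsubseteq> t" "x \<noteq> t" using u carr le_trans le_antisym by blast+
  have int: "\<lbrace>x..t\<rbrace> = ?C \<union> ?D"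
  proof
    show "\<lbrace>x..t\<rbrace> \<subseteq> ?C \<union> ?D" using interval by (auto simp: mem_interval image_iff) blast
    show "?C \<union> ?D \<subseteq> \<lbrace>x..t\<rbrace>" using carr u z xt by (auto simp: mem_interval)
  qed
  have incomp': "\<not> (le L)\<^sup>=\<^sup>= u (z i)" "\<not> (le L)\<^sup>=\<^sup>= (z i) u" if "i \<le> l" for i
    using incomp[OF that] carr(3) by auto
  have "pred_on.chain \<lbrace>x..t\<rbrace> (le L) ?C"
    using int u xt by (auto simp: pred_on.chain_def)
  moreover have "\<not> (pred_on.chain \<lbrace>x..t\<rbrace> (le L) S \<and> ?C \<subset> S)" for S
  proof
    assume S: "pred_on.chain \<lbrace>x..t\<rbrace> (le L) S \<and> ?C \<subset> S"
    then obtain s where "s \<in> S" "s \<notin> ?C" by blast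
    moreover have "S \<subseteq> ?C \<union> ?D" using S int by (auto simp: pred_on.chain_def)
    ultimately have "s \<in> z ` {..l}" by blast
    then obtain i where i: "i \<le> l" "z i \<in> S" using \<open>s \<in> S\<close> by auto
    have "u \<in> S" using S by blast
    from pred_on.chain_total[OF conjunct1[OF S] this i(2)] show False
      using incomp'[OF i(1)] by iprover
  qed
  ultimately have C: "pred_on.maxchain \<lbrace>x..t\<rbrace> (le L) ?C" by (auto simp: pred_on.maxchain_def)
  have "pred_on.chain \<lbrace>x..t\<rbrace> (le L) ?D"
    unfolding pred_on.chain_def
  proof (intro conjI ballI)
    show "?D \<subseteq> \<lbrace>x..t\<rbrace>" using int by auto
    fix p q assume "p \<in> ?D" "q \<in> ?D"
    moreover have "z i \<sqsubseteq> z i' \<or> z i' \<sqsubseteq> z i" if "i \<le> l" "i' \<le> l" for i i'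
      using mono[of i i'] mono[of i' i] that by linarith
    ultimately show "(le L)\<^sup>=\<^sup>= p q \<or> (le L)\<^sup>=\<^sup>= q p"
      using z xt by auto
  qed
  moreover have "\<not> (pred_on.chain \<lbrace>x..t\<rbrace> (le L) S \<and> ?D \<subset> S)" for S
  proof
    assume S: "pred_on.chain \<lbrace>x..t\<rbrace> (le L) S \<and> ?D \<subset> S"
    then obtain s where "s \<in> S" "s \<notin> ?D" by blast
    moreover have "S \<subseteq> ?C \<union> ?D" using S int by (auto simp: pred_on.chain_def)
    ultimately have uS: "u \<in> S" by blast
    have "z 0 \<in> S" using S by blast
    from pred_on.chain_total[OF conjunct1[OF S] uS this] show False
      using incomp'[of 0, OF le0] by iprover
  qed
  ultimately have D: "pred_on.maxchain \<lbrace>x..t\<rbrace> (le L) ?D" by (auto simp: pred_on.maxchain_def)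
  have u_notin: "u \<notin> ?D" using u incomp carr(3) by auto
  have xt_notin: "x \<notin> z ` {..l}" "t \<notin> z ` {..l}" using z by auto
  have "polygon_sides L x t ?C ?D"
    unfolding polygon_sides_def using C D int carr u_notin by auto
  moreover have "chain_length ?C = 2" using u xt by (simp add: chain_length_def)
  moreover have "card (z ` {..l}) = l + 1" using inj by (simp add: card_image)
  then have "chain_length ?D = l + 2" using xt_notin xt by (simp add: chain_length_def)
  ultimately show ?thesis by blast
qed

end

section \<open>Arrays of states\<close>

text \<open>The top state. Border cells have one state fewer because they are never empty.\<close>

definition cap :: "nat \<Rightarrow> nat \<Rightarrow> nat" where
  "cap r j = (if r < j then 3 else 2)"

lemma cap_gt_1 [simp]: "Suc 0 < cap r j" "Suc 0 \<le> cap r j" "0 < cap r j" "cap r j \<noteq> 0" "cap r j \<noteq> Suc 0" "0 \<noteq> cap r j" "Suc 0 \<noteq> cap r j"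
  by (auto simp: cap_def)

abbreviation in_tri :: "nat \<Rightarrow> nat \<Rightarrow> nat \<Rightarrow> bool" where
  "in_tri m r j \<equiv> 1 \<le> r \<and> r \<le> j \<and> j \<le> m"

text \<open>
  The conditions say that \<open>(r, j)\<close> is not shadowed from within its column, respectively its row.
  Both arrays vanish at a cell that is shadowed from both sides.
\<close>

definition shape :: "nat \<Rightarrow> (nat \<Rightarrow> nat \<Rightarrow> nat) \<Rightarrow> (nat \<Rightarrow> nat \<Rightarrow> nat) \<Rightarrow> bool" where
  "shape m a b \<longleftrightarrow> (\<forall>r j. in_tri m r j \<longrightarrow>
     (if r < j \<longrightarrow> 0 < a (Suc r) j
      then (if r < j \<longrightarrow> 0 < b r (j - 1) then a r j + b r j = cap r j else a r j = cap r j \<and> b r j = 0)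
      else (if r < j \<longrightarrow> 0 < b r (j - 1) then a r j = 0 \<and> b r j = cap r j else a r j = 0 \<and> b r j = 0)))"

lemmas shape_cell = shape_def[THEN iffD1, rule_format]

lemma shapeD:
  assumes "shape m a b" "in_tri m r j"
  shows "(r < j \<Longrightarrow> 0 < a (Suc r) j) \<Longrightarrow> (r < j \<Longrightarrow> 0 < b r (j - 1)) \<Longrightarrow> a r j + b r j = cap r j"
    and "(r < j \<Longrightarrow> 0 < a (Suc r) j) \<Longrightarrow> r < j \<Longrightarrow> b r (j - 1) = 0 \<Longrightarrow> a r j = cap r j"
    and "r < j \<Longrightarrow> b r (j - 1) = 0 \<Longrightarrow> b r j = 0"
    and "r < j \<Longrightarrow> a (Suc r) j = 0 \<Longrightarrow> a r j = 0"
    and "r < j \<Longrightarrow> a (Suc r) j = 0 \<Longrightarrow> (r < j \<Longrightarrow> 0 < b r (j - 1)) \<Longrightarrow> b r j = cap r j"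
    and "a r j + b r j \<le> cap r j"
  using shape_cell[OF assms] by (auto split: if_splits)

lemma shape_column_mono:
  assumes "shape m a b" "1 \<le> r" "r \<le> r'" "r' \<le> j" "j \<le> m" "a r' j = 0"
  shows "a r j = 0"
  using assms(3,2,4-6)
proof (induction r rule: inc_induct)
  case (step r)
  then show ?case using shapeD(4)[OF assms(1), of r j] by auto
qed

lemma shape_row_mono:
  assumes "shape m a b" "1 \<le> r" "r \<le> j'" "j' \<le> j" "j \<le> m" "b r j' = 0"
  shows "b r j = 0"
  using assms(4,2,3,5,6)
proof (induction j rule: dec_induct)
  case (step j)
  then show ?case using shapeD(3)[OF assms(1), of r "Suc j"] by auto
qed

text \<open>Zeros of \<open>b\<close> spread along the row away from the border, and the first one
  occurs exactly where \<open>a\<close> reaches \<open>cap\<close>.\<close>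

lemma shape_row_pos_iff:
  assumes "shape m a b" "in_tri m r j"
  shows "0 < b r j \<longleftrightarrow> (\<forall>j'\<in>{r..j}. a r j' < cap r j')"
proof
  assume b: "0 < b r j"
  show "\<forall>j'\<in>{r..j}. a r j' < cap r j'"
  proof
    fix j' assume j': "j' \<in> {r..j}"
    then have "b r j' \<noteq> 0" using b shape_row_mono[OF assms(1), of r j' j] assms(2) by auto
    then show "a r j' < cap r j'" using shapeD(6)[OF assms(1), of r j'] j' assms(2) by auto
  qed
next
  assume a: "\<forall>j'\<in>{r..j}. a r j' < cap r j'"
  have "j' \<in> {r..j} \<Longrightarrow> 0 < b r j'" for j'
  proof (induction j' rule: less_induct)
    case (less j')
    have c: "in_tri m r j'" using less.prems assms(2) by auto
    have "r < j' \<longrightarrow> 0 < b r (j' - 1)" using less.IH[of "j' - 1"] less.prems by auto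
    moreover have "a r j' < cap r j'" using a less.prems by auto
    ultimately show ?case
      using shape_cell[OF assms(1) c] by (simp split: if_splits)
  qed
  then show "0 < b r j" using assms(2) by auto
qed

lemma shape_column_pos_iff:
  assumes "shape m a b" "in_tri m r j"
  shows "0 < a r j \<longleftrightarrow> (\<forall>r'\<in>{r..j}. b r' j < cap r' j)"
proof
  assume a: "0 < a r j"
  show "\<forall>r'\<in>{r..j}. b r' j < cap r' j"
  proof
    fix r' assume r': "r' \<in> {r..j}"
    then have "a r' j \<noteq> 0" using a shape_column_mono[OF assms(1), of r r' j] assms(2) by auto
    then show "b r' j < cap r' j" using shapeD(6)[OF assms(1), of r' j] r' assms(2) by auto
  qed
next
  assume b: "\<forall>r'\<in>{r..j}. b r' j < cap r' j"
  have "r \<le> j" using assms by simp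
  then show "0 < a r j"
    using assms(2) b
  proof (induction r rule: inc_induct)
    case base
    then show ?case using shape_cell[OF assms(1), of j j] by (simp split: if_splits)
  next
    case (step r)
    then have "0 < a (Suc r) j" "b r j < cap r j" "in_tri m r j" by auto
    then show ?case
      using shape_cell[OF assms(1), of r j] cap_gt_1(2)[of r j] by (simp split: if_splits)
  qed
qed

text \<open>What remains of \<open>shape\<close> after \<open>b\<close> is eliminated: a cell is
  shadowed from within its row iff some cell of the row closer to the border is at
  \<open>cap\<close>.\<close>

definition valid :: "nat \<Rightarrow> (nat \<Rightarrow> nat \<Rightarrow> nat) \<Rightarrow> bool" where
  "valid m g \<longleftrightarrow> (\<forall>r j. in_tri m r j \<longrightarrow> g r j \<le> cap r j \<and>
     (r < j \<longrightarrow> g (Suc r) j = 0 \<longrightarrow> g r j = 0) \<and>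
     (\<forall>j'\<in>{r..<j}. g r j' = cap r j' \<longrightarrow> 0 < g (Suc r) j \<longrightarrow> g r j = cap r j))"

lemma validD:
  assumes "valid m g" "in_tri m r j"
  shows "g r j \<le> cap r j"
    and "r < j \<Longrightarrow> g (Suc r) j = 0 \<Longrightarrow> g r j = 0"
    and "r \<le> j' \<Longrightarrow> j' < j \<Longrightarrow> g r j' = cap r j' \<Longrightarrow> 0 < g (Suc r) j \<Longrightarrow> g r j = cap r j"
proof -
  have v: "g r j \<le> cap r j \<and> (r < j \<longrightarrow> g (Suc r) j = 0 \<longrightarrow> g r j = 0) \<and>
     (\<forall>j'\<in>{r..<j}. g r j' = cap r j' \<longrightarrow> 0 < g (Suc r) j \<longrightarrow> g r j = cap r j)"
    using assms unfolding valid_def by iprover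
  show "g r j \<le> cap r j" using v by iprover
  show "g r j = 0" if "r < j" "g (Suc r) j = 0" using v that by iprover
  have "\<forall>j'\<in>{r..<j}. g r j' = cap r j' \<longrightarrow> 0 < g (Suc r) j \<longrightarrow> g r j = cap r j"
    using v by iprover
  then show "g r j = cap r j" if "r \<le> j'" "j' < j" "g r j' = cap r j'" "0 < g (Suc r) j"
    using that by (meson atLeastLessThan_iff)
qed

text \<open>The second array recovered from the first. A cell shadowed only in its column has
  \<open>g r j = 0\<close>, so the complement gives the required \<open>cap r j\<close> without a
  case of its own.\<close>

definition co :: "(nat \<Rightarrow> nat \<Rightarrow> nat) \<Rightarrow> nat \<Rightarrow> nat \<Rightarrow> nat" where
  "co g r j = (if \<exists>j'\<in>{r..<j}. g r j' = cap r j' then 0 else cap r j - g r j)"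

lemma shape_row_free_iff:
  assumes "shape m a b" "in_tri m r j" "r < j"
  shows "0 < b r (j - 1) \<longleftrightarrow> \<not> (\<exists>j'\<in>{r..<j}. a r j' = cap r j')"
proof -
  have "{r..j - 1} = {r..<j}" using assms(3) by auto
  moreover have "a r j' < cap r j' \<longleftrightarrow> a r j' \<noteq> cap r j'" if "j' \<in> {r..<j}" for j'
    using that shapeD(6)[OF assms(1), of r j'] assms by auto
  moreover have "0 < b r (j - 1) \<longleftrightarrow> (\<forall>j'\<in>{r..j - 1}. a r j' < cap r j')"
    using assms by (intro shape_row_pos_iff) auto
  ultimately show ?thesis by auto
qed

lemma shape_eq_co:
  assumes "shape m a b" "in_tri m r j"
  shows "b r j = co a r j"
proof (cases "\<exists>j'\<in>{r..<j}. a r j' = cap r j'")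
  case True
  then have "r < j" by auto
  with True have "b r (j - 1) = 0" using shape_row_free_iff[OF assms] by auto
  then have "b r j = 0" using shapeD(3)[OF assms \<open>r < j\<close>] by auto
  then show ?thesis using True by (simp add: co_def)
next
  case False
  then have rf: "r < j \<Longrightarrow> 0 < b r (j - 1)" using shape_row_free_iff[OF assms] by auto
  have "b r j = cap r j - a r j"
  proof (cases "r < j \<longrightarrow> 0 < a (Suc r) j")
    case True
    then show ?thesis using shape_cell[OF assms] rf by (simp split: if_splits)
  next
    case F: False
    then show ?thesis using shapeD(4,5)[OF assms] rf by auto
  qed
  then show ?thesis using False by (simp add: co_def)
qed

lemma shape_valid: "shape m a b \<Longrightarrow> valid m a"
  unfolding valid_def
proof (intro allI impI conjI ballI)
  fix r j assume s: "shape m a b" and c: "in_tri m r j"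
  show "a r j \<le> cap r j" using shapeD(6)[OF s c] by simp
  show "r < j \<Longrightarrow> a (Suc r) j = 0 \<Longrightarrow> a r j = 0" using shapeD(4)[OF s c] by simp
  fix j' assume j': "j' \<in> {r..<j}" "a r j' = cap r j'" "0 < a (Suc r) j"
  then have "r < j" by auto
  with j' have "b r (j - 1) = 0" using shape_row_free_iff[OF s c] by auto
  then show "a r j = cap r j" using shapeD(2)[OF s c] j' \<open>r < j\<close> by simp
qed

lemma valid_shape:
  assumes "valid m g"
  shows "shape m g (co g)"
  unfolding shape_def
proof (intro allI impI)
  fix r j assume c: "in_tri m r j"
  have v: "g r j \<le> cap r j" "r < j \<Longrightarrow> g (Suc r) j = 0 \<Longrightarrow> g r j = 0"
    "\<And>j'. j'\<in>{r..<j} \<Longrightarrow> g r j' = cap r j' \<Longrightarrow> 0 < g (Suc r) j \<Longrightarrow> g r j = cap r j"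
    using validD[OF assms c] by auto
  have rf: "(r < j \<longrightarrow> 0 < co g r (j - 1)) \<longleftrightarrow> \<not> (\<exists>j'\<in>{r..<j}. g r j' = cap r j')"
  proof (cases "r < j")
    case True
    then have eq: "{r..<j} = insert (j - 1) {r..<j - 1}" by auto
    have "g r (j - 1) \<le> cap r (j - 1)"
      using c True by (intro validD(1)[OF assms]) auto
    then show ?thesis using True unfolding eq co_def by auto
  qed auto
  show "if r < j \<longrightarrow> 0 < g (Suc r) j
       then if r < j \<longrightarrow> 0 < co g r (j - 1) then g r j + co g r j = cap r j else g r j = cap r j \<and> co g r j = 0
       else if r < j \<longrightarrow> 0 < co g r (j - 1) then g r j = 0 \<and> co g r j = cap r j
            else g r j = 0 \<and> co g r j = 0"
  proof (cases "r < j \<longrightarrow> 0 < g (Suc r) j")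
    case True
    show ?thesis
    proof (cases "\<exists>j'\<in>{r..<j}. g r j' = cap r j'")
      case sh: True
      then obtain j' where "r \<le> j'" "j' < j" "g r j' = cap r j'" by auto
      then have "g r j = cap r j" using v(3)[of j'] True by simp
      then show ?thesis unfolding rf using sh True by (simp add: co_def)
    next
      case False
      then show ?thesis unfolding rf using v(1) True by (simp add: co_def)
    qed
  next
    case False
    then have "g r j = 0" using v(2) by auto
    then show ?thesis unfolding rf using False by (simp add: co_def)
  qed
qed

text \<open>A minimum is at \<open>cap\<close>, or positive, only if both entries are, so the row
  condition applies to both arrays at once. Pointwise maxima fail here: the full cell and the
  positive cell below may come from different arrays.\<close>

lemma valid_inf:
  assumes "valid m g" "valid m g'"
  shows "valid m (\<lambda>r j. min (g r j) (g' r j))"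
  unfolding valid_def
proof (intro allI impI conjI ballI)
  fix r j assume c: "in_tri m r j"
  note v = validD[OF assms(1) c] validD[OF assms(2) c]
  show "min (g r j) (g' r j) \<le> cap r j" using v(1) by auto
  show "min (g r j) (g' r j) = 0" if "r < j" "min (g (Suc r) j) (g' (Suc r) j) = 0"
  proof -
    from that(2) have "g (Suc r) j = 0 \<or> g' (Suc r) j = 0" by (auto simp: min_def split: if_splits)
    then have "g r j = 0 \<or> g' r j = 0" using v(2)[OF that(1)] v(5)[OF that(1)] by auto
    then show ?thesis by auto
  qed
  fix j' assume j': "j' \<in> {r..<j}" "min (g r j') (g' r j') = cap r j'"
    "0 < min (g (Suc r) j) (g' (Suc r) j)"
  have "g r j' \<le> cap r j'" "g' r j' \<le> cap r j'"
    using validD(1)[OF assms(1), of r j'] validD(1)[OF assms(2), of r j'] c j'(1) by (simp_all del: min_less_iff_conj)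
  then have "g r j' = cap r j'" "g' r j' = cap r j'" using j' by auto
  then show "min (g r j) (g' r j) = cap r j" using v(3,6)[of j'] j' by auto
qed

text \<open>From the sum bound, \<open>a \<le> a'\<close> is immediate at a cell that is open in its
  column for the second pair. If it is shadowed there, the cell below has \<open>a' = 0\<close>,
  hence \<open>a = 0\<close> by induction on the distance from the border, and this zero spreads
  upwards.\<close>

lemma shape_le_iff:
  assumes s: "shape m a b" and s': "shape m a' b'"
  shows "(\<forall>r j. in_tri m r j \<longrightarrow> a r j + b' r j \<le> cap r j) \<longleftrightarrow>
    (\<forall>r j. in_tri m r j \<longrightarrow> a r j \<le> a' r j)"
proof
  assume le: "\<forall>r j. in_tri m r j \<longrightarrow> a r j + b' r j \<le> cap r j"
  have "in_tri m r j \<Longrightarrow> a r j \<le> a' r j" for r j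
  proof (induction "j - r" arbitrary: r j rule: less_induct)
    case less
    have sum: "a r j + b' r j \<le> cap r j" using le less.prems by blast
    show ?case
    proof (cases "r < j \<longrightarrow> 0 < a' (Suc r) j")
      case False
      then have rj: "r < j" "a' (Suc r) j = 0" by auto
      then have "a (Suc r) j \<le> a' (Suc r) j" using less.prems by (intro less.hyps) auto
      then show ?thesis using rj shapeD(4)[OF s less.prems] by simp
    next
      case cf: True
      show ?thesis
      proof (cases "r < j \<longrightarrow> 0 < b' r (j - 1)")
        case True
        then have "a' r j + b' r j = cap r j" using cf shape_cell[OF s' less.prems] by simp
        then show ?thesis using sum by simp
      next
        case False
        then have "a' r j = cap r j" using cf shape_cell[OF s' less.prems] by simp
        then show ?thesis using shapeD(6)[OF s less.prems] by simp
      qed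
    qed
  qed
  then show "\<forall>r j. in_tri m r j \<longrightarrow> a r j \<le> a' r j" by blast
next
  assume *: "\<forall>r j. in_tri m r j \<longrightarrow> a r j \<le> a' r j"
  show "\<forall>r j. in_tri m r j \<longrightarrow> a r j + b' r j \<le> cap r j"
  proof (intro allI impI)
    fix r j assume c: "in_tri m r j"
    show "a r j + b' r j \<le> cap r j"
      using *[rule_format, OF c] shapeD(6)[OF s' c] by simp
  qed
qed

text \<open>Enlarging \<open>a\<close> shrinks the complement, and a cell at \<open>cap\<close>
  stays at \<open>cap\<close>, so shadows in rows persist.\<close>

lemma shape_le_imp_b_ge:
  assumes s: "shape m a b" and s': "shape m a' b'"
    and le: "\<forall>r j. in_tri m r j \<longrightarrow> a r j \<le> a' r j" and c: "in_tri m r j"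
  shows "b' r j \<le> b r j"
proof (cases "\<exists>j'\<in>{r..<j}. a r j' = cap r j'")
  case True
  then obtain j' where j': "j' \<in> {r..<j}" "a r j' = cap r j'" by blast
  then have c': "in_tri m r j'" using c by auto
  have "a' r j' = cap r j'"
    using le[rule_format, OF c'] shapeD(6)[OF s' c'] j'(2) by simp
  then have "b' r j = 0" using j'(1) unfolding shape_eq_co[OF s' c] co_def by auto
  then show ?thesis by simp
next
  case False
  then have "b r j = cap r j - a r j" unfolding shape_eq_co[OF s c] co_def by simp
  moreover have "a r j \<le> a' r j" using le[rule_format, OF c] .
  ultimately show ?thesis using shapeD(6)[OF s' c] by linarith
qed

text \<open>The ordinary transposition of the board, written with column labels that decrease from
  left to right. It preserves \<open>j - r\<close>, the distance from the border.\<close>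

definition transp :: "nat \<Rightarrow> (nat \<Rightarrow> nat \<Rightarrow> nat) \<Rightarrow> nat \<Rightarrow> nat \<Rightarrow> nat" where
  "transp m g r j = g (m + 1 - j) (m + 1 - r)"

lemma in_tri_transp: "in_tri m r j \<Longrightarrow> in_tri m (m + 1 - j) (m + 1 - r)"
  by auto

lemma cap_transp: "in_tri m r j \<Longrightarrow> cap (m + 1 - j) (m + 1 - r) = cap r j"
  by (auto simp: cap_def)

lemma transp_transp: "in_tri m r j \<Longrightarrow> transp m (transp m g) r j = g r j"
  by (auto simp: transp_def)

lemma shape_transp:
  assumes "shape m a b"
  shows "shape m (transp m b) (transp m a)"
  unfolding shape_def
proof (intro allI impI)
  fix r j assume c: "in_tri m r j"
  define R J where RJ: "R = m + 1 - j" "J = m + 1 - r"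
  have c': "in_tri m R J" using c by (auto simp: RJ)
  have eqs: "transp m b (Suc r) j = b R (J - 1)" "transp m b r j = b R J" "transp m a r j = a R J"
    by (simp_all add: transp_def RJ)
  have eq2: "transp m a r (j - 1) = a (Suc R) J" if "r < j"
    using that c by (simp add: transp_def RJ Suc_diff_le)
  have lt: "r < j \<longleftrightarrow> R < J" and cap: "cap r j = cap R J"
    using c by (auto simp: RJ cap_def)
  show "if r < j \<longrightarrow> 0 < transp m b (Suc r) j
     then if r < j \<longrightarrow> 0 < transp m a r (j - 1) then transp m b r j + transp m a r j = cap r j
       else transp m b r j = cap r j \<and> transp m a r j = 0
     else if r < j \<longrightarrow> 0 < transp m a r (j - 1) then transp m b r j = 0 \<and> transp m a r j = cap r j
       else transp m b r j = 0 \<and> transp m a r j = 0"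
  proof (cases "R < J")
    case True
    then show ?thesis using shape_cell[OF assms c'] eq2 unfolding eqs lt cap
      by (simp add: add.commute split: if_splits)
  next
    case False
    then show ?thesis using shape_cell[OF assms c'] unfolding eqs lt cap
      by (simp add: add.commute)
  qed
qed

section \<open>The lattice of arrays\<close>

text \<open>An interface that is its own dual. All that is asked for is that every
  \<open>shape\<close> is realised and that the order is the sum bound; the existence of meets and
  joins is derived.\<close>

locale triangle_lattice =
  fixes L :: "'a gorder" (structure) and m :: nat and a b :: "'a \<Rightarrow> nat \<Rightarrow> nat \<Rightarrow> nat"
  assumes eq_eq: "eq L = (=)"
    and finite_carrier': "finite (carrier L)"
    and antisym': "\<lbrakk>S \<in> carrier L; T \<in> carrier L; S \<sqsubseteq> T; T \<sqsubseteq> S\<rbrakk> \<Longrightarrow> S = T"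
    and shape: "S \<in> carrier L \<Longrightarrow> shape m (a S) (b S)"
    and ex_shape: "shape m g g' \<Longrightarrow>
      \<exists>S\<in>carrier L. \<forall>r j. in_tri m r j \<longrightarrow> a S r j = g r j \<and> b S r j = g' r j"
    and le_iff: "\<lbrakk>S \<in> carrier L; T \<in> carrier L\<rbrakk> \<Longrightarrow>
      S \<sqsubseteq> T \<longleftrightarrow> (\<forall>r j. in_tri m r j \<longrightarrow> a S r j + b T r j \<le> cap r j)"
begin

lemma dual: "triangle_lattice (inv_gorder L) m (\<lambda>S. transp m (b S)) (\<lambda>S. transp m (a S))"
proof (unfold_locales; (simp add: eq_eq finite_carrier' antisym' shape_transp[OF shape])?)
  fix g g' assume "shape m g g'"
  from ex_shape[OF shape_transp[OF this]] obtain S where S: "S \<in> carrier L"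
    "\<And>r j. in_tri m r j \<Longrightarrow> a S r j = transp m g' r j \<and> b S r j = transp m g r j" by blast
  have "transp m (b S) r j = g r j \<and> transp m (a S) r j = g' r j" if "in_tri m r j" for r j
  proof -
    have "transp m (b S) r j = transp m (transp m g) r j"
      "transp m (a S) r j = transp m (transp m g') r j"
      using S(2)[OF in_tri_transp[OF that]] by (simp_all add: transp_def)
    then show ?thesis using transp_transp[OF that] by metis
  qed
  then show "\<exists>S\<in>carrier L. \<forall>r j. Suc 0 \<le> r \<and> r \<le> j \<and> j \<le> m \<longrightarrow>
      transp m (b S) r j = g r j \<and> transp m (a S) r j = g' r j"
    using S(1) by (intro bexI[of _ S]) auto
next
  fix S T assume ST: "S \<in> carrier L" "T \<in> carrier L"
  show "le L T S \<longleftrightarrow> (\<forall>r j. Suc 0 \<le> r \<and> r \<le> j \<and> j \<le> m \<longrightarrow>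
      transp m (b S) r j + transp m (a T) r j \<le> cap r j)"
    unfolding le_iff[OF ST(2,1)]
  proof (intro iffI allI impI)
    fix r j
    assume *: "\<forall>r j. in_tri m r j \<longrightarrow> a T r j + b S r j \<le> cap r j" and c: "Suc 0 \<le> r \<and> r \<le> j \<and> j \<le> m"
    from c have c: "in_tri m r j" by simp
    show "transp m (b S) r j + transp m (a T) r j \<le> cap r j"
      using *[rule_format, OF in_tri_transp[OF c]] cap_transp[OF c] by (simp add: transp_def)
  next
    fix r j
    assume *: "\<forall>r j. Suc 0 \<le> r \<and> r \<le> j \<and> j \<le> m \<longrightarrow>
      transp m (b S) r j + transp m (a T) r j \<le> cap r j" and c: "in_tri m r j"
    have "Suc 0 \<le> m + 1 - j \<and> m + 1 - j \<le> m + 1 - r \<and> m + 1 - r \<le> m" using c by auto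
    from *[rule_format, OF this] show "a T r j + b S r j \<le> cap r j"
      using cap_transp[OF c] transp_transp[OF c, of "b S"] transp_transp[OF c, of "a T"]
      by (simp add: transp_def)
  qed
qed

lemma le_iff_a:
  assumes "S \<in> carrier L" "T \<in> carrier L"
  shows "S \<sqsubseteq> T \<longleftrightarrow> (\<forall>r j. in_tri m r j \<longrightarrow> a S r j \<le> a T r j)"
  unfolding le_iff[OF assms] by (rule shape_le_iff[OF shape[OF assms(1)] shape[OF assms(2)]])

lemma poset: "poset L"
proof
  show "eq L = (=)" by (rule eq_eq)
  fix x y z assume x: "x \<in> carrier L" and y: "y \<in> carrier L"
  show "x \<sqsubseteq> x" using x by (simp add: le_iff_a)
  show "x .= y" if "x \<sqsubseteq> y" "y \<sqsubseteq> x" using antisym'[OF x y that] by (simp add: eq_eq)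
  show "x \<sqsubseteq> z" if "x \<sqsubseteq> y" "y \<sqsubseteq> z" "z \<in> carrier L"
    using that x y by (meson le_iff_a order.trans)
qed (simp_all add: eq_eq)

sublocale poset L by (rule poset)

section \<open>Elements with a prescribed array; meets and joins\<close>

definition mk :: "(nat \<Rightarrow> nat \<Rightarrow> nat) \<Rightarrow> 'a" where
  "mk g = (SOME S. S \<in> carrier L \<and> (\<forall>r j. in_tri m r j \<longrightarrow> a S r j = g r j))"

lemma mk:
  assumes "valid m g"
  shows mk_closed: "mk g \<in> carrier L" and a_mk: "in_tri m r j \<Longrightarrow> a (mk g) r j = g r j"
    and b_mk: "in_tri m r j \<Longrightarrow> b (mk g) r j = co g r j"
proof -
  from ex_shape[OF valid_shape[OF assms]] obtain S where S: "S \<in> carrier L"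
    "\<forall>r j. in_tri m r j \<longrightarrow> a S r j = g r j \<and> b S r j = co g r j" by (rule bexE)
  have S': "\<forall>r j. in_tri m r j \<longrightarrow> a S r j = g r j"
  proof (intro allI impI)
    fix r j assume "in_tri m r j"
    with S(2) show "a S r j = g r j" by iprover
  qed
  have *: "mk g \<in> carrier L \<and> (\<forall>r j. in_tri m r j \<longrightarrow> a (mk g) r j = g r j)"
    unfolding mk_def by (rule someI) (rule conjI[OF S(1) S'])
  show 1: "mk g \<in> carrier L" using * by (rule conjunct1)
  have 2: "a (mk g) r j = g r j" if "in_tri m r j" for r j using * that by iprover
  show "in_tri m r j \<Longrightarrow> a (mk g) r j = g r j" by (rule 2)
  show "b (mk g) r j = co g r j" if "in_tri m r j"
  proof -
    have "co (a (mk g)) r j = co g r j" using 2 that by (auto simp: co_def)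
    then show ?thesis using shape_eq_co[OF shape[OF 1] that] by simp
  qed
qed

lemma ab_le_cap: "S \<in> carrier L \<Longrightarrow> in_tri m r j \<Longrightarrow> a S r j + b S r j \<le> cap r j"
  using shapeD(6)[OF shape] by blast

lemma valid_a: "S \<in> carrier L \<Longrightarrow> valid m (a S)"
  by (rule shape_valid[OF shape])

lemma b_eq_co: "S \<in> carrier L \<Longrightarrow> in_tri m r j \<Longrightarrow> b S r j = co (a S) r j"
  by (rule shape_eq_co[OF shape])

lemma greatest_mk_min:
  assumes "S \<in> carrier L" "T \<in> carrier L"
  shows "greatest L (mk (\<lambda>r j. min (a S r j) (a T r j))) (Lower L {S, T})"
proof -
  have v: "valid m (\<lambda>r j. min (a S r j) (a T r j))" by (intro valid_inf valid_a assms)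
  show ?thesis
    using assms mk_closed[OF v] by (intro greatest_LowerI) (auto simp: le_iff_a a_mk[OF v] Lower_def)
qed

lemma lower_semilattice: "lower_semilattice L"
  by unfold_locales (blast intro: greatest_mk_min)

text \<open>Meets come from pointwise minima of \<open>a\<close>; joins are the meets of the dual
  interpretation.\<close>

lemma fin_lattice: "fin_lattice L"
proof -
  interpret d: triangle_lattice "inv_gorder L" m "\<lambda>S. transp m (b S)" "\<lambda>S. transp m (a S)"
    by (rule dual)
  interpret dl: lower_semilattice "inv_gorder L" by (rule d.lower_semilattice)
  interpret l: lower_semilattice L by (rule lower_semilattice)
  show ?thesis
  proof (unfold_locales)
    fix x y assume "x \<in> carrier L" "y \<in> carrier L"
    then show "\<exists>s. least L s (Upper L {x, y})" using dl.inf_of_two_exists[of x y] by simp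
  qed (rule finite_carrier')
qed

sublocale fin_lattice L by (rule fin_lattice)

lemma a_meet:
  assumes "S \<in> carrier L" "T \<in> carrier L" "in_tri m r j"
  shows "a (S \<sqinter> T) r j = min (a S r j) (a T r j)"
proof -
  have v: "valid m (\<lambda>r j. min (a S r j) (a T r j))" by (intro valid_inf valid_a assms)
  have "S \<sqinter> T = mk (\<lambda>r j. min (a S r j) (a T r j))"
    using greatest_unique[OF inf_of_two_greatest[OF assms(1,2)] greatest_mk_min[OF assms(1,2)]]
    by (simp add: meet_def)
  then show ?thesis using a_mk[OF v assms(3)] by simp
qed

lemma b_join:
  assumes "S \<in> carrier L" "T \<in> carrier L" "in_tri m r j"
  shows "b (S \<squnion> T) r j = min (b S r j) (b T r j)"
proof -
  interpret d: triangle_lattice "inv_gorder L" m "\<lambda>S. transp m (b S)" "\<lambda>S. transp m (a S)"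
    by (rule dual)
  show ?thesis
    using d.a_meet[OF _ _ in_tri_transp[OF assms(3)], of S T] assms(1,2)
      transp_transp[OF assms(3), of "b S"] transp_transp[OF assms(3), of "b T"]
      transp_transp[OF assms(3), of "b (S \<squnion> T)"] by (simp add: transp_def)
qed

lemma b_antimono:
  assumes "S \<in> carrier L" "T \<in> carrier L" "S \<sqsubseteq> T" "in_tri m r j"
  shows "b T r j \<le> b S r j"
  using b_join[OF assms(1,2,4)] join_eq_right[OF assms(1,2,3)] by simp

lemma a_mono:
  assumes "S \<in> carrier L" "T \<in> carrier L" "S \<sqsubseteq> T" "in_tri m r j"
  shows "a S r j \<le> a T r j"
  using assms by (simp add: le_iff_a)

subsection \<open>Join-irreducible elements\<close>

definition labels :: "(nat \<times> nat \<times> nat) set" where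
  "labels = {(r, j, k). in_tri m r j \<and> 1 \<le> k \<and> k \<le> cap r j}"

lemma finite_labels: "finite labels"
  by (rule finite_subset[of _ "{..m} \<times> {..m} \<times> {..3}"]) (auto simp: labels_def cap_def split: if_splits)

text \<open>For positive \<open>k\<close> this is the least valid array with entry at least
  \<open>k\<close> at \<open>(r, j)\<close>: a positive entry forces positive entries below it in
  its column, and nothing else. For \<open>k = 0\<close> the ones below remain, which makes it the
  lower neighbour of the case \<open>k = 1\<close>.\<close>

definition ji_array :: "nat \<Rightarrow> nat \<Rightarrow> nat \<Rightarrow> nat \<Rightarrow> nat \<Rightarrow> nat" where
  "ji_array r j k r' j' = (if r' = r \<and> j' = j then k else if j' = j \<and> r < r' then 1 else 0)"

definition ji_elem :: "nat \<Rightarrow> nat \<Rightarrow> nat \<Rightarrow> 'a" where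
  "ji_elem r j k = mk (ji_array r j k)"

lemma valid_ji_array:
  assumes "k \<le> cap r j"
  shows "valid m (ji_array r j k)"
  unfolding valid_def
proof (intro allI impI conjI ballI)
  fix r' j' assume c: "in_tri m r' j'"
  show "ji_array r j k r' j' \<le> cap r' j'" using assms by (auto simp: ji_array_def cap_def)
  show "r' < j' \<Longrightarrow> ji_array r j k (Suc r') j' = 0 \<Longrightarrow> ji_array r j k r' j' = 0"
    by (auto simp: ji_array_def split: if_splits)
  fix j'' assume j'': "j'' \<in> {r'..<j'}" "ji_array r j k r' j'' = cap r' j''" "0 < ji_array r j k (Suc r') j'"
  then have "j'' = j" "j' = j" by (auto simp: ji_array_def cap_def split: if_splits)
  then show "ji_array r j k r' j' = cap r' j'" using j'' by simp
qed

lemma co_ji_array: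
  assumes "r \<le> j"
  shows "co (ji_array r j k) r' j' = (if r' = r \<and> j < j' \<and> k = cap r j then 0 else cap r' j' - ji_array r j k r' j')"
proof -
  have "(\<exists>j''\<in>{r'..<j'}. ji_array r j k r' j'' = cap r' j'') \<longleftrightarrow> r' = r \<and> j < j' \<and> k = cap r j"
    using assms by (auto simp: ji_array_def split: if_splits)
  then show ?thesis by (simp add: co_def)
qed

lemma ji_elem:
  assumes "k \<le> cap r j"
  shows ji_elem_closed: "ji_elem r j k \<in> carrier L"
    and a_ji_elem: "in_tri m r' j' \<Longrightarrow> a (ji_elem r j k) r' j' = ji_array r j k r' j'"
    and b_ji_elem: "r \<le> j \<Longrightarrow> in_tri m r' j' \<Longrightarrow> b (ji_elem r j k) r' j' =
      (if r' = r \<and> j < j' \<and> k = cap r j then 0 else cap r' j' - ji_array r j k r' j')"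
  using mk[OF valid_ji_array[OF assms]] co_ji_array by (auto simp: ji_elem_def)

lemma a_column_pos:
  assumes "S \<in> carrier L" "1 \<le> r" "r \<le> r'" "r' \<le> j" "j \<le> m" "0 < a S r j"
  shows "0 < a S r' j"
  using shape_column_mono[OF shape[OF assms(1)] assms(2-5)] assms(6) by auto

lemma ji_elem_le_iff:
  assumes "S \<in> carrier L" "in_tri m r j" "1 \<le> k" "k \<le> cap r j"
  shows "ji_elem r j k \<sqsubseteq> S \<longleftrightarrow> k \<le> a S r j"
proof
  assume "ji_elem r j k \<sqsubseteq> S"
  then have "a (ji_elem r j k) r j \<le> a S r j" using a_mono ji_elem_closed[OF assms(4)] assms by auto
  then show "k \<le> a S r j" using a_ji_elem[OF assms(4,2)] by (simp add: ji_array_def)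
next
  assume k: "k \<le> a S r j"
  show "ji_elem r j k \<sqsubseteq> S" unfolding le_iff_a[OF ji_elem_closed[OF assms(4)] assms(1)]
  proof (intro allI impI)
    fix r' j' assume c: "in_tri m r' j'"
    have "0 < a S r' j" if "j' = j" "r < r'"
      using a_column_pos[OF assms(1), of r r' j] that c k assms by auto
    then show "a (ji_elem r j k) r' j' \<le> a S r' j'"
      unfolding a_ji_elem[OF assms(4) c] using k by (auto simp: ji_array_def)
  qed
qed

lemma ji_elem_irreducible:
  assumes "(r, j, k) \<in> labels"
  shows "ji_elem r j k \<in> join_irreducibles L" "lower_cover L (ji_elem r j k) = ji_elem r j (k - Suc 0)"
proof -
  have c: "in_tri m r j" and k: "1 \<le> k" "k \<le> cap r j" "k - Suc 0 \<le> cap r j"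
    using assms by (auto simp: labels_def)
  have le: "ji_elem r j (k - Suc 0) \<sqsubseteq> ji_elem r j k"
    unfolding le_iff_a[OF ji_elem_closed[OF k(3)] ji_elem_closed[OF k(2)]]
    by (auto simp: a_ji_elem[OF k(2)] a_ji_elem[OF k(3)] ji_array_def)
  have ne: "ji_elem r j (k - Suc 0) \<noteq> ji_elem r j k"
  proof
    assume "ji_elem r j (k - Suc 0) = ji_elem r j k"
    then have "a (ji_elem r j (k - Suc 0)) r j = a (ji_elem r j k) r j" by simp
    then show False using k by (simp add: a_ji_elem[OF k(2) c] a_ji_elem[OF k(3) c] ji_array_def)
  qed
  have below: "y \<sqsubseteq> ji_elem r j (k - Suc 0)" if y: "y \<in> carrier L" "y \<sqsubseteq> ji_elem r j k" "y \<noteq> ji_elem r j k" for y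
    unfolding le_iff_a[OF y(1) ji_elem_closed[OF k(3)]]
  proof (intro allI impI)
    fix r' j' assume c': "in_tri m r' j'"
    have "\<not> k \<le> a y r j"
      using y ji_elem_le_iff[OF y(1) c k(1,2)] ji_elem_closed[OF k(2)] le_antisym by auto
    moreover have "a y r' j' \<le> ji_array r j k r' j'"
      using a_mono[OF y(1) ji_elem_closed[OF k(2)] y(2) c'] a_ji_elem[OF k(2) c'] by simp
    ultimately show "a y r' j' \<le> a (ji_elem r j (k - Suc 0)) r' j'"
      unfolding a_ji_elem[OF k(3) c'] by (auto simp: ji_array_def split: if_splits)
  qed
  show "ji_elem r j k \<in> join_irreducibles L" "lower_cover L (ji_elem r j k) = ji_elem r j (k - Suc 0)"
    using join_irreducibleI[OF ji_elem_closed[OF k(2)] ji_elem_closed[OF k(3)] le ne below] by auto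
qed

text \<open>At some cell \<open>x\<close> exceeds its lower cover. The least element with that entry
  lies below \<open>x\<close> but not below the lower cover, so it is \<open>x\<close>.\<close>

lemma join_irreducible_cases:
  assumes "x \<in> join_irreducibles L"
  obtains r j k where "(r, j, k) \<in> labels" "x = ji_elem r j k"
proof -
  note D = join_irreducibleD[OF finite_carrier assms]
  let ?y = "lower_cover L x"
  have y: "?y \<in> carrier L" "?y \<sqsubseteq> x" "?y \<noteq> x" using D(2) by (auto simp: covers_iff)
  then have "\<not> x \<sqsubseteq> ?y" using D(1) le_antisym by blast
  then obtain r j where c: "in_tri m r j" "\<not> a x r j \<le> a ?y r j"
    unfolding le_iff_a[OF D(1) y(1)] by blast
  define k where "k = a x r j"
  have k: "1 \<le> k" "k \<le> cap r j"
    using c ab_le_cap[OF D(1) c(1)] by (auto simp: k_def)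
  have "ji_elem r j k \<sqsubseteq> x" "\<not> ji_elem r j k \<sqsubseteq> ?y"
    using ji_elem_le_iff[OF D(1) c(1) k] ji_elem_le_iff[OF y(1) c(1) k] c(2) by (auto simp: k_def)
  then have "ji_elem r j k = x" using D(3) ji_elem_closed[OF k(2)] by blast
  then show thesis using that[of r j k] c(1) k by (auto simp: labels_def)
qed

lemma bij_betw_labels: "bij_betw (\<lambda>(r, j, k). ji_elem r j k) labels (join_irreducibles L)"
  unfolding bij_betw_def
proof
  show "inj_on (\<lambda>(r, j, k). ji_elem r j k) labels"
  proof (rule inj_onI)
    fix x y assume "x \<in> labels" "y \<in> labels"
      "(case x of (r, j, k) \<Rightarrow> ji_elem r j k) = (case y of (r, j, k) \<Rightarrow> ji_elem r j k)"
    then obtain r j k r' j' k' where xy: "x = (r, j, k)" "y = (r', j', k')"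
      and l: "(r, j, k) \<in> labels" and l': "(r', j', k') \<in> labels" and eq: "ji_elem r j k = ji_elem r' j' k'"
      by (cases x, cases y) auto
    have c: "in_tri m r j" "k \<le> cap r j" "k - Suc 0 \<le> cap r j" "1 \<le> k" using l by (auto simp: labels_def)
    have c': "in_tri m r' j'" "k' \<le> cap r' j'" "k' - Suc 0 \<le> cap r' j'" "1 \<le> k'" using l' by (auto simp: labels_def)
    \<comment> \<open>Comparing the lower covers as well locates the cell: between
      \<open>k - 1\<close> and \<open>k\<close> the array changes at \<open>(r, j)\<close>
      only.\<close>
    have "ji_elem r j (k - Suc 0) = ji_elem r' j' (k' - Suc 0)"
      using ji_elem_irreducible(2)[OF l] ji_elem_irreducible(2)[OF l'] eq by simp
    then have "ji_array r j (k - Suc 0) r' j' = k' - Suc 0"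
      using a_ji_elem[OF c(3) c'(1)] a_ji_elem[OF c'(3,1)] by (simp add: ji_array_def)
    moreover have "ji_array r j k r' j' = k'"
      using a_ji_elem[OF c(2) c'(1)] a_ji_elem[OF c'(2,1)] eq by (simp add: ji_array_def)
    ultimately show "x = y" unfolding xy
      using c(4) c'(4) by (auto simp: ji_array_def split: if_splits)
  qed
  show "(\<lambda>(r, j, k). ji_elem r j k) ` labels = join_irreducibles L"
  proof
    show "(\<lambda>(r, j, k). ji_elem r j k) ` labels \<subseteq> join_irreducibles L"
      using ji_elem_irreducible(1) by auto
    show "join_irreducibles L \<subseteq> (\<lambda>(r, j, k). ji_elem r j k) ` labels"
    proof
      fix x assume "x \<in> join_irreducibles L"
      then obtain r j k where "(r, j, k) \<in> labels" "x = ji_elem r j k" by (rule join_irreducible_cases)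
      then show "x \<in> (\<lambda>(r, j, k). ji_elem r j k) ` labels" by (intro image_eqI[of _ _ "(r, j, k)"]) auto
    qed
  qed
qed

lemma card_join_irreducibles: "card (join_irreducibles L) = card labels"
  using bij_betw_same_card[OF bij_betw_labels] by simp

lemma card_meet_irreducibles: "card (meet_irreducibles L) = card labels"
proof -
  interpret d: triangle_lattice "inv_gorder L" m "\<lambda>S. transp m (b S)" "\<lambda>S. transp m (a S)"
    by (rule dual)
  show ?thesis
    using d.card_join_irreducibles by (simp add: meet_irreducibles_dual labels_def d.labels_def)
qed

subsection \<open>Semidistributivity\<close>

text \<open>At a cell where the left side has the larger entry, \<open>x\<close> and
  \<open>y\<close> both have the smaller entry of \<open>x \<sqinter> z\<close>. If both satisfy
  \<open>b = cap - a\<close> there, their join has the same complement, which leaves no room for a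
  larger \<open>a\<close>.\<close>

lemma meet_semidistributive:
  assumes x: "x \<in> carrier L" and y: "y \<in> carrier L" and z: "z \<in> carrier L"
    and eq: "x \<sqinter> z = y \<sqinter> z"
  shows "(x \<squnion> y) \<sqinter> z = x \<sqinter> z"
proof -
  let ?w = "(x \<squnion> y) \<sqinter> z" and ?v = "x \<sqinter> z"
  have c: "x \<squnion> y \<in> carrier L" "?w \<in> carrier L" "?v \<in> carrier L" using x y z by auto
  have "in_tri m r j \<Longrightarrow> a ?w r j \<le> a ?v r j" for r j
  proof (induction "j - r" arbitrary: r j rule: less_induct)
    case less
    note t = less.prems
    show ?case
    proof (rule ccontr)
      assume "\<not> a ?w r j \<le> a ?v r j"
      then have gt: "a ?v r j < a ?w r j" by simp
      have vx: "a ?v r j = min (a x r j) (a z r j)" by (rule a_meet[OF x z t])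
      have vy: "a ?v r j = min (a y r j) (a z r j)" unfolding eq by (rule a_meet[OF y z t])
      have w: "a ?w r j = min (a (x \<squnion> y) r j) (a z r j)" by (rule a_meet[OF c(1) z t])
      \<comment> \<open>This fails only for a cell shadowed from within its row with
        \<open>a\<close> below \<open>cap\<close>. Then it is shadowed in its column too, and
        induction at the cell below gives \<open>a ?w r j = 0\<close>, contrary to
        \<open>gt\<close>.\<close>
      have b_u: "b u r j = cap r j - a u r j"
        if u: "u \<in> carrier L" "a u r j < a ?w r j" "?v = u \<sqinter> z" for u
      proof (cases "r < j \<longrightarrow> 0 < b u r (j - 1)")
        case True
        then show ?thesis using shape_cell[OF shape[OF u(1)] t] by (auto split: if_splits)
      next
        case False
        then have rj: "r < j" by simp
        have "a u r j \<noteq> cap r j" using u(2) ab_le_cap[OF c(2) t] by simp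
        then have "a u (Suc r) j = 0"
          using shape_cell[OF shape[OF u(1)] t] False by (auto split: if_splits)
        moreover have t': "in_tri m (Suc r) j" using t rj by simp
        have "a ?v (Suc r) j = min (a u (Suc r) j) (a z (Suc r) j)"
          unfolding u(3) by (rule a_meet[OF u(1) z t'])
        moreover have "a ?w (Suc r) j \<le> a ?v (Suc r) j" using less.hyps[OF _ t'] rj t by auto
        ultimately have "a ?w (Suc r) j = 0" by simp
        then show ?thesis using shapeD(4)[OF shape[OF c(2)] t rj] gt by simp
      qed
      have "a x r j < a ?w r j" "a y r j < a ?w r j" using gt vx vy w by auto
      then have "b (x \<squnion> y) r j = min (cap r j - a x r j) (cap r j - a y r j)"
        using b_join[OF x y t] b_u[OF x] b_u[OF y] eq by simp
      moreover have "a (x \<squnion> y) r j + b (x \<squnion> y) r j \<le> cap r j" by (rule ab_le_cap[OF c(1) t])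
      ultimately show False
        using \<open>a x r j < a ?w r j\<close> \<open>a y r j < a ?w r j\<close> w ab_le_cap[OF c(2) t] by linarith
    qed
  qed
  then have "?w \<sqsubseteq> ?v" by (simp add: le_iff_a[OF c(2,3)])
  moreover have "?v \<sqsubseteq> ?w"
    using x y z c by (intro meet_le le_trans[OF meet_left join_left] meet_right) auto
  ultimately show ?thesis using c le_antisym by blast
qed

lemma semidistributive: "semidistributive L"
proof -
  interpret d: triangle_lattice "inv_gorder L" m "\<lambda>S. transp m (b S)" "\<lambda>S. transp m (a S)"
    by (rule dual)
  show ?thesis
    using meet_semidistributive d.meet_semidistributive by (auto simp: semidistributive_def)
qed

subsection \<open>Trimness\<close>

text \<open>Cell by cell: if \<open>b y \<le> b x\<close>, the bound for
  \<open>y \<squnion> x\<close> suffices; if \<open>a z \<le> a x\<close>, the bound for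
  \<open>x \<sqinter> z\<close> does. Otherwise the two entries are at most
  \<open>cap - b x = a x\<close> and \<open>cap - a x = b x\<close>, and these add up to
  \<open>cap\<close>.\<close>

lemma left_modularI:
  assumes x: "x \<in> carrier L" and full: "\<And>r j. in_tri m r j \<Longrightarrow> a x r j + b x r j = cap r j"
  shows "left_modular_element L x"
  unfolding left_modular_element_def
proof (intro conjI ballI impI x)
  fix y z assume y: "y \<in> carrier L" and z: "z \<in> carrier L" and yz: "y \<sqsubseteq> z"
  let ?l = "(y \<squnion> x) \<sqinter> z" and ?r = "y \<squnion> (x \<sqinter> z)"
  have c: "?l \<in> carrier L" "?r \<in> carrier L" "y \<squnion> x \<in> carrier L" "x \<sqinter> z \<in> carrier L"
    using x y z by auto
  have "?l \<sqsubseteq> ?r" unfolding le_iff[OF c(1,2)]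
  proof (intro allI impI)
    fix r j assume t: "in_tri m r j"
    have "a ?l r j = min (a (y \<squnion> x) r j) (a z r j)" by (rule a_meet[OF c(3) z t])
    moreover have "b ?r r j = min (b y r j) (b (x \<sqinter> z) r j)" by (rule b_join[OF y c(4) t])
    moreover have "b (y \<squnion> x) r j = min (b y r j) (b x r j)" by (rule b_join[OF y x t])
    moreover have "a (x \<sqinter> z) r j = min (a x r j) (a z r j)" by (rule a_meet[OF x z t])
    moreover note full[OF t] ab_le_cap[OF c(3) t] ab_le_cap[OF c(4) t]
    ultimately show "a ?l r j + b ?r r j \<le> cap r j" by (simp add: min_def split: if_splits)
  qed
  moreover have "?r \<sqsubseteq> ?l"
    using x y z c yz
    by (intro meet_le join_le join_left le_trans[OF meet_left join_right] meet_right) auto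
  ultimately show "?l = ?r" using c le_antisym by blast
qed

text \<open>Cells are filled row by row from the largest \<open>r\<close>, and within a row from the
  largest \<open>j\<close>. A cell that becomes full then shadows only cells that are full already,
  so no cell is ever shadowed from both sides.\<close>

definition spine_array :: "nat \<Rightarrow> nat \<Rightarrow> nat \<Rightarrow> nat \<Rightarrow> nat \<Rightarrow> nat" where
  "spine_array r j k r' j' =
    (if r < r' \<or> r' = r \<and> j < j' then cap r' j' else if r' = r \<and> j' = j then k else 0)"

lemma valid_spine_array:
  assumes "k \<le> cap r j"
  shows "valid m (spine_array r j k)"
  unfolding valid_def
proof (intro allI impI conjI ballI)
  fix r' j' assume c: "in_tri m r' j'"
  show "spine_array r j k r' j' \<le> cap r' j'" using assms by (auto simp: spine_array_def)
  show "r' < j' \<Longrightarrow> spine_array r j k (Suc r') j' = 0 \<Longrightarrow> spine_array r j k r' j' = 0"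
    by (auto simp: spine_array_def split: if_splits)
  fix j'' assume "j'' \<in> {r'..<j'}" "spine_array r j k r' j'' = cap r' j''" "0 < spine_array r j k (Suc r') j'"
  then show "spine_array r j k r' j' = cap r' j'" by (auto simp: spine_array_def split: if_splits)
qed

lemma spine_array_mono:
  assumes "k \<le> cap r j" "r' < r \<or> r' = r \<and> j' < j \<or> r' = r \<and> j' = j \<and> k \<le> k'"
  shows "spine_array r j k s i \<le> spine_array r' j' k' s i"
proof (cases "s = r \<and> i = j")
  case True
  then show ?thesis using assms by (auto simp: spine_array_def)
next
  case False
  then show ?thesis using assms(2) by (auto simp: spine_array_def)
qed

lemma spine_array_co: "k \<le> cap r j \<Longrightarrow> spine_array r j k r' j' + co (spine_array r j k) r' j' = cap r' j'"
  by (auto simp: co_def spine_array_def split: if_splits)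

definition spine_elem :: "nat \<Rightarrow> nat \<Rightarrow> nat \<Rightarrow> 'a" where
  "spine_elem r j k = mk (spine_array r j k)"

lemma spine_elem:
  assumes "k \<le> cap r j"
  shows spine_elem_closed: "spine_elem r j k \<in> carrier L"
    and a_spine_elem: "in_tri m r' j' \<Longrightarrow> a (spine_elem r j k) r' j' = spine_array r j k r' j'"
    and left_modular_spine_elem: "left_modular_element L (spine_elem r j k)"
proof -
  note M = mk[OF valid_spine_array[OF assms]]
  show 1: "spine_elem r j k \<in> carrier L" and 2: "in_tri m r' j' \<Longrightarrow> a (spine_elem r j k) r' j' = spine_array r j k r' j'"
    using M by (auto simp: spine_elem_def)
  show "left_modular_element L (spine_elem r j k)"
    by (rule left_modularI[OF 1]) (use M spine_array_co[OF assms] in \<open>auto simp: spine_elem_def\<close>)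
qed

definition spine :: "'a set" where
  "spine = insert (mk (\<lambda>_ _. 0)) ((\<lambda>(r, j, k). spine_elem r j k) ` labels)"

lemma bottom:
  shows bottom_in: "mk (\<lambda>_ _. 0) \<in> carrier L"
    and a_bottom: "in_tri m r j \<Longrightarrow> a (mk (\<lambda>_ _. 0)) r j = 0"
    and left_modular_bottom: "left_modular_element L (mk (\<lambda>_ _. 0))"
proof -
  have v: "valid m (\<lambda>_ _. 0)" by (simp add: valid_def)
  note M = mk[OF v]
  show 1: "mk (\<lambda>_ _. 0) \<in> carrier L" and "in_tri m r j \<Longrightarrow> a (mk (\<lambda>_ _. 0)) r j = 0"
    using M by auto
  show "left_modular_element L (mk (\<lambda>_ _. 0))"
    by (rule left_modularI[OF 1]) (use M in \<open>auto simp: co_def\<close>)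
qed

lemma card_spine: "card spine = Suc (card labels)"
proof -
  have "inj_on (\<lambda>(r, j, k). spine_elem r j k) labels"
  proof (rule inj_onI)
    fix x y assume "x \<in> labels" "y \<in> labels"
      "(case x of (r, j, k) \<Rightarrow> spine_elem r j k) = (case y of (r, j, k) \<Rightarrow> spine_elem r j k)"
    then obtain r j k r' j' k' where xy: "x = (r, j, k)" "y = (r', j', k')"
      and l: "(r, j, k) \<in> labels" and l': "(r', j', k') \<in> labels" and eq: "spine_elem r j k = spine_elem r' j' k'"
      by (cases x, cases y) auto
    have c: "in_tri m r j" "k \<le> cap r j" "1 \<le> k" using l by (auto simp: labels_def)
    have c': "in_tri m r' j'" "k' \<le> cap r' j'" "1 \<le> k'" using l' by (auto simp: labels_def)
    have "spine_array r j k r j = spine_array r' j' k' r j" "spine_array r j k r' j' = spine_array r' j' k' r' j'"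
      using a_spine_elem[OF c(2)] a_spine_elem[OF c'(2)] c(1) c'(1) eq by metis+
    then show "x = y" unfolding xy
      using c(3) c'(3) by (auto simp: spine_array_def split: if_splits)
  qed
  moreover have "mk (\<lambda>_ _. 0) \<notin> (\<lambda>(r, j, k). spine_elem r j k) ` labels"
  proof
    assume "mk (\<lambda>_ _. 0) \<in> (\<lambda>(r, j, k). spine_elem r j k) ` labels"
    then obtain r j k where l: "(r, j, k) \<in> labels" and eq: "mk (\<lambda>_ _. 0) = spine_elem r j k" by auto
    have c: "in_tri m r j" "k \<le> cap r j" "1 \<le> k" using l by (auto simp: labels_def)
    have "spine_array r j k r j = 0" using a_spine_elem[OF c(2,1)] a_bottom[OF c(1)] eq by simp
    then show False using c(3) by (simp add: spine_array_def)
  qed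
  ultimately show ?thesis using finite_labels by (simp add: spine_def card_image)
qed

lemma chain_spine: "pred_on.chain (carrier L) (le L) spine"
proof (rule pred_on.chainI)
  show "spine \<subseteq> carrier L"
    using spine_elem_closed bottom_in by (auto simp: spine_def labels_def)
  have bot: "mk (\<lambda>_ _. 0) \<sqsubseteq> x" if "x \<in> carrier L" for x
    using that bottom_in a_bottom by (simp add: le_iff_a)
  have spine_elem: "spine_elem r j k \<sqsubseteq> spine_elem r' j' k' \<or> spine_elem r' j' k' \<sqsubseteq> spine_elem r j k"
    if "(r, j, k) \<in> labels" "(r', j', k') \<in> labels" for r j k r' j' k'
  proof -
    have k: "k \<le> cap r j" "k' \<le> cap r' j'" using that by (auto simp: labels_def)
    have "(r' < r \<or> r' = r \<and> j' < j \<or> r' = r \<and> j' = j \<and> k \<le> k') \<or>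
      (r < r' \<or> r = r' \<and> j < j' \<or> r = r' \<and> j = j' \<and> k' \<le> k)" by linarith
    then have "(\<forall>s i. spine_array r j k s i \<le> spine_array r' j' k' s i) \<or> (\<forall>s i. spine_array r' j' k' s i \<le> spine_array r j k s i)"
      using spine_array_mono[OF k(1)] spine_array_mono[OF k(2)] by blast
    then show ?thesis
      unfolding le_iff_a[OF spine_elem_closed[OF k(1)] spine_elem_closed[OF k(2)]]
        le_iff_a[OF spine_elem_closed[OF k(2)] spine_elem_closed[OF k(1)]]
      using a_spine_elem[OF k(1)] a_spine_elem[OF k(2)] by auto
  qed
  have cc: "spine_elem r j k \<in> carrier L" if "(r, j, k) \<in> labels" for r j k
    using that spine_elem_closed by (simp add: labels_def)
  have cases: "x = mk (\<lambda>_ _. 0) \<or> (\<exists>r j k. (r, j, k) \<in> labels \<and> x = spine_elem r j k)" if "x \<in> spine" for x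
    using that by (auto simp: spine_def)
  fix x y assume "x \<in> spine" "y \<in> spine"
  then have "x \<sqsubseteq> y \<or> y \<sqsubseteq> x"
    using cases[of x] cases[of y] bot spine_elem cc bottom_in by metis
  then show "(le L)\<^sup>=\<^sup>= x y \<or> (le L)\<^sup>=\<^sup>= y x" by auto
qed

text \<open>The set of labels reached by an element grows strictly along a chain, and its size is
  one of \<open>0\<close>, ..., \<open>card labels\<close>.\<close>

lemma card_chain_le:
  assumes "pred_on.chain (carrier L) (le L) C"
  shows "finite C" "card C \<le> Suc (card labels)"
proof -
  have C: "C \<subseteq> carrier L" "\<And>x y. x \<in> C \<Longrightarrow> y \<in> C \<Longrightarrow> x \<noteq> y \<Longrightarrow> x \<sqsubseteq> y \<or> y \<sqsubseteq> x"
    using assms by (auto simp: pred_on.chain_def)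
  show fin: "finite C" using C(1) finite_carrier by (rule finite_subset)
  define A where "A x = {(r, j, k). (r, j, k) \<in> labels \<and> k \<le> a x r j}" for x
  have fA: "A x \<subseteq> labels" for x by (auto simp: A_def)
  have strict: "card (A x) < card (A y)" if xy: "x \<in> C" "y \<in> C" "x \<sqsubseteq> y" "x \<noteq> y" for x y
  proof (rule psubset_card_mono)
    show "finite (A y)" using finite_subset[OF fA finite_labels] .
    have c: "x \<in> carrier L" "y \<in> carrier L" using xy C by auto
    have "\<not> y \<sqsubseteq> x" using xy c le_antisym by blast
    then obtain r j where t: "in_tri m r j" "\<not> a y r j \<le> a x r j" by (auto simp: le_iff_a c)
    have "(r, j, a y r j) \<in> A y" "(r, j, a y r j) \<notin> A x"
      using t ab_le_cap[OF c(2) t(1)] by (auto simp: A_def labels_def)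
    moreover have "A x \<subseteq> A y"
    proof clarify
      fix r j k assume "(r, j, k) \<in> A x"
      then show "(r, j, k) \<in> A y"
        using a_mono[OF c xy(3), of r j] by (auto simp: A_def labels_def)
    qed
    ultimately show "A x \<subset> A y" by blast
  qed
  have "inj_on (\<lambda>x. card (A x)) C"
    by (rule inj_onI) (metis C(2) strict less_irrefl)
  moreover have "(\<lambda>x. card (A x)) ` C \<subseteq> {..card labels}"
    using card_mono[OF finite_labels fA] by auto
  ultimately show "card C \<le> Suc (card labels)"
    using card_inj_on_le[of "\<lambda>x. card (A x)" C "{..card labels}"] by simp
qed

lemma max_chain_length: "max_chain_length L = card labels"
  unfolding max_chain_length_def
proof (rule Max_eqI)
  let ?X = "{chain_length C |C. pred_on.chain (carrier L) (le L) C}"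
  have le: "n \<le> card labels" if "n \<in> ?X" for n
    using that card_chain_le(2) by (fastforce simp: chain_length_def)
  then show "finite ?X" by (meson finite_nat_set_iff_bounded_le)
  show "n \<in> ?X \<Longrightarrow> n \<le> card labels" for n by (rule le)
  show "card labels \<in> ?X"
    using chain_spine card_spine by (auto simp: chain_length_def intro!: exI[of _ spine])
qed

lemma extremal: "extremal L"
  by (simp add: extremal_def max_chain_length card_join_irreducibles card_meet_irreducibles)

lemma left_modular: "left_modular L"
  unfolding left_modular_def
proof (intro exI[of _ spine] conjI ballI)
  show "pred_on.maxchain (carrier L) (le L) spine"
    unfolding pred_on.maxchain_def
  proof (intro conjI notI chain_spine)
    assume "\<exists>S. pred_on.chain (carrier L) (le L) S \<and> spine \<subset> S"
    then obtain S where S: "pred_on.chain (carrier L) (le L) S" "spine \<subset> S" by blast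
    have "card spine < card S" using S card_chain_le(1) by (intro psubset_card_mono) auto
    then show False using card_chain_le(2)[OF S(1)] card_spine by simp
  qed
  show "x \<in> spine \<Longrightarrow> left_modular_element L x" for x
    using left_modular_spine_elem left_modular_bottom by (auto simp: spine_def labels_def)
qed

lemma trim: "trim L"
  by (simp add: trim_def left_modular extremal)

subsection \<open>Congruence uniformity\<close>

definition near :: "('a \<Rightarrow> nat \<Rightarrow> nat \<Rightarrow> nat) \<Rightarrow> nat \<Rightarrow> nat \<Rightarrow> nat \<Rightarrow> 'a \<Rightarrow> 'a \<Rightarrow> bool" where
  "near f r j k S T \<longleftrightarrow> (\<forall>r' j'. in_tri m r' j' \<longrightarrow> j' - r' < j - r \<longrightarrow> f S r' j' = f T r' j') \<and>
     (k \<le> f S r j \<longleftrightarrow> k \<le> f T r j)"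

definition cong_at :: "nat \<Rightarrow> nat \<Rightarrow> nat \<Rightarrow> ('a \<times> 'a) set" where
  "cong_at r j k = {(S, T) \<in> carrier L \<times> carrier L. near a r j k S T}"

text \<open>Prepares compatibility with joins, which are visible only in \<open>b\<close>. By
  \<open>co\<close>, an entry of \<open>b\<close> depends on entries of \<open>a\<close> in the same
  row, at the cell or closer to the border. Without a shadow \<open>b = cap - a\<close>, so the
  threshold \<open>k\<close> for \<open>a\<close> turns into the negated threshold
  \<open>cap + 1 - k\<close> for \<open>b\<close>.\<close>

lemma near_a_imp_b:
  assumes ST: "S \<in> carrier L" "T \<in> carrier L" and t: "in_tri m r j" and k: "1 \<le> k" "k \<le> cap r j"
    and near: "near a r j k S T"
  shows "near b r j (cap r j + 1 - k) S T"
proof -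
  have agree: "a S r' j' = a T r' j'" if "in_tri m r' j'" "j' - r' < j - r" for r' j'
    using near that by (simp add: near_def)
  have "b S r' j' = b T r' j'" if t': "in_tri m r' j'" and d: "j' - r' < j - r" for r' j'
  proof -
    have "a S r' j'' = a T r' j''" if "j'' \<in> {r'..j'}" for j''
      using that t' d by (intro agree) auto
    then show ?thesis
      unfolding b_eq_co[OF ST(1) t'] b_eq_co[OF ST(2) t'] using t' by (simp add: co_def)
  qed
  moreover have "cap r j + 1 - k \<le> b S r j \<longleftrightarrow> cap r j + 1 - k \<le> b T r j"
  proof -
    have "a S r j'' = a T r j''" if "j'' \<in> {r..<j}" for j''
      using that t by (intro agree) auto
    then have sh: "(\<exists>j'\<in>{r..<j}. a S r j' = cap r j') = (\<exists>j'\<in>{r..<j}. a T r j' = cap r j')" by simp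
    have eq: "cap r j + 1 - k \<le> cap r j - a U r j \<longleftrightarrow> \<not> k \<le> a U r j" if "U \<in> carrier L" for U
      using ab_le_cap[OF that t] k by linarith
    have "k \<le> a S r j \<longleftrightarrow> k \<le> a T r j" using near by (simp add: near_def)
    then show ?thesis
      unfolding b_eq_co[OF ST(1) t] b_eq_co[OF ST(2) t] co_def sh using eq ST k by auto
  qed
  ultimately show ?thesis by (simp add: near_def)
qed

lemma near_b_imp_a:
  assumes ST: "S \<in> carrier L" "T \<in> carrier L" and t: "in_tri m r j" and k: "1 \<le> k" "k \<le> cap r j"
    and near: "near b r j k S T"
  shows "near a r j (cap r j + 1 - k) S T"
proof -
  interpret d: triangle_lattice "inv_gorder L" m "\<lambda>S. transp m (b S)" "\<lambda>S. transp m (a S)"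
    by (rule dual)
  \<comment> \<open>Transposition preserves distances from the border, so it carries one relation
    into the other.\<close>
  have tr: "d.near (\<lambda>S. transp m (f S)) (m + 1 - j) (m + 1 - r) k S T \<longleftrightarrow> near f r j k S T" for f k
  proof -
    have "(\<forall>r' j'. in_tri m r' j' \<longrightarrow> j' - r' < (m + 1 - r) - (m + 1 - j) \<longrightarrow>
         transp m (f S) r' j' = transp m (f T) r' j') \<longleftrightarrow>
      (\<forall>r' j'. in_tri m r' j' \<longrightarrow> j' - r' < j - r \<longrightarrow> f S r' j' = f T r' j')" (is "?l = ?r")
    proof
      assume l: ?l
      show ?r
      proof (intro allI impI)
        fix r' j' assume t': "in_tri m r' j'" and d: "j' - r' < j - r"
        have "(m + 1 - r') - (m + 1 - j') < (m + 1 - r) - (m + 1 - j)" using t t' d by auto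
        from l[rule_format, OF in_tri_transp[OF t'] this]
        show "f S r' j' = f T r' j'"
          using transp_transp[OF t', of "f S"] transp_transp[OF t', of "f T"] by (simp add: transp_def)
      qed
    next
      assume r: ?r
      show ?l
      proof (intro allI impI)
        fix r' j' assume t': "in_tri m r' j'" and d: "j' - r' < (m + 1 - r) - (m + 1 - j)"
        have "(m + 1 - r') - (m + 1 - j') < j - r" using t t' d by auto
        from r[rule_format, OF in_tri_transp[OF t'] this]
        show "transp m (f S) r' j' = transp m (f T) r' j'" by (simp add: transp_def)
      qed
    qed
    moreover have "transp m (f U) (m + 1 - j) (m + 1 - r) = f U r j" for U
      using transp_transp[OF t, of "f U"] by (simp add: transp_def)
    ultimately show ?thesis by (simp add: near_def d.near_def)
  qed
  have t': "in_tri m (m + 1 - j) (m + 1 - r)" by (rule in_tri_transp[OF t])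
  have "d.near (\<lambda>S. transp m (a S)) (m + 1 - j) (m + 1 - r) (cap (m + 1 - j) (m + 1 - r) + 1 - k) S T"
    by (rule d.near_a_imp_b[OF _ _ t']) (use ST k near tr cap_transp[OF t] in auto)
  then show ?thesis unfolding tr cap_transp[OF t] .
qed

lemma congruence_cong_at:
  assumes t: "in_tri m r j" and k: "1 \<le> k" "k \<le> cap r j"
  shows "lattice_congruence L (cong_at r j k)"
proof (rule lattice_congruenceI)
  show "equiv (carrier L) (cong_at r j k)"
  proof (rule equivI)
    show "cong_at r j k \<subseteq> carrier L \<times> carrier L" by (auto simp: cong_at_def)
    show "refl_on (carrier L) (cong_at r j k)" by (auto simp: cong_at_def near_def refl_on_def)
    show "sym (cong_at r j k)" by (rule symI) (simp add: cong_at_def near_def)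
    show "trans (cong_at r j k)" by (rule transI) (simp add: cong_at_def near_def)
  qed
  fix x x' y y' assume xy: "(x, x') \<in> cong_at r j k" "(y, y') \<in> cong_at r j k"
  then have c: "x \<in> carrier L" "x' \<in> carrier L" "y \<in> carrier L" "y' \<in> carrier L"
    and n: "near a r j k x x'" "near a r j k y y'" by (auto simp: cong_at_def)
  have "near a r j k (x \<sqinter> y) (x' \<sqinter> y')"
    using n t c by (simp add: near_def a_meet)
  then show "(x \<sqinter> y, x' \<sqinter> y') \<in> cong_at r j k" using c by (simp add: cong_at_def)
  let ?k = "cap r j + 1 - k"
  have "near b r j ?k x x'" "near b r j ?k y y'"
    using near_a_imp_b[OF _ _ t k] n c by auto
  then have "near b r j ?k (x \<squnion> y) (x' \<squnion> y')"
    using t c by (simp add: near_def b_join)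
  then have "near a r j (cap r j + 1 - ?k) (x \<squnion> y) (x' \<squnion> y')"
    using c k by (intro near_b_imp_a[OF _ _ t]) auto
  moreover have "cap r j + 1 - ?k = k" using k by simp
  ultimately show "(x \<squnion> y, x' \<squnion> y') \<in> cong_at r j k" using c by (simp add: cong_at_def)
qed

text \<open>The second pair differs only at its own cell, which is at least as far from the border,
  and not across the threshold \<open>k\<close> at \<open>(r, j)\<close>. So
  \<open>cong_at r j k\<close> contains the second congruence, but it separates the first
  pair.\<close>

lemma con_ji_elem_distinct:
  assumes l: "(r, j, k) \<in> labels" and l': "(r', j', k') \<in> labels"
    and ne: "(r, j, k) \<noteq> (r', j', k')" and d: "j - r \<le> j' - r'"
  shows "con L (ji_elem r j (k - Suc 0)) (ji_elem r j k) \<noteq> con L (ji_elem r' j' (k' - Suc 0)) (ji_elem r' j' k')"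
proof
  assume eq: "con L (ji_elem r j (k - Suc 0)) (ji_elem r j k) = con L (ji_elem r' j' (k' - Suc 0)) (ji_elem r' j' k')"
  have t: "in_tri m r j" "1 \<le> k" "k \<le> cap r j" "k - Suc 0 \<le> cap r j" using l by (auto simp: labels_def)
  have t': "in_tri m r' j'" "1 \<le> k'" "k' \<le> cap r' j'" "k' - Suc 0 \<le> cap r' j'"
    using l' by (auto simp: labels_def)
  have "near a r j k (ji_elem r' j' (k' - Suc 0)) (ji_elem r' j' k')"
    unfolding near_def
  proof (intro conjI allI impI)
    fix s i assume s: "in_tri m s i" "i - s < j - r"
    then have "\<not> (s = r' \<and> i = j')" using d by auto
    then show "a (ji_elem r' j' (k' - Suc 0)) s i = a (ji_elem r' j' k') s i"
      unfolding a_ji_elem[OF t'(3) s(1)] a_ji_elem[OF t'(4) s(1)] by (auto simp: ji_array_def)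
  next
    show "k \<le> a (ji_elem r' j' (k' - Suc 0)) r j \<longleftrightarrow> k \<le> a (ji_elem r' j' k') r j"
      unfolding a_ji_elem[OF t'(3) t(1)] a_ji_elem[OF t'(4) t(1)] using ne by (auto simp: ji_array_def)
  qed
  then have "(ji_elem r' j' (k' - Suc 0), ji_elem r' j' k') \<in> cong_at r j k"
    using ji_elem_closed t' by (simp add: cong_at_def)
  then have "con L (ji_elem r' j' (k' - Suc 0)) (ji_elem r' j' k') \<subseteq> cong_at r j k"
    using ji_elem_closed t' by (intro con_subset congruence_cong_at t) auto
  moreover have "(ji_elem r j (k - Suc 0), ji_elem r j k) \<in> con L (ji_elem r j (k - Suc 0)) (ji_elem r j k)"
    using ji_elem_closed t by (intro mem_con) auto
  ultimately have "near a r j k (ji_elem r j (k - Suc 0)) (ji_elem r j k)"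
    using eq by (auto simp: cong_at_def)
  then have "k \<le> k - Suc 0"
    using t by (simp add: near_def a_ji_elem[OF t(3,1)] a_ji_elem[OF t(4,1)] ji_array_def)
  then show False using t by simp
qed

lemma congruence_uniform: "congruence_uniform L"
proof (rule congruence_uniformI)
  show "card (join_irreducibles L) = card (meet_irreducibles L)"
    by (simp add: card_join_irreducibles card_meet_irreducibles)
  show "inj_on (\<lambda>j. con L (lower_cover L j) j) (join_irreducibles L)"
  proof (rule inj_onI)
    fix x y assume x: "x \<in> join_irreducibles L" and y: "y \<in> join_irreducibles L"
      and eq: "con L (lower_cover L x) x = con L (lower_cover L y) y"
    obtain r j k where l: "(r, j, k) \<in> labels" "x = ji_elem r j k" by (rule join_irreducible_cases[OF x])
    obtain r' j' k' where l': "(r', j', k') \<in> labels" "y = ji_elem r' j' k'" by (rule join_irreducible_cases[OF y])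
    have "con L (ji_elem r j (k - Suc 0)) (ji_elem r j k) = con L (ji_elem r' j' (k' - Suc 0)) (ji_elem r' j' k')"
      using eq ji_elem_irreducible(2)[OF l(1)] ji_elem_irreducible(2)[OF l'(1)] l l' by simp
    then have "(r, j, k) = (r', j', k')"
      using con_ji_elem_distinct[OF l(1) l'(1)] con_ji_elem_distinct[OF l'(1) l(1)] by (metis linear)
    then show "x = y" using l l' by simp
  qed
qed

subsection \<open>Polygons\<close>

text \<open>
  The upper covers of \<open>x\<close> arise by raising the state of one cell \<open>(r, j)\<close> by one. Raising it to
  \<open>cap r j\<close> shadows the rest of the row, which gives a cover only if every cell that gets newly
  shadowed was already shadowed from within its column.
\<close>

definition move :: "'a \<Rightarrow> 'a \<Rightarrow> nat \<Rightarrow> nat \<Rightarrow> bool" where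
  "move x y r j \<longleftrightarrow> in_tri m r j \<and> 0 < b x r j \<and> a x r j + b x r j = cap r j \<and>
     (r < j \<longrightarrow> 0 < a x (Suc r) j) \<and>
     (b x r j = 1 \<longrightarrow> (\<forall>j'. j < j' \<longrightarrow> j' \<le> m \<longrightarrow> 0 < b x r j' \<longrightarrow> a x (Suc r) j' = 0)) \<and>
     y = x \<squnion> ji_elem r j (Suc (a x r j))"

text \<open>The entry formula for \<open>b y\<close> holds because the join-irreducible lowers
  nothing else: below \<open>(r, j)\<close> in the column its \<open>b\<close> is
  \<open>cap - 1\<close>, and there \<open>a x\<close> is positive, so \<open>b x\<close> is no
  larger. Shadowing the row happens exactly when the step reaches \<open>cap\<close>.\<close>

lemma moveD:
  assumes "x \<in> carrier L" "move x y r j"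
  shows "in_tri m r j" "0 < b x r j" "a x r j + b x r j = cap r j"
    and "r < j \<Longrightarrow> 0 < a x (Suc r) j"
    and "b x r j = 1 \<Longrightarrow> j < j' \<Longrightarrow> j' \<le> m \<Longrightarrow> 0 < b x r j' \<Longrightarrow> a x (Suc r) j' = 0"
    and "y \<in> carrier L" "x \<sqsubseteq> y" "x \<noteq> y"
    and "z \<in> carrier L \<Longrightarrow> x \<sqsubseteq> z \<Longrightarrow> y \<sqsubseteq> z \<longleftrightarrow> a x r j < a z r j"
    and "a x r j < a y r j"
    and "in_tri m r' j' \<Longrightarrow> b y r' j' =
      (if r' = r \<and> j' = j then b x r j - 1 else if r' = r \<and> j < j' \<and> b x r j = 1 then 0 else b x r' j')"
proof -
  show t: "in_tri m r j" and pos: "0 < b x r j" and sum: "a x r j + b x r j = cap r j"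
    and cf: "r < j \<Longrightarrow> 0 < a x (Suc r) j"
    and "b x r j = 1 \<Longrightarrow> j < j' \<Longrightarrow> j' \<le> m \<Longrightarrow> 0 < b x r j' \<Longrightarrow> a x (Suc r) j' = 0"
    using assms(2) unfolding move_def by blast+
  let ?k = "Suc (a x r j)"
  have y: "y = x \<squnion> ji_elem r j ?k" using assms(2) unfolding move_def by blast
  have k: "1 \<le> ?k" "?k \<le> cap r j" using pos sum by auto
  have jc: "ji_elem r j ?k \<in> carrier L" by (rule ji_elem_closed[OF k(2)])
  show yc: "y \<in> carrier L" and xy: "x \<sqsubseteq> y" using assms(1) jc y join_left by auto
  show iff: "y \<sqsubseteq> z \<longleftrightarrow> a x r j < a z r j" if z: "z \<in> carrier L" "x \<sqsubseteq> z" for z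
  proof -
    have "y \<sqsubseteq> z \<longleftrightarrow> ji_elem r j ?k \<sqsubseteq> z"
      using z assms(1) jc y join_le join_right le_trans[of "ji_elem r j ?k" y z] by auto
    then show ?thesis using ji_elem_le_iff[OF z(1) t k] by auto
  qed
  show ay: "a x r j < a y r j" using iff[OF yc xy] yc by simp
  then show "x \<noteq> y" by auto
  show "b y r' j' =
      (if r' = r \<and> j' = j then b x r j - 1 else if r' = r \<and> j < j' \<and> b x r j = 1 then 0 else b x r' j')"
    if t': "in_tri m r' j'"
  proof -
    have "b y r' j' = min (b x r' j') (b (ji_elem r j ?k) r' j')"
      unfolding y by (rule b_join[OF assms(1) jc t'])
    moreover have "b (ji_elem r j ?k) r' j' =
      (if r' = r \<and> j < j' \<and> ?k = cap r j then 0 else cap r' j' - ji_array r j ?k r' j')"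
      using b_ji_elem[OF k(2) _ t'] t by simp
    moreover have "?k = cap r j \<longleftrightarrow> b x r j = 1" using sum by auto
    moreover have "b x r' j' \<le> cap r' j' - 1" if "j' = j" "r < r'"
    proof -
      have "r < j" using that t' by auto
      then have "0 < a x r' j" using cf a_column_pos[OF assms(1), of "Suc r" r' j] that t t' by auto
      then show ?thesis using ab_le_cap[OF assms(1) t'] that by auto
    qed
    moreover have "b x r' j' \<le> cap r' j'" using ab_le_cap[OF assms(1) t'] by simp
    moreover have "cap r j - ?k = b x r j - 1" using sum by auto
    ultimately show ?thesis by (auto simp: ji_array_def min_def split: if_splits)
  qed
qed

lemma cover_move:
  assumes "covers L y x"
  obtains r j where "move x y r j"
proof -
  have c: "x \<in> carrier L" "y \<in> carrier L" "x \<sqsubseteq> y" "x \<noteq> y"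
    and cov: "\<And>z. z \<in> carrier L \<Longrightarrow> x \<sqsubseteq> z \<Longrightarrow> z \<sqsubseteq> y \<Longrightarrow> z = x \<or> z = y"
    using assms by (auto simp: covers_iff)
  have y_eq: "y = x \<squnion> ji_elem r j k"
    if "in_tri m r j" "cap r j < k + b x r j" "k \<le> a y r j" for r j k
  proof -
    have k: "1 \<le> k" "k \<le> cap r j"
      using that ab_le_cap[OF c(1) that(1)] ab_le_cap[OF c(2) that(1)] by auto
    note jc = ji_elem_closed[OF k(2)]
    have "ji_elem r j k \<sqsubseteq> y" using ji_elem_le_iff[OF c(2) that(1) k] that(3) by simp
    then have "x \<squnion> ji_elem r j k \<sqsubseteq> y" using c jc by (intro join_le) auto
    moreover have "\<not> ji_elem r j k \<sqsubseteq> x"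
      using ji_elem_le_iff[OF c(1) that(1) k] ab_le_cap[OF c(1) that(1)] that(2) by simp
    then have "x \<squnion> ji_elem r j k \<noteq> x" using join_right[OF c(1) jc] by auto
    ultimately show ?thesis using cov[of "x \<squnion> ji_elem r j k"] join_left[OF c(1) jc] c jc by auto
  qed
  text \<open>All labels by which \<open>y\<close> exceeds \<open>x\<close> generate \<open>y\<close> over \<open>x\<close>, so none is redundant.\<close>
  have key: "b (ji_elem r' j' k) r j < b x r j"
    if "in_tri m r' j'" "cap r' j' < k + b x r' j'" "k \<le> a y r' j'"
      and t: "in_tri m r j" and gt: "cap r j < a y r j + b x r j" for r j r' j' k
  proof -
    have k: "k \<le> cap r' j'" using that ab_le_cap[OF c(2) that(1)] by auto
    have "b y r j = min (b x r j) (b (ji_elem r' j' k) r j)"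
      using y_eq[OF that(1-3)] b_join[OF c(1) ji_elem_closed[OF k] t] by simp
    moreover have "a y r j + b y r j \<le> cap r j" by (rule ab_le_cap[OF c(2) t])
    ultimately show ?thesis using gt by (auto simp: min_def split: if_splits)
  qed
  have "\<not> y \<sqsubseteq> x" using c le_antisym by blast
  then obtain r j where t: "in_tri m r j" and gt: "cap r j < a y r j + b x r j"
    unfolding le_iff[OF c(2,1)] by force
  have pos: "0 < b x r j" using gt ab_le_cap[OF c(2) t] by simp
  have rf: "r < j \<longrightarrow> 0 < b x r (j - 1)" using shapeD(3)[OF shape[OF c(1)] t] pos by auto
  \<comment> \<open>Otherwise some cell \<open>s\<close> below in the column has full
    \<open>b\<close>. Its first step would already generate \<open>y\<close> over \<open>x\<close>,
    yet that join-irreducible leaves \<open>b\<close> full at \<open>(r, j)\<close>.\<close>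
  have cf: "0 < a x (Suc r) j" if rj: "r < j"
  proof (rule ccontr)
    assume no: "\<not> 0 < a x (Suc r) j"
    have "in_tri m (Suc r) j" using t rj by simp
    from no[unfolded shape_column_pos_iff[OF shape[OF c(1)] this]]
    obtain s where s: "s \<in> {Suc r..j}" "\<not> b x s j < cap s j" by blast
    have ts: "in_tri m s j" using s t by auto
    have bs: "b x s j = cap s j" using s(2) ab_le_cap[OF c(1) ts] by simp
    have "0 < a y r j" using gt ab_le_cap[OF c(1) t] by simp
    then have "1 \<le> a y s j" using a_column_pos[OF c(2), of r s j] s t by auto
    from key[OF ts _ this t gt] have "b (ji_elem s j 1) r j < b x r j" using bs by simp
    moreover have "b (ji_elem s j 1) r j = cap r j"
      using b_ji_elem[of 1 s j r j] s t by (simp add: ji_array_def)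
    ultimately show False using ab_le_cap[OF c(1) t] by simp
  qed
  have sum: "a x r j + b x r j = cap r j"
    using shape_cell[OF shape[OF c(1)] t] rf cf by (auto split: if_splits)
  \<comment> \<open>Otherwise filling \<open>(r, j)\<close> forces \<open>(r, j')\<close> to be full
    in \<open>y\<close>. The last step of \<open>(r, j')\<close> would then generate
    \<open>y\<close>, although it does not affect \<open>(r, j)\<close>.\<close>
  have block: "a x (Suc r) j' = 0"
    if b1: "b x r j = 1" and j': "j < j'" "j' \<le> m" "0 < b x r j'" for j'
  proof (rule ccontr)
    assume "a x (Suc r) j' \<noteq> 0"
    have t': "in_tri m r j'" "in_tri m (Suc r) j'" using t j' by auto
    have "0 < a y (Suc r) j'" using a_mono[OF c(1-3) t'(2)] \<open>a x (Suc r) j' \<noteq> 0\<close> by simp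
    moreover have "a y r j = cap r j" using gt b1 ab_le_cap[OF c(2) t] by simp
    ultimately have "a y r j' = cap r j'"
      using validD(3)[OF valid_a[OF c(2)] t'(1), of j] t j' by auto
    then have "b (ji_elem r j' (cap r j')) r j < b x r j"
      using j' by (intro key[OF t'(1) _ _ t gt]) auto
    moreover have "b (ji_elem r j' (cap r j')) r j = cap r j"
      using b_ji_elem[of "cap r j'" r j' r j] t t' j' by (simp add: ji_array_def)
    ultimately show False using ab_le_cap[OF c(1) t] by simp
  qed
  have "y = x \<squnion> ji_elem r j (Suc (a x r j))"
    using sum gt by (intro y_eq t) auto
  then have "move x y r j" unfolding move_def using t pos sum cf block by blast
  then show thesis by (rule that)
qed

text \<open>At the remaining cells \<open>a z + b z' \<le> a t + b x \<le> cap\<close> holds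
  automatically.\<close>

lemma interval_le:
  assumes "x \<in> carrier L" "t \<in> carrier L" "z \<in> carrier L" "z' \<in> carrier L" "z \<sqsubseteq> t" "x \<sqsubseteq> z'"
    and *: "\<And>r j. in_tri m r j \<Longrightarrow> cap r j < a t r j + b x r j \<Longrightarrow> a z r j \<le> a z' r j"
  shows "z \<sqsubseteq> z'"
  unfolding le_iff[OF assms(3,4)]
proof (intro allI impI)
  fix r j assume c: "in_tri m r j"
  show "a z r j + b z' r j \<le> cap r j"
    using *[OF c] a_mono[OF assms(3,2,5) c] b_antimono[OF assms(1,4,6) c] ab_le_cap[OF assms(4) c]
    by linarith
qed

text \<open>The cell \<open>(r1, j2)\<close> lies left of the first moved cell and above the second.
  The first move completes its cell and so shadows the row; the second starts from state 0 and so
  opens the column. The last condition says that the column is then open up to the corner.\<close>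

definition corner :: "'a \<Rightarrow> 'a \<Rightarrow> nat \<Rightarrow> nat \<Rightarrow> nat \<Rightarrow> nat \<Rightarrow> bool" where
  "corner x t r1 j1 r2 j2 \<longleftrightarrow> j1 < j2 \<and> r1 < r2 \<and> b x r1 j1 = 1 \<and> b x r2 j2 = cap r2 j2 \<and>
     b x r1 j2 = cap r1 j2 \<and> 0 < a t r1 j2"

context
  fixes x y1 y2 r1 j1 r2 j2
  assumes x: "x \<in> carrier L" and y1: "move x y1 r1 j1" and y2: "move x y2 r2 j2" and ne: "y1 \<noteq> y2"
begin

lemma moves_distinct: "(r1, j1) \<noteq> (r2, j2)"
  using y1 y2 ne by (auto simp: move_def)

text \<open>Besides its own cell, \<open>y1\<close> can lower \<open>b\<close> only in the row it
  shadows, at cells that are shadowed in their columns for \<open>x\<close>. Such a cell can become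
  positive in the join only if \<open>y2\<close> opens its column.\<close>

lemma critical_corner:
  assumes t: "in_tri m r j" and crit: "cap r j < a (y1 \<squnion> y2) r j + b x r j"
    and "b y1 r j < b x r j" "(r, j) \<noteq> (r1, j1)"
  shows "r = r1 \<and> j = j2 \<and> corner x (y1 \<squnion> y2) r1 j1 r2 j2"
proof -
  note M1 = moveD[OF x y1] and M2 = moveD[OF x y2]
  let ?t = "y1 \<squnion> y2"
  have tc: "?t \<in> carrier L" using M1(6) M2(6) by simp
  have r: "r = r1" "j1 < j" "b x r1 j1 = 1"
    using M1(11)[OF t] assms(3,4) by (auto split: if_splits)
  have rj: "r < j" using r M1(1) by auto
  have pos: "0 < b x r j" using assms(3) by simp
  have noarr: "a x (Suc r) j = 0" using M1(5)[of j] r t pos by auto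
  have at: "0 < a ?t r j" using crit ab_le_cap[OF x t] by simp
  have rf: "r < j \<longrightarrow> 0 < b x r (j - 1)" using shapeD(3)[OF shape[OF x] t] pos by auto
  then have be: "b x r j = cap r j" using shapeD(5)[OF shape[OF x] t rj noarr] by auto
  let ?A = "{s \<in> {Suc r..j}. b x s j = cap s j}"
  have "in_tri m (Suc r) j" using t rj by simp
  from shape_column_pos_iff[OF shape[OF x] this] noarr
  obtain s0 where s0: "s0 \<in> {Suc r..j}" "\<not> b x s0 j < cap s0 j" by auto
  moreover have "b x s0 j \<le> cap s0 j" using ab_le_cap[OF x, of s0 j] s0(1) t by auto
  ultimately have "?A \<noteq> {}" by auto
  moreover define s where "s = Max ?A"
  ultimately have "s \<in> ?A" using Max_in[of ?A] by simp
  then have s: "s \<in> {Suc r..j}" "b x s j = cap s j" by auto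
  have smax: "s' \<le> s" if "s' \<in> {Suc r..j}" "b x s' j = cap s' j" for s'
    using Max_ge[of ?A s'] that by (simp add: s_def)
  have ts: "in_tri m s j" using s t by auto
  have cfs: "0 < a x (Suc s) j" if "s < j"
  proof -
    have ts': "in_tri m (Suc s) j" using ts that by auto
    have "b x s' j < cap s' j" if "s' \<in> {Suc s..j}" for s'
    proof -
      have "b x s' j \<le> cap s' j" using ab_le_cap[OF x, of s' j] that ts by auto
      moreover have "b x s' j \<noteq> cap s' j" using smax[of s'] that s by auto
      ultimately show ?thesis by simp
    qed
    then show ?thesis using shape_column_pos_iff[OF shape[OF x] ts'] by blast
  qed
  have "b ?t s j < cap s j"
    using shape_column_pos_iff[OF shape[OF tc] t] at s by auto
  then have "b y1 s j < b x s j \<or> b y2 s j < b x s j"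
    using b_join[OF M1(6) M2(6) ts] s by (auto simp: min_def split: if_splits)
  moreover have "\<not> b y1 s j < b x s j"
    using M1(11)[OF ts] r s by auto
  ultimately have b2: "b y2 s j < b x s j" by blast
  have "s = r2 \<and> j = j2"
  proof (rule ccontr)
    assume "\<not> (s = r2 \<and> j = j2)"
    then have "s = r2" "j2 < j" "b x r2 j2 = 1"
      using M2(11)[OF ts] b2 by (auto split: if_splits)
    moreover have "s < j" using calculation M2(1) by auto
    ultimately show False using M2(5)[of j] cfs ts s by auto
  qed
  then show ?thesis
    using r s be at by (auto simp: corner_def)
qed

text \<open>A move that shadows its row reaches only cells already shadowed in their columns, and
  \<open>(r1, j1)\<close> is open in its column.\<close>

lemma b_other: "b y2 r1 j1 = b x r1 j1"
proof (rule ccontr)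
  note M1 = moveD[OF x y1] and M2 = moveD[OF x y2]
  assume "b y2 r1 j1 \<noteq> b x r1 j1"
  then have r: "r1 = r2" "j2 < j1" "b x r2 j2 = 1"
    using M2(11)[OF M1(1)] moves_distinct by (auto split: if_splits)
  then have "a x (Suc r1) j1 = 0" using M2(5)[of j1] M1(1,2) by auto
  moreover have "r1 < j1" using r M2(1) by auto
  ultimately show False using M1(4) by simp
qed

lemma a_top_le: "a (y1 \<squnion> y2) r1 j1 \<le> Suc (a x r1 j1)"
proof -
  note M1 = moveD[OF x y1] and M2 = moveD[OF x y2]
  have "b (y1 \<squnion> y2) r1 j1 = b x r1 j1 - 1"
    using b_join[OF M1(6) M2(6) M1(1)] b_other M1(11)[OF M1(1)] by simp
  moreover have "a (y1 \<squnion> y2) r1 j1 + b (y1 \<squnion> y2) r1 j1 \<le> cap r1 j1"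
    using M1(1,6) M2(6) by (intro ab_le_cap) auto
  ultimately show ?thesis using M1(2,3) by linarith
qed

lemma moves_incomparable: "\<not> y1 \<sqsubseteq> y2"
proof
  note M1 = moveD[OF x y1] and M2 = moveD[OF x y2]
  assume "y1 \<sqsubseteq> y2"
  then have "b y2 r1 j1 \<le> b y1 r1 j1" using b_antimono M1(1,6) M2(6) by blast
  then show False using b_other M1(2) M1(11)[OF M1(1)] by simp
qed

end

lemma critical_cases:
  assumes x: "x \<in> carrier L" and y1: "move x y1 r1 j1" and y2: "move x y2 r2 j2" and ne: "y1 \<noteq> y2"
    and t: "in_tri m r j" and crit: "cap r j < a (y1 \<squnion> y2) r j + b x r j"
  obtains "r = r1" "j = j1" | "r = r2" "j = j2"
    | "r = r1" "j = j2" "corner x (y1 \<squnion> y2) r1 j1 r2 j2"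
    | "r = r2" "j = j1" "corner x (y1 \<squnion> y2) r2 j2 r1 j1"
proof -
  note M1 = moveD[OF x y1] and M2 = moveD[OF x y2]
  have tc: "y1 \<squnion> y2 \<in> carrier L" using M1(6) M2(6) by simp
  have comm: "y2 \<squnion> y1 = y1 \<squnion> y2" by (rule join_comm)
  have "b (y1 \<squnion> y2) r j < b x r j" using ab_le_cap[OF tc t] crit by simp
  then have "b y1 r j < b x r j \<or> b y2 r j < b x r j"
    using b_join[OF M1(6) M2(6) t] by (auto simp: min_def split: if_splits)
  then show thesis
    using critical_corner[OF x y1 y2 ne t crit]
      critical_corner[OF x y2 y1 ne[symmetric] t, unfolded comm, OF crit] that by blast
qed

text \<open>If \<open>y1\<close> comes first, the corner is shadowed from both sides until
  \<open>y2\<close> makes it full at once. If \<open>y2\<close> comes first, the corner is open in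
  its column and passes through all its states before \<open>y1\<close>.\<close>

lemma heptagonI:
  assumes x: "x \<in> carrier L" and y1: "move x y1 r1 j1" and y2: "move x y2 r2 j2" and ne: "y1 \<noteq> y2"
    and corner: "corner x (y1 \<squnion> y2) r1 j1 r2 j2"
  shows "heptagon L x (y1 \<squnion> y2)"
proof -
  note M1 = moveD[OF x y1] and M2 = moveD[OF x y2]
  let ?t = "y1 \<squnion> y2"
  have tc: "?t \<in> carrier L" and yt: "y1 \<sqsubseteq> ?t" "y2 \<sqsubseteq> ?t"
    using M1(6) M2(6) join_left join_right by auto
  have xt: "x \<sqsubseteq> ?t" using le_trans[OF M1(7) yt(1)] x M1(6) tc by blast
  have cor: "j1 < j2" "r1 < r2" "b x r1 j1 = 1" "b x r2 j2 = cap r2 j2" "b x r1 j2 = cap r1 j2" "0 < a ?t r1 j2"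
    using corner by (auto simp: corner_def)
  have te: "in_tri m r1 j2" and re: "r1 < j2" using M1(1) M2(1) cor by auto
  have ax2: "a x r2 j2 = 0" using M2(3) cor by simp
  have at1: "a ?t r1 j1 \<le> Suc (a x r1 j1)" by (rule a_top_le[OF x y1 y2 ne])
  have at2: "a ?t r2 j2 \<le> Suc (a x r2 j2)"
    using a_top_le[OF x y2 y1 ne[symmetric]] by (simp add: join_comm)
  \<comment> \<open>In the join the cell \<open>(r1, j1)\<close> is full and the column of the
    corner is open, so the row shadow forces the corner to be full.\<close>
  have ate: "a ?t r1 j2 = cap r1 j2"
  proof -
    have "a y1 r1 j1 = cap r1 j1" using M1(3,10) cor ab_le_cap[OF M1(6,1)] by simp
    then have "a ?t r1 j1 = cap r1 j1"
      using a_mono[OF M1(6) tc yt(1) M1(1)] ab_le_cap[OF tc M1(1)] by simp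
    moreover have "0 < a ?t (Suc r1) j2"
      using cor(6) a_column_pos[OF tc, of r1 "Suc r1" j2] te re by auto
    ultimately show ?thesis using validD(3)[OF valid_a[OF tc] te, of j1] M1(1) cor by auto
  qed
  have crit: "r = r1 \<and> j = j1 \<or> r = r2 \<and> j = j2 \<or> r = r1 \<and> j = j2"
    if "in_tri m r j" "cap r j < a ?t r j + b x r j" for r j
    by (rule critical_cases[OF x y1 y2 ne that]) (use cor in \<open>auto simp: corner_def\<close>)
  \<comment> \<open>The index is the state of the corner. State 0 is \<open>y2\<close> itself and is
    listed apart because \<open>ji_elem_le_iff\<close> concerns positive states.\<close>
  define z where "z k = (if k = 0 then y2 else x \<squnion> ji_elem r1 j2 k)" for k
  have z: "z k \<in> carrier L \<and> x \<sqsubseteq> z k \<and> z k \<sqsubseteq> ?t \<and> y2 \<sqsubseteq> z k \<and> \<not> y1 \<sqsubseteq> z k \<and> a (z k) r1 j2 = k"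
    if k: "k \<le> cap r1 j2" for k
  proof (cases "k = 0")
    case True
    have "b y2 r1 j2 = cap r1 j2" using M2(11)[OF te] cor by auto
    then have "a y2 r1 j2 = 0" using ab_le_cap[OF M2(6) te] by simp
    then show ?thesis
      using True M2(6,7) yt moves_incomparable[OF x y1 y2 ne] by (simp add: z_def)
  next
    case False
    let ?w = "x \<squnion> ji_elem r1 j2 k"
    have jc: "ji_elem r1 j2 k \<in> carrier L" by (rule ji_elem_closed[OF k])
    have wc: "?w \<in> carrier L" and xw: "x \<sqsubseteq> ?w" and jw: "ji_elem r1 j2 k \<sqsubseteq> ?w"
      using x jc join_left join_right by auto
    have "ji_elem r1 j2 k \<sqsubseteq> ?t" using ji_elem_le_iff[OF tc te _ k] False ate k by simp
    then have wt: "?w \<sqsubseteq> ?t" using join_le[OF xt] x jc tc by simp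
    have kw: "k \<le> a ?w r1 j2" using ji_elem_le_iff[OF wc te _ k] False jw by simp
    have "b ?w r1 j2 = cap r1 j2 - k"
      using b_join[OF x jc te] b_ji_elem[OF k _ te] re cor by (simp add: ji_array_def)
    then have ae: "a ?w r1 j2 = k" using kw ab_le_cap[OF wc te] k by simp
    have "0 < a ?w r2 j2"
      using a_column_pos[OF wc, of r1 r2 j2] te M2(1) cor kw False by auto
    then have "y2 \<sqsubseteq> ?w" using M2(9)[OF wc xw] ax2 by simp
    moreover have "b (ji_elem r1 j2 k) r1 j1 = cap r1 j1"
      using b_ji_elem[OF k _ M1(1)] re cor by (simp add: ji_array_def)
    then have "b ?w r1 j1 = 1" using b_join[OF x jc M1(1)] cor by simp
    then have "\<not> a x r1 j1 < a ?w r1 j1" using ab_le_cap[OF wc M1(1)] M1(3) cor by simp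
    then have "\<not> y1 \<sqsubseteq> ?w" using M1(9)[OF wc xw] by simp
    ultimately show ?thesis using False wc xw wt ae by (simp add: z_def)
  qed
  \<comment> \<open>Among the elements above \<open>y2\<close> and not above \<open>y1\<close>, the
    entries at both moved cells are fixed, so the state of the corner alone decides.\<close>
  have side: "w \<sqsubseteq> w'"
    if w: "w \<in> carrier L" "x \<sqsubseteq> w" "w \<sqsubseteq> ?t" "\<not> y1 \<sqsubseteq> w"
      and w': "w' \<in> carrier L" "x \<sqsubseteq> w'" "y2 \<sqsubseteq> w'" and e: "a w r1 j2 \<le> a w' r1 j2" for w w'
  proof (rule interval_le[OF x tc w(1) w'(1) w(3) w'(2)])
    fix r j assume "in_tri m r j" "cap r j < a ?t r j + b x r j"
    then have "r = r1 \<and> j = j1 \<or> r = r2 \<and> j = j2 \<or> r = r1 \<and> j = j2" by (rule crit)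
    moreover have "a w r1 j1 \<le> a w' r1 j1"
      using M1(9)[OF w(1,2)] w(4) a_mono[OF x w'(1,2) M1(1)] by simp
    moreover have "a w r2 j2 \<le> a w' r2 j2"
      using a_mono[OF w(1) tc w(3) M2(1)] at2 M2(9)[OF w'(1,2)] w'(3) by simp
    ultimately show "a w r j \<le> a w' r j" using e by auto
  qed
  \<comment> \<open>Without \<open>y2\<close> the entry at \<open>(r2, j2)\<close> is 0, which keeps
    the corner above it at 0.\<close>
  have low: "w = x \<or> w = y1" if w: "w \<in> carrier L" "x \<sqsubseteq> w" "w \<sqsubseteq> ?t" "\<not> y2 \<sqsubseteq> w" for w
  proof -
    have w2: "a w r2 j2 = 0" using M2(9)[OF w(1,2)] w(4) ax2 by simp
    then have we: "a w r1 j2 = 0"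
      using a_column_pos[OF w(1), of r1 r2 j2] te M2(1) cor by auto
    show ?thesis
    proof (cases "y1 \<sqsubseteq> w")
      case True
      have "w \<sqsubseteq> y1"
      proof (rule interval_le[OF x tc w(1) M1(6) w(3) M1(7)])
        fix r j assume "in_tri m r j" "cap r j < a ?t r j + b x r j"
        then have "r = r1 \<and> j = j1 \<or> r = r2 \<and> j = j2 \<or> r = r1 \<and> j = j2" by (rule crit)
        moreover have "a w r1 j1 \<le> a y1 r1 j1"
          using a_mono[OF w(1) tc w(3) M1(1)] at1 M1(10) by simp
        ultimately show "a w r j \<le> a y1 r j" using w2 we by auto
      qed
      then show ?thesis using True le_antisym w(1) M1(6) by blast
    next
      case False
      have "w \<sqsubseteq> x"
      proof (rule interval_le[OF x tc w(1) x w(3)])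
        fix r j assume "in_tri m r j" "cap r j < a ?t r j + b x r j"
        then have "r = r1 \<and> j = j1 \<or> r = r2 \<and> j = j2 \<or> r = r1 \<and> j = j2" by (rule crit)
        moreover have "a w r1 j1 \<le> a x r1 j1" using M1(9)[OF w(1,2)] False by simp
        ultimately show "a w r j \<le> a x r j" using w2 we by auto
      qed (use x in auto)
      then show ?thesis using w le_antisym x by blast
    qed
  qed
  have "\<exists>C D. polygon_sides L x ?t C D \<and> chain_length C = 2 \<and> chain_length D = cap r1 j2 + 2"
  proof (rule polygon_sidesI[where u = y1 and z = z and l = "cap r1 j2"])
    show "x \<in> carrier L" "?t \<in> carrier L" "y1 \<in> carrier L" by (rule x tc M1(6))+
    show "x \<sqsubseteq> y1" "y1 \<sqsubseteq> ?t" "y1 \<noteq> x" using M1(7,8) yt by auto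
    show "y1 \<noteq> ?t" using yt moves_incomparable[OF x y2 y1 ne[symmetric]] by auto
    show "inj_on z {..cap r1 j2}" using z by (metis atMost_iff inj_onI)
    fix i assume i: "i \<le> cap r1 j2"
    note zi = z[OF i]
    show "z i \<in> carrier L" "x \<sqsubseteq> z i" "z i \<sqsubseteq> ?t" "\<not> y1 \<sqsubseteq> z i" using zi by auto
    show "z i \<noteq> x" using zi M2(6,7,8) x le_antisym by auto
    show "z i \<noteq> ?t" using zi yt by auto
    show "\<not> z i \<sqsubseteq> y1"
      using zi moves_incomparable[OF x y2 y1 ne[symmetric]] le_trans[of y2 "z i" y1] M1(6) M2(6) by auto
  next
    fix i i' assume i: "i \<le> i'" "i' \<le> cap r1 j2"
    then have i0: "i \<le> cap r1 j2" by simp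
    note zi = z[OF i0] and zi' = z[OF i(2)]
    have "a (z i) r1 j2 \<le> a (z i') r1 j2" using zi zi' i(1) by metis
    then show "z i \<sqsubseteq> z i'" using zi zi' side[of "z i" "z i'"] by iprover
  next
    fix w assume w: "w \<in> carrier L" "x \<sqsubseteq> w" "w \<sqsubseteq> ?t"
    show "w = x \<or> w = y1 \<or> w = ?t \<or> (\<exists>i\<le>cap r1 j2. w = z i)"
    proof (cases "y2 \<sqsubseteq> w")
      case False
      then show ?thesis using low[OF w] by auto
    next
      case y2w: True
      show ?thesis
      proof (cases "y1 \<sqsubseteq> w")
        case True
        then have "?t \<sqsubseteq> w" using join_le[OF True y2w M1(6) M2(6) w(1)] by simp
        then have "w = ?t" using le_antisym[OF w(3)] w(1) tc by simp
        then show ?thesis by simp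
      next
        case False
        let ?i = "a w r1 j2"
        have i: "?i \<le> cap r1 j2" using ab_le_cap[OF w(1) te] by simp
        note zi = z[OF i]
        then have e: "a (z ?i) r1 j2 = ?i" by iprover
        have "w \<sqsubseteq> z ?i" using side[of w "z ?i"] zi w False e by simp
        moreover have "z ?i \<sqsubseteq> w" using side[of "z ?i" w] zi w y2w e by simp
        ultimately have "w = z ?i" using le_antisym zi w(1) by iprover
        then show ?thesis using i by (intro disjI2 exI[of _ ?i] conjI)
      qed
    qed
  qed
  moreover have "cap r1 j2 = 3" using re by (simp add: cap_def)
  ultimately show ?thesis by (auto simp: heptagon_def)
qed

text \<open>Only the two moved cells are critical, each with two possible entries in the interval.
  An element is thus determined by which of \<open>y1\<close>, \<open>y2\<close> lie below
  it.\<close>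

lemma quadrilateralI:
  assumes x: "x \<in> carrier L" and y1: "move x y1 r1 j1" and y2: "move x y2 r2 j2" and ne: "y1 \<noteq> y2"
    and "\<not> corner x (y1 \<squnion> y2) r1 j1 r2 j2" "\<not> corner x (y1 \<squnion> y2) r2 j2 r1 j1"
  shows "quadrilateral L x (y1 \<squnion> y2)"
proof -
  note M1 = moveD[OF x y1] and M2 = moveD[OF x y2]
  let ?t = "y1 \<squnion> y2"
  have tc: "?t \<in> carrier L" and yt: "y1 \<sqsubseteq> ?t" "y2 \<sqsubseteq> ?t"
    using M1(6) M2(6) join_left join_right by auto
  have at1: "a ?t r1 j1 \<le> Suc (a x r1 j1)" by (rule a_top_le[OF x y1 y2 ne])
  have at2: "a ?t r2 j2 \<le> Suc (a x r2 j2)"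
    using a_top_le[OF x y2 y1 ne[symmetric]] by (simp add: join_comm)
  have crit: "r = r1 \<and> j = j1 \<or> r = r2 \<and> j = j2"
    if "in_tri m r j" "cap r j < a ?t r j + b x r j" for r j
    by (rule critical_cases[OF x y1 y2 ne that]) (use assms(5,6) in auto)
  have side: "w \<sqsubseteq> w'"
    if w: "w \<in> carrier L" "x \<sqsubseteq> w" "w \<sqsubseteq> ?t" and w': "w' \<in> carrier L" "x \<sqsubseteq> w'"
      and "y1 \<sqsubseteq> w \<Longrightarrow> y1 \<sqsubseteq> w'" "y2 \<sqsubseteq> w \<Longrightarrow> y2 \<sqsubseteq> w'" for w w'
  proof (rule interval_le[OF x tc w(1) w'(1) w(3) w'(2)])
    fix r j assume "in_tri m r j" "cap r j < a ?t r j + b x r j"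
    then have "r = r1 \<and> j = j1 \<or> r = r2 \<and> j = j2" by (rule crit)
    moreover have "a w r1 j1 \<le> a w' r1 j1"
      using a_mono[OF w(1) tc w(3) M1(1)] at1 M1(9)[OF w(1,2)] M1(9)[OF w'] that(6)
        a_mono[OF x w' M1(1)] by linarith
    moreover have "a w r2 j2 \<le> a w' r2 j2"
      using a_mono[OF w(1) tc w(3) M2(1)] at2 M2(9)[OF w(1,2)] M2(9)[OF w'] that(7)
        a_mono[OF x w' M2(1)] by linarith
    ultimately show "a w r j \<le> a w' r j" by auto
  qed
  note inc = moves_incomparable[OF x y1 y2 ne] moves_incomparable[OF x y2 y1 ne[symmetric]]
  have "\<exists>C D. polygon_sides L x ?t C D \<and> chain_length C = 2 \<and> chain_length D = 0 + 2"
  proof (rule polygon_sidesI[where u = y1 and z = "\<lambda>_. y2" and l = 0])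
    show "x \<in> carrier L" "?t \<in> carrier L" "y1 \<in> carrier L" "y2 \<in> carrier L"
      by (rule x tc M1(6) M2(6))+
    show "x \<sqsubseteq> y1" "y1 \<sqsubseteq> ?t" "y1 \<noteq> x" "x \<sqsubseteq> y2" "y2 \<sqsubseteq> ?t" "y2 \<noteq> x" using M1(7,8) M2(7,8) yt by auto
    show "y1 \<noteq> ?t" "y2 \<noteq> ?t" using yt inc by auto
    show "\<not> y1 \<sqsubseteq> y2" "\<not> y2 \<sqsubseteq> y1" by (rule inc)+
    show "y2 \<sqsubseteq> y2" using M2(6) by simp
    show "inj_on (\<lambda>_. y2) {..0::nat}" by (simp add: inj_on_def)
    fix w assume w: "w \<in> carrier L" "x \<sqsubseteq> w" "w \<sqsubseteq> ?t"
    have "w = x" if "\<not> y1 \<sqsubseteq> w" "\<not> y2 \<sqsubseteq> w"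
      using side[OF w x] that w x le_antisym by auto
    moreover have "w = y1" if "y1 \<sqsubseteq> w" "\<not> y2 \<sqsubseteq> w"
      using side[OF w M1(6,7)] that w M1(6) le_antisym by auto
    moreover have "w = y2" if "\<not> y1 \<sqsubseteq> w" "y2 \<sqsubseteq> w"
      using side[OF w M2(6,7)] that w M2(6) le_antisym by auto
    moreover have "w = ?t" if "y1 \<sqsubseteq> w" "y2 \<sqsubseteq> w"
      using that join_le[OF that M1(6) M2(6) w(1)] w tc le_antisym by auto
    ultimately show "w = x \<or> w = y1 \<or> w = ?t \<or> (\<exists>i\<le>0::nat. w = y2)" by auto
  qed
  then show ?thesis by (simp add: quadrilateral_def numeral_2_eq_2)
qed

lemma upper_polygon:
  assumes "covers L y1 x" "covers L y2 x" "y1 \<noteq> y2"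
  shows "quadrilateral L x (y1 \<squnion> y2) \<or> heptagon L x (y1 \<squnion> y2)"
proof -
  have x: "x \<in> carrier L" using assms(1) by (simp add: covers_iff)
  obtain r1 j1 where y1: "move x y1 r1 j1" by (rule cover_move[OF assms(1)])
  obtain r2 j2 where y2: "move x y2 r2 j2" by (rule cover_move[OF assms(2)])
  have comm: "y2 \<squnion> y1 = y1 \<squnion> y2" by (rule join_comm)
  show ?thesis
    using heptagonI[OF x y1 y2 assms(3)] heptagonI[OF x y2 y1 assms(3)[symmetric], unfolded comm]
      quadrilateralI[OF x y1 y2 assms(3)] by blast
qed

lemma lower_polygon:
  assumes "covers L x y1" "covers L x y2" "y1 \<noteq> y2"
  shows "quadrilateral L (y1 \<sqinter> y2) x \<or> heptagon L (y1 \<sqinter> y2) x"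
proof -
  interpret d: triangle_lattice "inv_gorder L" m "\<lambda>S. transp m (b S)" "\<lambda>S. transp m (a S)"
    by (rule dual)
  show ?thesis
    using d.upper_polygon[of y1 x y2] assms by (simp add: covers_dual polygon_dual)
qed

lemma polygon_if: "quadrilateral L x y \<or> heptagon L x y \<Longrightarrow> polygon L x y"
  by (auto simp: quadrilateral_def heptagon_def polygon_def)

lemma polygonal: "polygonal L"
  unfolding polygonal_def using upper_polygon lower_polygon polygon_if by blast

lemma polygons_of: "(x, y) \<in> polygons_of L \<Longrightarrow> quadrilateral L x y \<or> heptagon L x y"
  unfolding polygons_of_def using upper_polygon lower_polygon by blast

end

section \<open>Fb-tableaux as arrays\<close>

text \<open>
  With \<open>m = n - 1\<close>, the position \<open>(r, j)\<close> of an array stands for the cell \<open>(r + 1, j)\<close> of the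
  board, so that \<open>r = j\<close> are the border cells. The state \<open>arr_a\<close> counts how far a cell has got
  on its way up the lattice: \<open>0\<close> if its column is empty above, \<open>cap\<close> if its row is empty to the
  left, and in between if it is free, a dot being larger than an empty cell. The cells with both
  parts empty have \<open>arr_a = arr_b = 0\<close>.
\<close>

definition arr_a :: "cell set \<Rightarrow> nat \<Rightarrow> nat \<Rightarrow> nat" where
  "arr_a T r j =
    (if \<not> has_above T (Suc r, j) then 0
     else if \<not> has_left T (Suc r, j) then cap r j
     else if (Suc r, j) \<in> T \<and> r < j then 2 else 1)"

text \<open>A border cell is always filled and its only intermediate state is 1, in both arrays;
  this is why being filled counts only for \<open>r < j\<close>.\<close>

definition arr_b :: "cell set \<Rightarrow> nat \<Rightarrow> nat \<Rightarrow> nat" where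
  "arr_b T r j =
    (if \<not> has_left T (Suc r, j) then 0
     else if \<not> has_above T (Suc r, j) then cap r j
     else cap r j - (if (Suc r, j) \<in> T \<and> r < j then 2 else 1))"

lemma arr_pos:
  "0 < arr_a T r j \<longleftrightarrow> has_above T (Suc r, j)" "0 < arr_b T r j \<longleftrightarrow> has_left T (Suc r, j)"
  by (auto simp: arr_a_def arr_b_def cap_def)

lemma has_above_Suc: "has_above T (Suc i, j) \<longleftrightarrow> has_above T (i, j) \<or> (i, j) \<in> T"
  by (auto simp: has_above_def less_Suc_eq)

lemma has_left_pred: "has_left T (i, j) \<longleftrightarrow> has_left T (i, Suc j) \<or> (i, Suc j) \<in> T"
  unfolding has_left_def fst_conv snd_conv using Suc_lessI Suc_lessD by blast

lemma board_iff:
  "(i, j) \<in> board n \<longleftrightarrow> i = 1 \<and> 1 \<le> j \<and> j \<le> n \<or> 2 \<le> i \<and> i \<le> n \<and> i - 1 \<le> j \<and> j \<le> n"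
  by (auto simp: board_def)

lemma fb_tableauxD:
  assumes "T \<in> fb_tableaux n"
  shows "T \<subseteq> board n" "(1, n) \<in> T" "in_tri (n - 1) r r \<Longrightarrow> (Suc r, r) \<in> T"
    "(i, j) \<in> T \<Longrightarrow> (i, j) \<noteq> (1, n) \<Longrightarrow> has_left T (i, j) \<or> has_above T (i, j)"
proof -
  show "(Suc r, r) \<in> T" if "in_tri (n - 1) r r"
  proof -
    have "(Suc r, r) \<in> border n" using that by (auto simp: border_def)
    then show ?thesis using assms by (auto simp: fb_tableaux_def)
  qed
qed (use assms in \<open>auto simp: fb_tableaux_def root_def\<close>)

lemma arr_free_iff:
  assumes T: "T \<in> fb_tableaux n" and c: "in_tri (n - 1) r j"
  shows "(r < j \<longrightarrow> 0 < arr_a T (Suc r) j) \<longleftrightarrow> has_above T (Suc r, j) \<or> (Suc r, j) \<in> T"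
    and "(r < j \<longrightarrow> 0 < arr_b T r (j - 1)) \<longleftrightarrow> has_left T (Suc r, j) \<or> (Suc r, j) \<in> T"
proof -
  have diag: "(Suc r, j) \<in> T" if "\<not> r < j"
    using that c fb_tableauxD(3)[OF T, of r] by (auto simp: le_antisym)
  show "(r < j \<longrightarrow> 0 < arr_a T (Suc r) j) \<longleftrightarrow> has_above T (Suc r, j) \<or> (Suc r, j) \<in> T"
    using diag unfolding arr_pos has_above_Suc[of T "Suc r"] by blast
  have "Suc (j - 1) = j" using c by simp
  then show "(r < j \<longrightarrow> 0 < arr_b T r (j - 1)) \<longleftrightarrow> has_left T (Suc r, j) \<or> (Suc r, j) \<in> T"
    using diag has_left_pred[of T "Suc r" "j - 1"] unfolding arr_pos by auto
qed

lemma shape_arr: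
  assumes T: "T \<in> fb_tableaux n"
  shows "shape (n - 1) (arr_a T) (arr_b T)"
  unfolding shape_def
proof (intro allI impI)
  fix r j assume c: "in_tri (n - 1) r j"
  have "has_left T (Suc r, j) \<or> has_above T (Suc r, j)" if "(Suc r, j) \<in> T"
    using fb_tableauxD(4)[OF T that] c by auto
  then show "if r < j \<longrightarrow> 0 < arr_a T (Suc r) j
     then if r < j \<longrightarrow> 0 < arr_b T r (j - 1) then arr_a T r j + arr_b T r j = cap r j
       else arr_a T r j = cap r j \<and> arr_b T r j = 0
     else if r < j \<longrightarrow> 0 < arr_b T r (j - 1) then arr_a T r j = 0 \<and> arr_b T r j = cap r j
       else arr_a T r j = 0 \<and> arr_b T r j = 0"
    unfolding arr_free_iff[OF T c] by (auto simp: arr_a_def arr_b_def cap_def)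
qed

subsection \<open>The order\<close>

text \<open>The topmost filled cell of a column is its up-arrow, except in column \<open>n\<close>,
  where it is the root.\<close>

lemma up_arrow_iff:
  assumes "j \<noteq> n"
  shows "(\<exists>i'<i. (i', j) \<in> up_arrows n T) \<longleftrightarrow> has_above T (i, j)"
proof
  assume "has_above T (i, j)"
  then obtain i0 where i0: "(i0, j) \<in> T" "i0 < i" by (auto simp: has_above_def)
  define k where "k = (LEAST k. (k, j) \<in> T)"
  have "(k, j) \<in> T" "k \<le> i0" unfolding k_def by (rule LeastI Least_le, rule i0(1))+
  moreover have "\<not> has_above T (k, j)"
    unfolding has_above_def fst_conv snd_conv using not_less_Least k_def by blast
  ultimately show "\<exists>i'<i. (i', j) \<in> up_arrows n T"
    using assms i0(2) by (intro exI[of _ k]) (auto simp: up_arrows_def root_def)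
qed (auto simp: up_arrows_def has_above_def)

lemma left_arrow_iff:
  assumes "i \<noteq> 1" "T \<subseteq> board n"
  shows "(\<exists>j'>j. (i, j') \<in> left_arrows n T) \<longleftrightarrow> has_left T (i, j)"
proof
  assume "has_left T (i, j)"
  then obtain j0 where j0: "(i, j0) \<in> T" "j0 > j" by (auto simp: has_left_def)
  let ?A = "{k. (i, k) \<in> T}"
  have fin: "finite ?A"
    by (rule finite_subset[of _ "{..n}"]) (use assms(2) in \<open>auto simp: board_iff\<close>)
  have "Max ?A \<in> ?A" by (rule Max_in[OF fin]) (use j0 in auto)
  moreover have "j0 \<le> Max ?A" by (rule Max_ge[OF fin]) (use j0 in auto)
  moreover have "\<not> has_left T (i, Max ?A)"
    using Max_ge[OF fin] by (fastforce simp: has_left_def)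
  ultimately show "\<exists>j'>j. (i, j') \<in> left_arrows n T"
    using assms(1) j0(2) by (intro exI[of _ "Max ?A"]) (auto simp: left_arrows_def root_def)
qed (auto simp: left_arrows_def has_left_def)

lemma Col_iff:
  "(i, j) \<in> Col n T \<longleftrightarrow> (i, j) \<in> board n \<and> (j = n \<or> has_above T (Suc i, j))"
proof (cases "j = n")
  case True
  have "\<exists>i'\<le>i. (i', j) \<in> up_arrows n T \<union> {root n}" if "(i, j) \<in> board n"
    using that True by (intro exI[of _ 1]) (auto simp: root_def board_iff)
  then show ?thesis using True by (auto simp: Col_def)
next
  case False
  have "(i, j) \<in> Col n T \<longleftrightarrow> (i, j) \<in> board n \<and> (\<exists>i'<Suc i. (i', j) \<in> up_arrows n T)"
    using False by (auto simp: Col_def root_def less_Suc_eq_le)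
  then show ?thesis unfolding up_arrow_iff[OF False] using False by simp
qed

lemma Row_iff:
  assumes "T \<subseteq> board n"
  shows "(i, j) \<in> Row n T \<longleftrightarrow> (i, j) \<in> board n \<and> (i = 1 \<or> has_left T (i, j) \<or> (i, j) \<in> T)"
proof (cases "i = 1")
  case True
  have "\<exists>j'\<ge>j. (i, j') \<in> left_arrows n T \<union> {root n}" if "(i, j) \<in> board n"
    using that True by (intro exI[of _ n]) (auto simp: root_def board_iff)
  then show ?thesis using True by (auto simp: Row_def)
next
  case False
  show ?thesis
  proof (cases "(i, j) \<in> board n")
    case True
    then have j: "Suc (j - 1) = j" using False by (auto simp: board_iff)
    then have le: "j \<le> j' \<longleftrightarrow> j - 1 < j'" for j' by linarith
    have "(i, j) \<in> Row n T \<longleftrightarrow> (\<exists>j'\<ge>j. (i, j') \<in> left_arrows n T)"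
      using False True by (simp add: Row_def root_def)
    also have "\<dots> \<longleftrightarrow> (\<exists>j'>j - 1. (i, j') \<in> left_arrows n T)" unfolding le ..
    finally show ?thesis
      unfolding left_arrow_iff[OF False assms] using has_left_pred[of T i "j - 1"] True False j by auto
  qed (auto simp: Row_def)
qed

lemma free_cells_iff:
  assumes "T \<subseteq> board n"
  shows "(i, j) \<in> free_cells n T \<longleftrightarrow>
    (i, j) \<in> board n \<and> 2 \<le> i \<and> j < n \<and> has_above T (i, j) \<and> has_left T (i, j)"
proof (cases "2 \<le> i \<and> j < n")
  case True
  then show ?thesis
    using up_arrow_iff[of j n i T] left_arrow_iff[of i T n j] assms by (auto simp: free_cells_def)
next
  case False
  have "(i', j) \<in> up_arrows n T \<Longrightarrow> (i', j) \<in> board n" "(i, j') \<in> left_arrows n T \<Longrightarrow> (i, j') \<in> board n" for i' j'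
    using assms by (auto simp: up_arrows_def left_arrows_def)
  then have "(i, j) \<notin> free_cells n T"
    using False by (fastforce simp: free_cells_def board_iff)
  then show ?thesis using False by blast
qed

lemma dots_iff:
  "has_above T c \<Longrightarrow> has_left T c \<Longrightarrow> c \<in> dots n T \<longleftrightarrow> c \<in> T"
  by (auto simp: dots_def left_arrows_def up_arrows_def)

text \<open>The sum can exceed \<open>cap\<close> only if both entries are positive. Then the
  inclusions of \<open>Col\<close> and \<open>Row\<close> make the cell free in both tableaux, and
  the bound is the comparison of dots.\<close>

lemma fb_le_iff:
  assumes S: "S \<in> fb_tableaux n" and T: "T \<in> fb_tableaux n"
  shows "fb_le n S T \<longleftrightarrow>
    (\<forall>r j. in_tri (n - 1) r j \<longrightarrow> arr_a S r j + arr_b T r j \<le> cap r j)"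
proof
  note bS = fb_tableauxD(1)[OF S] and bT = fb_tableauxD(1)[OF T]
  assume le: "fb_le n S T"
  show "\<forall>r j. in_tri (n - 1) r j \<longrightarrow> arr_a S r j + arr_b T r j \<le> cap r j"
  proof (intro allI impI)
    fix r j assume c: "in_tri (n - 1) r j"
    show "arr_a S r j + arr_b T r j \<le> cap r j"
    proof (cases "has_above S (Suc r, j) \<and> has_left T (Suc r, j)")
      case False
      then show ?thesis by (auto simp: arr_a_def arr_b_def cap_def)
    next
      case True
      \<comment> \<open>Whether anything lies above \<open>(Suc r, j)\<close> is tested by
        membership of the cell one row up in \<open>Col\<close>.\<close>
      have "(r, j) \<in> board n" using c by (auto simp: board_iff)
      then have "(r, j) \<in> Col n S" using True by (simp add: Col_iff)
      then have "(r, j) \<in> Col n T" using le by (auto simp: fb_le_def)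
      then have aT: "has_above T (Suc r, j)" using c by (auto simp: Col_iff)
      \<comment> \<open>Likewise the cell one column to the left tests \<open>has_left\<close>
        through \<open>Row\<close>; for \<open>j = n - 1\<close> it lies in column
        \<open>n\<close>.\<close>
      have "(Suc r, Suc j) \<in> board n" using c by (auto simp: board_iff)
      then have "(Suc r, Suc j) \<in> Row n T" using True has_left_pred[of T "Suc r" j] by (simp add: Row_iff[OF bT])
      then have "(Suc r, Suc j) \<in> Row n S" using le by (auto simp: fb_le_def)
      then have lS: "has_left S (Suc r, j)" using c has_left_pred[of S "Suc r" j] by (simp add: Row_iff[OF bS])
      have "(Suc r, j) \<in> board n" "2 \<le> Suc r" "j < n" using c by (auto simp: board_iff)
      then have "(Suc r, j) \<in> free_cells n S \<inter> free_cells n T"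
        using True aT lS by (simp add: free_cells_iff[OF bS] free_cells_iff[OF bT])
      then have "(Suc r, j) \<in> dots n S \<longrightarrow> (Suc r, j) \<in> dots n T" using le unfolding fb_le_def by blast
      then have "(Suc r, j) \<in> S \<longrightarrow> (Suc r, j) \<in> T" using True aT lS by (simp add: dots_iff)
      then show ?thesis using True aT lS by (auto simp: arr_a_def arr_b_def cap_def)
    qed
  qed
next
  note bS = fb_tableauxD(1)[OF S] and bT = fb_tableauxD(1)[OF T]
  assume *: "\<forall>r j. in_tri (n - 1) r j \<longrightarrow> arr_a S r j + arr_b T r j \<le> cap r j"
  then have a: "\<forall>r j. in_tri (n - 1) r j \<longrightarrow> arr_a S r j \<le> arr_a T r j"
    by (rule shape_le_iff[OF shape_arr[OF S] shape_arr[OF T], THEN iffD1])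
  have above: "has_above T (Suc r, j)" if "in_tri (n - 1) r j" "has_above S (Suc r, j)" for r j
    using a[rule_format, OF that(1)] that(2) arr_pos(1)[of S r j] arr_pos(1)[of T r j] by linarith
  have left: "has_left S (Suc r, j)" if "in_tri (n - 1) r j" "has_left T (Suc r, j)" for r j
    using shape_le_imp_b_ge[OF shape_arr[OF S] shape_arr[OF T] a that(1)] that(2)
      arr_pos(2)[of S r j] arr_pos(2)[of T r j] by linarith
  show "fb_le n S T"
    unfolding fb_le_def
  proof (intro conjI subsetI ballI impI)
    fix c assume "c \<in> Col n S"
    moreover obtain i j where ij: "c = (i, j)" by (cases c)
    ultimately have b: "(i, j) \<in> board n" and h: "j = n \<or> has_above S (Suc i, j)" by (auto simp: Col_iff)
    have "has_above T (Suc i, j)" if "j \<noteq> n"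
    proof (cases "i \<le> j")
      case True
      then show ?thesis using above[of i j] b h that by (auto simp: board_iff)
    next
      case False
      \<comment> \<open>A border cell has no array position below it, but it is filled in every
        tableau.\<close>
      then have "i = Suc j" "in_tri (n - 1) j j" using b that by (auto simp: board_iff)
      then show ?thesis using fb_tableauxD(3)[OF T, of j] by (simp add: has_above_Suc)
    qed
    then show "c \<in> Col n T" using b ij by (auto simp: Col_iff)
  next
    fix c assume "c \<in> Row n T"
    moreover obtain i j where ij: "c = (i, j)" by (cases c)
    ultimately have b: "(i, j) \<in> board n" and h: "i = 1 \<or> has_left T (i, j) \<or> (i, j) \<in> T"
      by (auto simp: Row_iff[OF bT])
    have "has_left S (i, j) \<or> (i, j) \<in> S" if i1: "i \<noteq> 1"
    proof (cases "i \<le> j")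
      case True
      obtain r k where rk: "i = Suc r" "j = Suc k" using True i1 b by (cases i; cases j) (auto simp: board_iff)
      then have "in_tri (n - 1) r k" using True i1 b by (auto simp: board_iff)
      moreover have "has_left T (Suc r, k)" using h i1 rk by (simp add: has_left_pred[of T _ k])
      ultimately have "has_left S (Suc r, k)" by (rule left)
      then show ?thesis using rk by (simp add: has_left_pred[of S _ k])
    next
      case False
      then have "i = Suc j" "in_tri (n - 1) j j" using b i1 by (auto simp: board_iff)
      then show ?thesis using fb_tableauxD(3)[OF S, of j] by simp
    qed
    then show "c \<in> Row n S" using b ij by (auto simp: Row_iff[OF bS])
  next
    fix c assume free: "c \<in> free_cells n S \<inter> free_cells n T" and dS: "c \<in> dots n S"
    obtain i j where ij: "c = (i, j)" by (cases c)
    have b: "(i, j) \<in> board n" "2 \<le> i" "j < n" and h: "has_above S (i, j)" "has_left S (i, j)"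
      "has_above T (i, j)" "has_left T (i, j)"
      using free ij by (auto simp: free_cells_iff[OF bS] free_cells_iff[OF bT])
    obtain r where r: "i = Suc r" using b(2) by (cases i) auto
    then have t: "in_tri (n - 1) r j" using b by (auto simp: board_iff)
    have "(i, j) \<in> S" using dS h ij by (simp add: dots_iff)
    then have "(i, j) \<in> T"
    proof (cases "r < j")
      case True
      have "arr_a S r j + arr_b T r j \<le> 3" using *[rule_format, OF t] True by (simp add: cap_def)
      then show ?thesis
        using True h r \<open>(i, j) \<in> S\<close> by (auto simp: arr_a_def arr_b_def cap_def split: if_splits)
    next
      case False
      then show ?thesis using t fb_tableauxD(3)[OF T, of j] r by (auto simp: le_antisym)
    qed
    then show "c \<in> dots n T" using h ij by (simp add: dots_iff)
  qed
qed

subsection \<open>Reconstruction of a tableau from its array\<close>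

text \<open>Row 1 and column \<open>n\<close> have no array positions of their own; their cells are
  recovered from the positivity of the neighbouring entries. Elsewhere a cell is filled iff it is
  unshadowed from both sides and, off the border, not in state 1, the state of an empty
  cell.\<close>

definition tab :: "nat \<Rightarrow> (nat \<Rightarrow> nat \<Rightarrow> nat) \<Rightarrow> (nat \<Rightarrow> nat \<Rightarrow> nat) \<Rightarrow> cell set" where
  "tab n g g' = {(i, j) \<in> board n.
     if i = 1 then j = n \<or> 0 < g 1 j
     else if j = n then 0 < g' (i - 1) (n - 1)
     else (i - 1 < j \<longrightarrow> 0 < g i j) \<and> (i - 1 < j \<longrightarrow> 0 < g' (i - 1) (j - 1)) \<and>
       \<not> (i - 1 < j \<and> g (i - 1) j = 1)}"

lemma tab_cell:
  assumes "in_tri (n - 1) r j"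
  shows "(Suc r, j) \<in> tab n g g' \<longleftrightarrow> (r < j \<longrightarrow> 0 < g (Suc r) j) \<and> (r < j \<longrightarrow> 0 < g' r (j - 1)) \<and>
       \<not> (r < j \<and> g r j = 1)"
  using assms by (auto simp: tab_def board_iff)

lemma tab_top: "1 \<le> j \<Longrightarrow> j < n \<Longrightarrow> (1, j) \<in> tab n g g' \<longleftrightarrow> 0 < g 1 j"
  by (auto simp: tab_def board_iff)

lemma tab_left: "1 \<le> r \<Longrightarrow> r \<le> n - 1 \<Longrightarrow> (Suc r, n) \<in> tab n g g' \<longleftrightarrow> 0 < g' r (n - 1)"
  by (auto simp: tab_def board_iff)

lemma tab_board: "tab n g g' \<subseteq> board n"
  by (auto simp: tab_def)

lemma board_cases:
  assumes "(i, j) \<in> board n"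
  obtains "i = 1" "j = n" | "i = 1" "1 \<le> j" "j < n"
    | r where "i = Suc r" "j = n" "1 \<le> r" "r \<le> n - 1"
    | r where "i = Suc r" "in_tri (n - 1) r j"
proof (cases "i = 1")
  case True
  then show thesis using assms that(1,2) by (cases "j = n") (auto simp: board_iff)
next
  case False
  then obtain r where "i = Suc r" "1 \<le> r" using assms by (cases i) (auto simp: board_iff)
  then show thesis using assms that(3)[of r] that(4)[of r] by (cases "j = n") (auto simp: board_iff)
qed

text \<open>Makes the encoding injective, from which antisymmetry of the order follows.\<close>

lemma tab_arr:
  assumes n: "n \<ge> 1" and T: "T \<in> fb_tableaux n"
  shows "tab n (arr_a T) (arr_b T) = T"
proof -
  note bT = fb_tableauxD(1)[OF T]
  have "(i, j) \<in> tab n (arr_a T) (arr_b T) \<longleftrightarrow> (i, j) \<in> T" if b: "(i, j) \<in> board n" for i j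
    using b
  proof (cases rule: board_cases)
    case 1
    then show ?thesis using fb_tableauxD(2)[OF T] b by (simp add: tab_def)
  next
    case 2
    have "\<not> has_above T (1, j)" using bT by (auto simp: has_above_def board_iff)
    then show ?thesis using 2 tab_top[of j n] has_above_Suc[of T 1 j] by (simp add: arr_pos)
  next
    case (3 r)
    have "\<not> has_left T (i, n)" using bT by (auto simp: has_left_def board_iff)
    then show ?thesis
      using 3 tab_left[of r n] has_left_pred[of T i "n - 1"] n by (simp add: arr_pos)
  next
    case (4 r)
    have "has_left T (i, j) \<or> has_above T (i, j)" if "(i, j) \<in> T"
      using fb_tableauxD(4)[OF T that] 4 by auto
    moreover have "(r < j \<and> arr_a T r j = 1) \<longleftrightarrow>
        r < j \<and> has_above T (i, j) \<and> has_left T (i, j) \<and> (i, j) \<notin> T"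
      using 4 by (auto simp: arr_a_def cap_def)
    moreover have "(i, j) \<in> T" if "\<not> r < j"
      using that 4 fb_tableauxD(3)[OF T, of r] by (auto simp: le_antisym)
    ultimately show ?thesis
      unfolding 4(1) tab_cell[OF 4(2)] arr_free_iff[OF T 4(2)] by blast
  qed
  then show ?thesis using bT tab_board by fast
qed

lemma tab_cong:
  assumes "n \<ge> 1" "\<And>r j. in_tri (n - 1) r j \<Longrightarrow> g r j = h r j" "\<And>r j. in_tri (n - 1) r j \<Longrightarrow> g' r j = h' r j"
  shows "tab n g g' = tab n h h'"
proof -
  have "(i, j) \<in> tab n g g' \<longleftrightarrow> (i, j) \<in> tab n h h'" if b: "(i, j) \<in> board n" for i j
    using b
  proof (cases rule: board_cases)
    case 1
    then show ?thesis using b by (simp add: tab_def)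
  next
    case 2
    have "g 1 j = h 1 j" using 2 by (intro assms(2)) auto
    then show ?thesis using 2 tab_top[of j n] by simp
  next
    case (3 r)
    have "g' r (n - 1) = h' r (n - 1)" using 3 by (intro assms(3)) auto
    then show ?thesis using 3 tab_left[of r n] by simp
  next
    case (4 r)
    have "g r j = h r j" using 4 by (intro assms(2)) auto
    moreover have "g (Suc r) j = h (Suc r) j" if "r < j" using that 4 by (intro assms(2)) auto
    moreover have "g' r (j - 1) = h' r (j - 1)" if "r < j" using that 4 by (intro assms(3)) auto
    ultimately show ?thesis unfolding 4(1) tab_cell[OF 4(2)] by auto
  qed
  then show ?thesis using tab_board by fast
qed

context
  fixes n g g'
  assumes n: "n \<ge> 1" and s: "shape (n - 1) g g'"
begin

text \<open>Induction from the top row: by \<open>shape\<close>, the entry below a cell is positive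
  iff the cell's own entry is positive or the cell is filled. The companion for
  \<open>has_left\<close> runs from column \<open>n\<close> in the same way.\<close>

lemma tab_above: "in_tri (n - 1) r j \<Longrightarrow> has_above (tab n g g') (Suc r, j) \<longleftrightarrow> 0 < g r j"
proof (induction r)
  case (Suc r)
  show ?case
  proof (cases "r = 0")
    case True
    have "\<not> has_above (tab n g g') (1, j)" using tab_board by (fastforce simp: has_above_def board_iff)
    moreover have "(1, j) \<in> tab n g g' \<longleftrightarrow> 0 < g 1 j" using Suc.prems by (intro tab_top) auto
    ultimately have "has_above (tab n g g') (Suc 1, j) \<longleftrightarrow> 0 < g 1 j"
      unfolding has_above_Suc[of "tab n g g'" 1] by blast
    then show ?thesis using True by simp
  next
    case False
    then have c: "in_tri (n - 1) r j" and rj: "r < j" using Suc.prems by auto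
    have "has_above (tab n g g') (Suc (Suc r), j) \<longleftrightarrow> 0 < g r j \<or> (Suc r, j) \<in> tab n g g'"
      unfolding has_above_Suc[of _ "Suc r"] using Suc.IH[OF c] by simp
    then show ?thesis
      unfolding tab_cell[OF c] using shape_cell[OF s c] rj by (auto split: if_splits)
  qed
qed simp

lemma tab_has_left: "in_tri (n - 1) r j \<Longrightarrow> has_left (tab n g g') (Suc r, j) \<longleftrightarrow> 0 < g' r j"
proof (induction "n - j" arbitrary: j)
  case (Suc k)
  show ?case
  proof (cases "Suc j = n")
    case True
    have "\<not> has_left (tab n g g') (Suc r, n)" using tab_board by (fastforce simp: has_left_def board_iff)
    moreover have "(Suc r, n) \<in> tab n g g' \<longleftrightarrow> 0 < g' r (n - 1)" using Suc.prems by (intro tab_left) auto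
    moreover have "n - 1 = j" using True by simp
    ultimately show ?thesis
      unfolding has_left_pred[of "tab n g g'" "Suc r" j] True by simp
  next
    case False
    then have c: "in_tri (n - 1) r (Suc j)" and rj: "r < Suc j" using Suc.prems by auto
    have "has_left (tab n g g') (Suc r, j) \<longleftrightarrow> 0 < g' r (Suc j) \<or> (Suc r, Suc j) \<in> tab n g g'"
      unfolding has_left_pred[of _ _ j] using Suc.hyps(1)[OF _ c] Suc.hyps(2) by simp
    then show ?thesis
      unfolding tab_cell[OF c] using shape_cell[OF s c] rj by (auto split: if_splits)
  qed
qed (use n in auto)

lemma tab_fb: "tab n g g' \<in> fb_tableaux n"
  unfolding fb_tableaux_def
proof (intro CollectI conjI ballI impI)
  show "tab n g g' \<subseteq> board n" by (rule tab_board)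
  show root: "root n \<in> tab n g g'" using n by (simp add: root_def tab_def board_iff)
  show "border n \<subseteq> tab n g g'"
  proof
    fix c assume "c \<in> border n"
    then obtain i where i: "c = (i, i - 1)" "2 \<le> i" "i \<le> n" by (auto simp: border_def)
    then have "in_tri (n - 1) (i - 1) (i - 1)" by auto
    from tab_cell[OF this, of g g'] show "c \<in> tab n g g'" using i by simp
  qed
  fix c assume c: "c \<in> tab n g g'" "c \<noteq> root n"
  obtain i j where ij: "c = (i, j)" by (cases c)
  have "(i, j) \<in> board n" using c ij tab_board by auto
  then show "has_left (tab n g g') c \<or> has_above (tab n g g') c"
  proof (cases rule: board_cases)
    case 1
    then show ?thesis using c ij by (simp add: root_def)
  next
    case 2
    then show ?thesis using root ij by (auto simp: has_left_def root_def)
  next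
    case (3 r)
    then show ?thesis using root ij by (auto simp: has_above_def root_def)
  next
    case (4 r)
    have "0 < g r j \<or> 0 < g' r j"
      using c(1) shape_cell[OF s 4(2)] unfolding ij 4(1) tab_cell[OF 4(2)]
      by (auto split: if_splits)
    then show ?thesis
      using tab_above[OF 4(2)] tab_has_left[OF 4(2)] ij 4(1) by auto
  qed
qed

lemma arr_tab:
  assumes c: "in_tri (n - 1) r j"
  shows "arr_a (tab n g g') r j = g r j" "arr_b (tab n g g') r j = g' r j"
proof -
  have "g r j \<le> cap r j" "g' r j \<le> cap r j" using shapeD(6)[OF s c] by auto
  then show "arr_a (tab n g g') r j = g r j" "arr_b (tab n g g') r j = g' r j"
    unfolding arr_a_def arr_b_def tab_above[OF c] tab_has_left[OF c] tab_cell[OF c]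
    using shape_cell[OF s c] by (auto simp: cap_def split: if_splits)
qed

end

lemma finite_fb_tableaux: "finite (fb_tableaux n)"
proof -
  have "board n \<subseteq> {..Suc n} \<times> {..n}" by (auto simp: board_def)
  then have "finite (board n)" by (rule finite_subset) auto
  then show ?thesis
    by (rule_tac finite_subset[of _ "Pow (board n)"]) (auto simp: fb_tableaux_def)
qed

lemma triangle_lattice_esTam:
  assumes n: "n \<ge> 1"
  shows "triangle_lattice (esTam n) (n - 1) arr_a arr_b"
proof
  fix S T assume "S \<in> carrier (esTam n)" "T \<in> carrier (esTam n)"
  then have S: "S \<in> fb_tableaux n" and T: "T \<in> fb_tableaux n" by (auto simp: esTam_def)
  note sS = shape_arr[OF S] and sT = shape_arr[OF T]
  show "S \<sqsubseteq>\<^bsub>esTam n\<^esub> T \<longleftrightarrow> (\<forall>r j. in_tri (n - 1) r j \<longrightarrow> arr_a S r j + arr_b T r j \<le> cap r j)"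
    using fb_le_iff[OF S T] by (simp add: esTam_def)
  assume "S \<sqsubseteq>\<^bsub>esTam n\<^esub> T" "T \<sqsubseteq>\<^bsub>esTam n\<^esub> S"
  then have le: "\<forall>r j. in_tri (n - 1) r j \<longrightarrow> arr_a S r j \<le> arr_a T r j"
    "\<forall>r j. in_tri (n - 1) r j \<longrightarrow> arr_a T r j \<le> arr_a S r j"
    using fb_le_iff[OF S T] fb_le_iff[OF T S] shape_le_iff[OF sS sT] shape_le_iff[OF sT sS]
    by (auto simp: esTam_def)
  have "arr_a S r j = arr_a T r j" "arr_b S r j = arr_b T r j" if c: "in_tri (n - 1) r j" for r j
  proof -
    show "arr_a S r j = arr_a T r j"
      using le(1)[rule_format, OF c] le(2)[rule_format, OF c] by simp
    show "arr_b S r j = arr_b T r j"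
      using shape_le_imp_b_ge[OF sS sT le(1) c] shape_le_imp_b_ge[OF sT sS le(2) c] by simp
  qed
  then have "tab n (arr_a S) (arr_b S) = tab n (arr_a T) (arr_b T)" by (intro tab_cong n)
  then show "S = T" using tab_arr[OF n S] tab_arr[OF n T] by simp
next
  show "finite (carrier (esTam n))" by (simp add: esTam_def finite_fb_tableaux)
  show "(.=\<^bsub>esTam n\<^esub>) = (=)" by (simp add: esTam_def)
  show "shape (n - 1) (arr_a S) (arr_b S)" if "S \<in> carrier (esTam n)" for S
    using that shape_arr by (simp add: esTam_def)
  show "\<exists>S\<in>carrier (esTam n). \<forall>r j. in_tri (n - 1) r j \<longrightarrow> arr_a S r j = g r j \<and> arr_b S r j = g' r j"
    if "shape (n - 1) g g'" for g g'
    using tab_fb[OF n that] arr_tab[OF n that] by (intro bexI[of _ "tab n g g'"]) (auto simp: esTam_def)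
qed

theorem theorem1p4:
  fixes n :: nat
  assumes "n \<ge> 1"
  shows "finite_lattice (esTam n) \<and>
    semidistributive (esTam n) \<and>
    extremal (esTam n) \<and>
    trim (esTam n) \<and>
    (polygonal (esTam n) \<and>
      (\<forall>(x, y) \<in> polygons_of (esTam n). quadrilateral (esTam n) x y \<or> heptagon (esTam n) x y)) \<and>
    congruence_uniform (esTam n)"
proof -
  interpret triangle_lattice "esTam n" "n - 1" arr_a arr_b
    by (rule triangle_lattice_esTam[OF assms])
  show ?thesis
    using finite_lattice_axioms semidistributive extremal trim polygonal polygons_of congruence_uniform
    by blast
qed

end
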